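(* Let $h=\hat h\circ\tilde h:\Sigma^c\to\mathcal R$ be a random tornado tabulation hash function with $d$ derived characters, let $Q\subseteq\Sigma^c$ be a set of query keys and $f$ a selector function with query keys $Q$. If $\mu^f\le|\Sigma|/2$, then the set of derived selected keys $\tilde h(X^{f,h})$ is linearly dependent with probability at most $$\mathsf{DependenceProb}(\mu^f,d,\Sigma):=7(\mu^f)^3\left(\frac{3}{|\Sigma|}\right)^{d+1}+\frac{1}{2^{|\Sigma|/2}}.$$
   Context: Let $\Sigma=\{0,1,\dots,2^k-1\}$ be an alphabet of characters, identified with $k$-bit strings, where $\oplus$ denotes bitwise xor; throughout $|\Sigma|\ge 2^8$. Let $\mathcal R=\{0,\dots,2^r-1\}$, viewed as $r$-bit strings. A simple tabulation hash function $g:\Sigma^b\to\mathcal R'$ is $g(x_1\cdots x_b)=T_1[x_1]\oplus\cdots\oplus T_b[x_b]$ with independent fully random tables $T_i:\Sigma\to\mathcal R'$. A random tornado tabulation hash function $h:\Sigma^c\to\mathcal R$ with $d\ge1$ derived characters consists of mutually independent simple tabulation functions $\tilde h_i:\Sigma^{c+i-1}\to\Sigma$ ($i=0,\dots,d$) and $\hat h:\Sigma^{c+d}\to\mathcal R$; for $x=x_1\cdots x_c$ the derived key $\tilde h(x)=\tilde x_1\cdots\tilde x_{c+d}$ has $\tilde x_i=x_i$ for $i<c$, $\tilde x_c=x_c\oplus\tilde h_0(\tilde x_1\cdots\tilde x_{c-1})$, $\tilde x_i=\tilde h_{i-c}(\tilde x_1\cdots\tilde x_{i-1})$ for $c<i\le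 c+d$, and $h(x)=\hat h(\tilde h(x))$. A selector function with query keys $Q\subseteq\Sigma^c$ is a function $f:\Sigma^c\times\mathcal R\times\mathcal R^Q\to\{0,1\}$ with $f(q,\cdot,\cdot)=1$ for all $q\in Q$. The selected set is $X^{f,h}=\{x\in\Sigma^c: f(x,h(x),h|_Q)=1\}$. Define $p^f_x=\max_{\varphi\in\mathcal R^Q}\Pr_{r\sim\mathcal U(\mathcal R)}[f(x,r,\varphi)=1]$ and $\mu^f=\sum_{x\in\Sigma^c}p^f_x$. A set $Y\subseteq\Sigma^b$ of keys is linearly dependent if there is a nonempty $Y'\subseteq Y$ such that for every position $i\in\{1,\dots,b\}$ and every character $a\in\Sigma$, the number of $y\in Y'$ with $y_i=a$ is even; otherwise it is linearly independent. *)

theory Defs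
  imports "HOL-Probability.Probability"
begin

text \<open>Alphabet Sigma = {0..<2^k}; keys in Sigma^b are lists of length b.
  Range R' = {0..<m}. Bitwise xor is the library's xor on nat.\<close>

definition keys :: "nat \<Rightarrow> nat \<Rightarrow> nat list set" where
  "keys s b = {xs. length xs = b \<and> set xs \<subseteq> {..<s}}"

text \<open>A table family for a simple tabulation function Sigma^b -> {0..<m}:
  T i a is table T_(i+1) at character a (for i < b, a < s); extensional (0 elsewhere).\<close>
definition tab_tables :: "nat \<Rightarrow> nat \<Rightarrow> nat \<Rightarrow> (nat \<Rightarrow> nat \<Rightarrow> nat) set" where
  "tab_tables s b m = {T. (\<forall>i a. T i a < m) \<and>
       (\<forall>i a. (b \<le> i \<or> s \<le> a) \<longrightarrow> T i a = 0)}"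

definition simple_tab :: "(nat \<Rightarrow> nat \<Rightarrow> nat) \<Rightarrow> nat list \<Rightarrow> nat" where
  "simple_tab T xs = foldr xor (map (\<lambda>i. T i (xs ! i)) [0..<length xs]) 0"

text \<open>Derived key: TT j are the tables of \<tilde>h_j. derived_key TT c j x is the prefix
  \<tilde>x_1 ... \<tilde>x_(c+j).\<close>
fun derived_key :: "(nat \<Rightarrow> nat \<Rightarrow> nat \<Rightarrow> nat) \<Rightarrow> nat \<Rightarrow> nat \<Rightarrow> nat list \<Rightarrow> nat list" where
  "derived_key TT c 0 x =
     take (c - 1) x @ [xor (x ! (c - 1)) (simple_tab (TT 0) (take (c - 1) x))]"
| "derived_key TT c (Suc j) x =
     (let y = derived_key TT c j x in y @ [simple_tab (TT (Suc j)) y])"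

definition tornado :: "(nat \<Rightarrow> nat \<Rightarrow> nat \<Rightarrow> nat) \<Rightarrow> (nat \<Rightarrow> nat \<Rightarrow> nat) \<Rightarrow> nat \<Rightarrow> nat \<Rightarrow> nat list \<Rightarrow> nat" where
  "tornado TT H c d x = simple_tab H (derived_key TT c d x)"

text \<open>Sample space of a random tornado tabulation function: all table choices
  (tables of \<tilde>h_0..\<tilde>h_d and of \<hat>h), drawn uniformly, i.e. fully random independent tables.\<close>
definition tornado_space :: "nat \<Rightarrow> nat \<Rightarrow> nat \<Rightarrow> nat \<Rightarrow>
    ((nat \<Rightarrow> nat \<Rightarrow> nat \<Rightarrow> nat) \<times> (nat \<Rightarrow> nat \<Rightarrow> nat)) set" where
  "tornado_space k r c d = {(TT, H).
      (\<forall>j\<le>d. TT j \<in> tab_tables (2^k) (c + j - 1) (2^k)) \<and>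
      (\<forall>j>d. TT j = (\<lambda>_ _. 0)) \<and>
      H \<in> tab_tables (2^k) (c + d) (2^r)}"

definition query_vals :: "nat list set \<Rightarrow> nat \<Rightarrow> (nat list \<Rightarrow> nat) set" where
  "query_vals Q r = {\<phi>. (\<forall>q\<in>Q. \<phi> q < 2^r) \<and> (\<forall>q. q \<notin> Q \<longrightarrow> \<phi> q = 0)}"

definition restr :: "nat list set \<Rightarrow> (nat list \<Rightarrow> nat) \<Rightarrow> nat list \<Rightarrow> nat" where
  "restr Q g = (\<lambda>q. if q \<in> Q then g q else 0)"

definition is_selector :: "nat \<Rightarrow> nat \<Rightarrow> nat \<Rightarrow> nat list set \<Rightarrow>
    (nat list \<Rightarrow> nat \<Rightarrow> (nat list \<Rightarrow> nat) \<Rightarrow> bool) \<Rightarrow> bool" where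
  "is_selector k r c Q f \<longleftrightarrow> Q \<subseteq> keys (2^k) c \<and>
     (\<forall>q\<in>Q. \<forall>v<2^r. \<forall>\<phi>\<in>query_vals Q r. f q v \<phi>)"

definition sel_prob :: "nat \<Rightarrow> nat list set \<Rightarrow>
    (nat list \<Rightarrow> nat \<Rightarrow> (nat list \<Rightarrow> nat) \<Rightarrow> bool) \<Rightarrow> nat list \<Rightarrow> real" where
  "sel_prob r Q f x = Max ((\<lambda>\<phi>. real (card {v. v < 2^r \<and> f x v \<phi>}) / 2^r) ` query_vals Q r)"

definition sel_mu :: "nat \<Rightarrow> nat \<Rightarrow> nat \<Rightarrow> nat list set \<Rightarrow>
    (nat list \<Rightarrow> nat \<Rightarrow> (nat list \<Rightarrow> nat) \<Rightarrow> bool) \<Rightarrow> real" where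
  "sel_mu k r c Q f = (\<Sum>x\<in>keys (2^k) c. sel_prob r Q f x)"

definition selected :: "nat \<Rightarrow> nat \<Rightarrow> nat list set \<Rightarrow>
    (nat list \<Rightarrow> nat \<Rightarrow> (nat list \<Rightarrow> nat) \<Rightarrow> bool) \<Rightarrow> (nat list \<Rightarrow> nat) \<Rightarrow> nat list set" where
  "selected k c Q f h = {x \<in> keys (2^k) c. f x (h x) (restr Q h)}"

definition lin_dep :: "nat \<Rightarrow> nat \<Rightarrow> nat list set \<Rightarrow> bool" where
  "lin_dep s b Y \<longleftrightarrow> (\<exists>Y'. Y' \<subseteq> Y \<and> Y' \<noteq> {} \<and>
      (\<forall>i<b. \<forall>a<s. even (card {y\<in>Y'. y ! i = a})))"

definition dependence_prob :: "real \<Rightarrow> nat \<Rightarrow> nat \<Rightarrow> real" where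
  "dependence_prob \<mu> d s = 7 * \<mu>^3 * (3 / real s)^(d+1) + 1 / 2 powr (real s / 2)"

end

theory Submission
  imports Defs
begin

text \<open>
  A dependent set of derived keys contains a minimal zero set \<open>Z\<close>, and at every level \<open>n \<le> d\<close> the
  vertices of a zero set can be perfectly matched into pairs with the same derived character.
  Pairs whose prefixes are linearly independent agree with probability \<open>1 / |\<Sigma>|\<close> each, independently, and
  of a minimal dependent set of pairs any pair may be left out to get an independent set.
  At the two top levels the pairs are explored along the alternating cycles of the two matchings
  until the lower one becomes dependent; this yields \<open>2 m - 1\<close> selected keys, of total weight
  \<open>\<mu>\<^bsup>2 m - 1\<^esup> / (2 m - 1)!\<close>, two near-perfect matchings, and thus a factor
  \<open>(2 m - 1)!!\<^sup>2 / |\<Sigma>|\<^bsup>2 (m - 1)\<^esup>\<close>.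
  Every further level costs a factor \<open>3 / |\<Sigma>|\<close>, up to a factor \<open>obstruction_bound m\<close> that is paid for by
  the decay in \<open>m\<close>. Explorations that go beyond \<open>m \<approx> 17 |\<Sigma>| / 64\<close> are cut off and give the term
  \<open>2\<^bsup>- |\<Sigma>| / 2\<^esup>\<close>.
\<close>

text \<open>Two costs shape the argument. Choosing all \<open>2 m\<close> keys of an exploration
  would give \<open>\<mu> ^ (2 * m)\<close>, one factor too many already at \<open>m = 2\<close>,
  where only \<open>\<mu> ^ 3\<close> is affordable; and the keys of a zero set are not hashed
  independently. Both are met by leaving out one vertex, the end \<open>b\<close> of the walk: no
  pair containing it is inspected in either matching, and the other vertices avoid a key
  \<open>x\<close> without which the minimal zero set is independent modulo the queries. The
  stand-in \<open>[]\<close> for \<open>b\<close> keeps the count one of perfect matchings on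
  \<open>2 m\<close> points. The factor 3 comes from the smallest obstruction of a level: four keys,
  three ways to pair them and, with one pair left out, one agreement of probability
  \<open>1 / s\<close>, where \<open>s\<close> is the size of the alphabet. The cut-off lies just
  above \<open>s / 4\<close>: as \<open>\<mu>\<close> is at most \<open>s / 2\<close>, the weight
  has decayed to about \<open>2 ^ -(s / 2)\<close> there, and the excess of \<open>17 / 64\<close>
  over \<open>16 / 64\<close> absorbs polynomial factors. Up to that size
  \<open>obstruction_bound\<close> still grows with a base below 4, so that the sum over
  \<open>m\<close> converges.\<close>

lemma xor_less_pow2:
  fixes a b :: nat
  assumes "a < 2 ^ n" "b < 2 ^ n"
  shows "xor a b < 2 ^ n"
  using assms by (simp flip: take_bit_nat_eq_self_iff add: take_bit_xor)

lemma xor_nat_eq_iff: "xor a b = c \<longleftrightarrow> b = xor a c" for a b c :: nat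
  by (metis xor.assoc xor.left_neutral xor_self_eq)

subsection \<open>Separating functionals over the field with two elements\<close>

lemma odd_card_xor:
  assumes "finite D"
  shows "odd (card {p \<in> D. P p \<noteq> Q p}) \<longleftrightarrow> odd (card {p \<in> D. P p}) \<noteq> odd (card {p \<in> D. Q p})"
  using assms
proof (induction D rule: finite_induct)
  case empty
  then show ?case by simp
next
  case (insert x D)
  have *: "card {p \<in> insert x D. R p} = (if R x then Suc (card {p \<in> D. R p}) else card {p \<in> D. R p})" for R
  proof -
    have "{p \<in> insert x D. R p} = (if R x then insert x {p \<in> D. R p} else {p \<in> D. R p})"
      by auto
    then show ?thesis using insert by auto
  qed
  show ?case unfolding * using insert.IH by auto
qed

text \<open>Duality over the two-element field: by hypothesis \<open>a0\<close> lies outside the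
  span of the \<open>a i\<close>, and \<open>D\<close> is a functional that kills the span but not
  \<open>a0\<close>. When \<open>b\<close> is added, take functionals for \<open>a0\<close> and for
  \<open>a0 + a b\<close>, both killing the old vectors: one of them works, or else their
  sum.\<close>

lemma separating_set_exists:
  fixes a :: "'i \<Rightarrow> 'p \<Rightarrow> bool"
  assumes "finite B" "finite P"
    and "\<And>J. J \<subseteq> B \<Longrightarrow> \<exists>p\<in>P. a0 p \<noteq> odd (card {i \<in> J. a i p})"
  shows "\<exists>D\<subseteq>P. odd (card {p \<in> D. a0 p}) \<and> (\<forall>i\<in>B. even (card {p \<in> D. a i p}))"
  using assms(1,3)
proof (induction B arbitrary: a0 rule: finite_induct)
  case empty
  obtain p where p: "p \<in> P" "a0 p" using empty[of "{}"] by auto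
  then have "{q \<in> {p}. a0 q} = {p}" by auto
  then show ?case using p by (intro exI[of _ "{p}"]) auto
next
  case (insert b B)
  have "\<exists>D\<subseteq>P. odd (card {p \<in> D. a0 p}) \<and> (\<forall>i\<in>B. even (card {p \<in> D. a i p}))"
    by (rule insert.IH) (use insert.prems in blast)
  then obtain D1 where D1: "D1 \<subseteq> P" "odd (card {p \<in> D1. a0 p})" "\<forall>i\<in>B. even (card {p \<in> D1. a i p})"
    by blast
  have "\<exists>D\<subseteq>P. odd (card {p \<in> D. a0 p \<noteq> a b p}) \<and> (\<forall>i\<in>B. even (card {p \<in> D. a i p}))"
  proof (rule insert.IH)
    fix J assume J: "J \<subseteq> B"
    obtain p where p: "p \<in> P" "a0 p \<noteq> odd (card {i \<in> insert b J. a i p})"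
      using insert.prems[of "insert b J"] J by blast
    have bJ: "b \<notin> J" "finite J" using J insert.hyps finite_subset by auto
    have "{i \<in> insert b J. a i p} = (if a b p then insert b {i \<in> J. a i p} else {i \<in> J. a i p})"
      by auto
    then have "card {i \<in> insert b J. a i p} =
        (if a b p then Suc (card {i \<in> J. a i p}) else card {i \<in> J. a i p})"
      using bJ by auto
    then show "\<exists>p\<in>P. (a0 p \<noteq> a b p) \<noteq> odd (card {i \<in> J. a i p})"
      using p by (intro bexI[of _ p]) (auto split: if_splits)
  qed
  then obtain D2 where D2: "D2 \<subseteq> P" "odd (card {p \<in> D2. a0 p \<noteq> a b p})"
      "\<forall>i\<in>B. even (card {p \<in> D2. a i p})"
    by blast
  have fin: "finite D1" "finite D2" using D1(1) D2(1) assms(2) finite_subset by auto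
  \<comment> \<open>The symmetric difference is the sum of the functionals \<open>D1\<close> and
    \<open>D2\<close>. It is needed when both are 1 on \<open>a b\<close> while only
    \<open>D1\<close> is 1 on \<open>a0\<close>.\<close>
  define D3 where "D3 = {p \<in> P. (p \<in> D1) \<noteq> (p \<in> D2)}"
  have D3: "odd (card {p \<in> D3. R p}) \<longleftrightarrow> odd (card {p \<in> D1. R p}) \<noteq> odd (card {p \<in> D2. R p})" for R
  proof -
    have "{p \<in> D3. R p} = {p \<in> {p \<in> P. R p}. (p \<in> D1) \<noteq> (p \<in> D2)}"
      unfolding D3_def by auto
    moreover have "{p \<in> {p \<in> P. R p}. p \<in> D1} = {p \<in> D1. R p}" "{p \<in> {p \<in> P. R p}. p \<in> D2} = {p \<in> D2. R p}"
      using D1(1) D2(1) by auto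
    ultimately show ?thesis
      using odd_card_xor[of "{p \<in> P. R p}" "\<lambda>p. p \<in> D1" "\<lambda>p. p \<in> D2"] assms(2) by simp
  qed
  have ab: "odd (card {p \<in> D2. a0 p}) \<noteq> odd (card {p \<in> D2. a b p})"
    using D2(2) odd_card_xor[OF fin(2)] by blast
  consider "even (card {p \<in> D1. a b p})"
    | "odd (card {p \<in> D1. a b p})" "odd (card {p \<in> D2. a0 p})"
    | "odd (card {p \<in> D1. a b p})" "even (card {p \<in> D2. a0 p})"
    by blast
  then show ?case
  proof cases
    case 1
    then show ?thesis using D1 by (intro exI[of _ D1]) auto
  next
    case 2
    then show ?thesis using D2 ab by (intro exI[of _ D2]) auto
  next
    case 3
    have "D3 \<subseteq> P" unfolding D3_def by auto
    then show ?thesis using D1 D2 ab 3 D3 by (intro exI[of _ D3]) blast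
  qed
qed

subsection \<open>Uniformity of simple tabulation\<close>

text \<open>Uniform randomness of the tables enters only through these involutions of the table
  space. A xor of table entries moves by \<open>u\<close> if an odd number of its entries lie in
  \<open>D\<close>, and stays fixed otherwise.\<close>

definition shift_table :: "(nat \<times> nat) set \<Rightarrow> nat \<Rightarrow> (nat \<Rightarrow> nat \<Rightarrow> nat) \<Rightarrow> nat \<Rightarrow> nat \<Rightarrow> nat" where
  "shift_table D u T = (\<lambda>i a. if (i, a) \<in> D then xor (T i a) u else T i a)"

lemma shift_table_shift_table [simp]: "shift_table D u (shift_table D u T) = T"
  by (auto simp: shift_table_def xor.assoc intro!: ext)

lemma shift_table_in_tab_tables:
  assumes "D \<subseteq> {..<b} \<times> {..<s}" "u < 2 ^ r" "T \<in> tab_tables s b (2 ^ r)"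
  shows "shift_table D u T \<in> tab_tables s b (2 ^ r)"
  using assms by (auto simp: tab_tables_def shift_table_def intro!: xor_less_pow2)

lemma simple_tab_less:
  assumes "T \<in> tab_tables s b (2 ^ r)"
  shows "simple_tab T xs < 2 ^ r"
proof -
  have "foldr xor (map (\<lambda>i. T i (xs ! i)) is) 0 < (2 ^ r :: nat)" for "is"
    using assms by (induction "is") (auto simp: tab_tables_def intro!: xor_less_pow2)
  then show ?thesis by (simp add: simple_tab_def)
qed

lemma simple_tab_shift_table:
  "simple_tab (shift_table D u T) xs =
     xor (simple_tab T xs) (if odd (card {i. i < length xs \<and> (i, xs ! i) \<in> D}) then u else 0)"
proof -
  have "foldr xor (map (\<lambda>i. shift_table D u T i (xs ! i)) [0..<n]) z =
     xor (foldr xor (map (\<lambda>i. T i (xs ! i)) [0..<n]) z)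
       (if odd (card {i. i < n \<and> (i, xs ! i) \<in> D}) then u else 0)" for n z
  proof (induction n arbitrary: z)
    case 0
    then show ?case by simp
  next
    case (Suc n)
    have fold_xor: "foldr xor ys (xor w z) = xor (foldr xor ys w) z" for ys and w z :: nat
      by (induction ys) (auto simp: xor.assoc)
    have "{i. i < Suc n \<and> (i, xs ! i) \<in> D} =
        (if (n, xs ! n) \<in> D then insert n {i. i < n \<and> (i, xs ! i) \<in> D} else {i. i < n \<and> (i, xs ! i) \<in> D})"
      by (auto simp: less_Suc_eq)
    then have c: "card {i. i < Suc n \<and> (i, xs ! i) \<in> D} =
        (if (n, xs ! n) \<in> D then Suc (card {i. i < n \<and> (i, xs ! i) \<in> D})
         else card {i. i < n \<and> (i, xs ! i) \<in> D})"
      by auto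
    have uu: "xor u (xor u w) = w" for w :: nat
      by (metis xor.assoc xor.left_neutral xor_self_eq)
    show ?case
      using Suc.IH[of "xor (T n (xs ! n)) z"] Suc.IH[of "xor (xor (T n (xs ! n)) u) z"]
      unfolding c
      by (auto simp: shift_table_def fold_xor xor.commute xor.left_commute xor.assoc uu)
  qed
  then show ?thesis by (simp add: simple_tab_def)
qed

lemma finite_tab_tables [simp]: "finite (tab_tables s b m)"
proof -
  let ?F = "({..<b} \<times> {..<s}) \<rightarrow>\<^sub>E {..<m}"
  have "tab_tables s b m \<subseteq> (\<lambda>g i a. if i < b \<and> a < s then g (i, a) else 0) ` ?F"
  proof
    fix T assume T: "T \<in> tab_tables s b m"
    define g where "g = restrict (\<lambda>(i, a). T i a) ({..<b} \<times> {..<s})"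
    have "g \<in> ?F" using T by (auto simp: g_def tab_tables_def)
    moreover have "T = (\<lambda>i a. if i < b \<and> a < s then g (i, a) else 0)"
      using T by (auto simp: g_def tab_tables_def not_less intro!: ext)
    ultimately show "T \<in> (\<lambda>g i a. if i < b \<and> a < s then g (i, a) else 0) ` ?F" by blast
  qed
  then show ?thesis by (rule finite_subset) (auto intro!: finite_imageI finite_PiE)
qed

lemma tab_tables_nonempty: "m > 0 \<Longrightarrow> tab_tables s b m \<noteq> {}"
  by (auto simp: tab_tables_def intro!: exI[of _ "\<lambda>_ _. 0"])

lemma card_tab_tables_pos: "m > 0 \<Longrightarrow> 0 < card (tab_tables s b m)"
  by (simp add: card_gt_0_iff tab_tables_nonempty)

lemma card_filter_eq_sum: "finite A \<Longrightarrow> real (card {x \<in> A. P x}) = (\<Sum>x\<in>A. if P x then 1 else 0)"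
  using sum.inter_filter[of A "\<lambda>_. 1 :: real" P] by simp

text \<open>Double counting over the orbits of the shifts: along each orbit \<open>val\<close> runs through the whole range.\<close>

lemma card_shift_invariant:
  fixes p :: real and val :: "'t \<Rightarrow> nat"
  assumes "finite \<Omega>"
    and \<sigma>: "\<And>u T. u < 2 ^ r \<Longrightarrow> T \<in> \<Omega> \<Longrightarrow> \<sigma> u T \<in> \<Omega>"
    and inv: "\<And>u T. u < 2 ^ r \<Longrightarrow> T \<in> \<Omega> \<Longrightarrow> \<sigma> u (\<sigma> u T) = T"
    and P: "\<And>u T. u < 2 ^ r \<Longrightarrow> T \<in> \<Omega> \<Longrightarrow> P (\<sigma> u T) = P T"
    and R: "\<And>u T. u < 2 ^ r \<Longrightarrow> T \<in> \<Omega> \<Longrightarrow> R (\<sigma> u T) = R T"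
    and val: "\<And>u T. u < 2 ^ r \<Longrightarrow> T \<in> \<Omega> \<Longrightarrow> val (\<sigma> u T) = xor (val T) u"
    and less: "\<And>T. T \<in> \<Omega> \<Longrightarrow> val T < 2 ^ r"
    and card: "\<And>T. T \<in> \<Omega> \<Longrightarrow> real (card {v. v < 2 ^ r \<and> v \<in> R T}) \<le> p * 2 ^ r"
  shows "real (card {T \<in> \<Omega>. P T \<and> val T \<in> R T}) \<le> p * real (card {T \<in> \<Omega>. P T})"
proof -
  let ?A = "{T \<in> \<Omega>. P T \<and> val T \<in> R T}" and ?U = "{..<2 ^ r} :: nat set" and ?B = "{T \<in> \<Omega>. P T}"
  \<comment> \<open>Each shift is a bijection of the table space, so the count may be averaged over
    all \<open>u\<close>; for fixed \<open>T\<close> the value \<open>xor (val T) u\<close> is then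
    uniform.\<close>
  have eq: "card {T \<in> ?B. xor (val T) u \<in> R T} = card ?A" if "u < 2 ^ r" for u
    by (rule sym, rule bij_betw_same_card[of "\<sigma> u"], rule bij_betw_byWitness[of _ "\<sigma> u"])
       (use that \<sigma> inv P R val in \<open>auto simp: xor.assoc\<close>)
  have "2 ^ r * real (card ?A) = (\<Sum>u\<in>?U. real (card ?A))"
    by simp
  also have "\<dots> = (\<Sum>u\<in>?U. real (card {T \<in> ?B. xor (val T) u \<in> R T}))"
    by (rule sum.cong) (simp_all only: eq lessThan_iff)
  also have "\<dots> = (\<Sum>u\<in>?U. \<Sum>T\<in>?B. if xor (val T) u \<in> R T then 1 else 0)"
    using assms(1) by (intro sum.cong refl card_filter_eq_sum) simp
  also have "\<dots> = (\<Sum>T\<in>?B. \<Sum>u\<in>?U. if xor (val T) u \<in> R T then 1 else 0)"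
    by (rule sum.swap)
  also have "\<dots> = (\<Sum>T\<in>?B. real (card {u. u < 2 ^ r \<and> xor (val T) u \<in> R T}))"
    using card_filter_eq_sum[of ?U] by simp
  also have "\<dots> \<le> (\<Sum>T\<in>?B. p * 2 ^ r)"
  proof (rule sum_mono)
    fix T assume T: "T \<in> ?B"
    have "card {u. u < 2 ^ r \<and> xor (val T) u \<in> R T} = card {v. v < 2 ^ r \<and> v \<in> R T}"
      by (rule bij_betw_same_card[of "xor (val T)"], rule bij_betw_byWitness[of _ "xor (val T)"])
         (use less T in \<open>auto simp: xor.assoc[symmetric] intro!: xor_less_pow2\<close>)
    then show "real (card {u. u < 2 ^ r \<and> xor (val T) u \<in> R T}) \<le> p * 2 ^ r"
      using card T by simp
  qed
  also have "\<dots> = 2 ^ r * (p * real (card ?B))" by simp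
  finally show ?thesis by simp
qed

text \<open>\<open>val i\<close> is the xor of the table entries at the positions selected by \<open>a i\<close>; only its
  behaviour under shifts matters.\<close>

lemma card_independent_values:
  fixes val :: "'i \<Rightarrow> (nat \<Rightarrow> nat \<Rightarrow> nat) \<Rightarrow> nat" and a :: "'i \<Rightarrow> nat \<times> nat \<Rightarrow> bool" and b s r :: nat and p :: "'i \<Rightarrow> real"
  defines "P \<equiv> {..<b} \<times> {..<s}"
  assumes finS: "finite S" and finQ: "finite Q" and disj: "S \<inter> Q = {}"
    and indep: "\<And>J. J \<subseteq> S \<union> Q \<Longrightarrow> J \<inter> S \<noteq> {} \<Longrightarrow> \<exists>q\<in>P. odd (card {i \<in> J. a i q})"
    and val: "\<And>i D u T. i \<in> S \<union> Q \<Longrightarrow> D \<subseteq> P \<Longrightarrow> u < 2 ^ r \<Longrightarrow>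
       val i (shift_table D u T) = xor (val i T) (if odd (card {q \<in> D. a i q}) then u else 0)"
    and less: "\<And>i T. i \<in> S \<Longrightarrow> T \<in> tab_tables s b (2 ^ r) \<Longrightarrow> val i T < 2 ^ r"
    and R: "\<And>i T T'. i \<in> S \<Longrightarrow> (\<And>q. q \<in> Q \<Longrightarrow> val q T = val q T') \<Longrightarrow> R i T = R i T'"
    and card: "\<And>i T. i \<in> S \<Longrightarrow> T \<in> tab_tables s b (2 ^ r) \<Longrightarrow>
       real (card {v. v < 2 ^ r \<and> v \<in> R i T}) \<le> p i * 2 ^ r"
  shows "real (card {T \<in> tab_tables s b (2 ^ r). \<forall>i\<in>S. val i T \<in> R i T}) \<le>
     (\<Prod>i\<in>S. p i) * real (card (tab_tables s b (2 ^ r)))"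
proof -
  have finP: "finite P" by (simp add: P_def)
  have "real (card {T \<in> tab_tables s b (2 ^ r). \<forall>i\<in>S'. val i T \<in> R i T}) \<le>
     (\<Prod>i\<in>S'. p i) * real (card (tab_tables s b (2 ^ r)))" if "S' \<subseteq> S" for S'
    using finite_subset[OF that finS] that
  proof (induction S' rule: finite_induct)
    case empty
    then show ?case by simp
  next
    case (insert e S')
    have e: "e \<in> S" "S' \<subseteq> S" "\<And>i. i \<in> S' \<Longrightarrow> i \<in> S" using insert.prems by auto
    \<comment> \<open>Shifting along this \<open>D\<close> moves \<open>val e\<close> but none of
      the earlier values and none of those of \<open>Q\<close>, so it preserves the conditions
      already imposed as well as the target set \<open>R e\<close>.\<close>
    have "\<exists>D\<subseteq>P. odd (card {q \<in> D. a e q}) \<and> (\<forall>i\<in>S' \<union> Q. even (card {q \<in> D. a i q}))"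
    proof (rule separating_set_exists[OF _ finP])
      show "finite (S' \<union> Q)" using insert.hyps finQ by auto
      fix J assume J: "J \<subseteq> S' \<union> Q"
      have eJ: "e \<notin> J" "finite J"
        using J e insert.hyps finQ disj finite_subset[OF J] by auto
      have "insert e J \<subseteq> S \<union> Q" "insert e J \<inter> S \<noteq> {}" using J e by auto
      then obtain q where q: "q \<in> P" "odd (card {i \<in> insert e J. a i q})"
        using indep by blast
      have "{i \<in> insert e J. a i q} = (if a e q then insert e {i \<in> J. a i q} else {i \<in> J. a i q})"
        by auto
      then have "card {i \<in> insert e J. a i q} =
          (if a e q then Suc (card {i \<in> J. a i q}) else card {i \<in> J. a i q})"
        using eJ by auto
      then show "\<exists>q\<in>P. a e q \<noteq> odd (card {i \<in> J. a i q})"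
        using q by (intro bexI[of _ q]) (auto split: if_splits)
    qed
    then obtain D where D: "D \<subseteq> P" "odd (card {q \<in> D. a e q})" "\<forall>i\<in>S' \<union> Q. even (card {q \<in> D. a i q})"
      by blast
    have val_e: "val e (shift_table D u T) = xor (val e T) u" if "u < 2 ^ r" for u T
      using val[of e D u T] D that e by simp
    have val_other: "val i (shift_table D u T) = val i T" if "u < 2 ^ r" "i \<in> S' \<union> Q" for i u T
      using val[of i D u T] D that e by auto
    have R_same: "R i (shift_table D u T) = R i T" if "i \<in> S" "u < 2 ^ r" for i u T
      by (rule R) (use that val_other in auto)
    have "real (card {T \<in> tab_tables s b (2 ^ r). (\<forall>i\<in>S'. val i T \<in> R i T) \<and> val e T \<in> R e T})
        \<le> p e * real (card {T \<in> tab_tables s b (2 ^ r). \<forall>i\<in>S'. val i T \<in> R i T})"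
    proof (rule card_shift_invariant[where \<sigma> = "shift_table D" and r = r])
      fix u T assume "u < (2::nat) ^ r" "T \<in> tab_tables s b (2 ^ r)"
      then show "shift_table D u T \<in> tab_tables s b (2 ^ r)"
        using D(1) unfolding P_def by (intro shift_table_in_tab_tables)
    qed (use val_e val_other R_same e less card in auto)
    also have "\<dots> \<le> p e * ((\<Prod>i\<in>S'. p i) * real (card (tab_tables s b (2 ^ r))))"
    proof (rule mult_left_mono)
      \<comment> \<open>A cardinality bounded by \<open>p e * 2 ^ r\<close> forces
        \<open>p e\<close> to be nonnegative.\<close>
      obtain T where T: "T \<in> tab_tables s b (2 ^ r)"
        using tab_tables_nonempty[of "2 ^ r" s b] by auto
      have "0 \<le> p e * 2 ^ r" using card[OF e(1) T] by (meson of_nat_0_le_iff order_trans)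
      then show "0 \<le> p e" using mult_neg_pos[of "p e" "2 ^ r"] zero_less_power[of "2::real" r] by linarith
    qed (use insert e in auto)
    finally show ?case using insert.hyps by (simp add: conj_commute mult.assoc)
  qed
  then show ?thesis by blast
qed

subsection \<open>Zero sets and matchings\<close>

text \<open>The vectors of the keys, indexed by pairs of a position and a character, add up to zero
  over the two-element field on the first \<open>n\<close> positions. Letting \<open>a\<close> range
  over all numbers keeps the alphabet out of the definition.\<close>

definition zero_upto :: "('v \<Rightarrow> nat list) \<Rightarrow> nat \<Rightarrow> 'v set \<Rightarrow> bool" where
  "zero_upto K n Z \<longleftrightarrow> (\<forall>j<n. \<forall>a. even (card {v \<in> Z. K v ! j = a}))"

definition perfect_matchings :: "'v set \<Rightarrow> 'v set set set" where
  "perfect_matchings Z = {M. partition_on Z M \<and> (\<forall>e\<in>M. card e = 2)}"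

text \<open>Linear independence of the pairs, where a pair stands for the sum of the vectors of its
  two ends. For disjoint pairs the sum over \<open>L\<close> is the sum over the keys in the union
  of \<open>L\<close>.\<close>

definition indep_upto :: "('v \<Rightarrow> nat list) \<Rightarrow> nat \<Rightarrow> 'v set set \<Rightarrow> bool" where
  "indep_upto K n M \<longleftrightarrow> (\<forall>L\<subseteq>M. L \<noteq> {} \<longrightarrow> \<not> zero_upto K n (\<Union>L))"

definition agree_at :: "('v \<Rightarrow> nat list) \<Rightarrow> nat \<Rightarrow> 'v set set \<Rightarrow> bool" where
  "agree_at K p M \<longleftrightarrow> (\<forall>e\<in>M. \<forall>u\<in>e. \<forall>v\<in>e. K u ! p = K v ! p)"

lemma indep_upto_subset: "indep_upto K n M \<Longrightarrow> L \<subseteq> M \<Longrightarrow> indep_upto K n L"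
  by (auto simp: indep_upto_def)

lemma agree_at_subset: "agree_at K p M \<Longrightarrow> L \<subseteq> M \<Longrightarrow> agree_at K p L"
  by (auto simp: agree_at_def)

lemma zero_upto_cong:
  assumes "\<And>v j. v \<in> Z \<Longrightarrow> j < n \<Longrightarrow> K v ! j = K' v ! j"
  shows "zero_upto K n Z \<longleftrightarrow> zero_upto K' n Z"
proof -
  have "{v \<in> Z. K v ! j = a} = {v \<in> Z. K' v ! j = a}" if "j < n" for j a
    using assms that by auto
  then show ?thesis by (simp add: zero_upto_def)
qed

lemma indep_upto_cong:
  assumes "\<And>v j. v \<in> \<Union>M \<Longrightarrow> j < n \<Longrightarrow> K v ! j = K' v ! j"
  shows "indep_upto K n M \<longleftrightarrow> indep_upto K' n M"
proof -
  have "zero_upto K n (\<Union>L) \<longleftrightarrow> zero_upto K' n (\<Union>L)" if "L \<subseteq> M" for L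
    by (rule zero_upto_cong) (use assms that in blast)
  then show ?thesis by (simp add: indep_upto_def)
qed

lemma agree_at_cong:
  assumes "\<And>v. v \<in> \<Union>M \<Longrightarrow> K v ! p = K' v ! p"
  shows "agree_at K p M \<longleftrightarrow> agree_at K' p M"
  using assms unfolding agree_at_def by (metis UnionI)

lemma zero_upto_mono: "zero_upto K n Z \<Longrightarrow> m \<le> n \<Longrightarrow> zero_upto K m Z"
  by (auto simp: zero_upto_def)

lemma perfect_matchingsD:
  assumes "M \<in> perfect_matchings Z"
  shows "\<Union>M = Z" "disjoint M" "\<And>e. e \<in> M \<Longrightarrow> card e = 2" "\<And>e. e \<in> M \<Longrightarrow> finite e"
  using assms by (auto simp: perfect_matchings_def partition_on_def card_2_iff)

lemma perfect_matchings_finite: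
  assumes "M \<in> perfect_matchings Z" "finite Z"
  shows "finite M"
  using assms finite_elements by (auto simp: perfect_matchings_def)

lemma perfect_matchings_card:
  assumes "M \<in> perfect_matchings Z"
  shows "card Z = 2 * card M"
  using perfect_matchingsD[OF assms] card_Union_disjoint[of M] sum_constant[of "2::nat" M]
  by (simp add: disjoint_def pairwise_def disjnt_def)

lemma perfect_matchings_subset:
  assumes "M \<in> perfect_matchings Z" "L \<subseteq> M"
  shows "L \<in> perfect_matchings (\<Union>L)"
  using assms by (auto simp: perfect_matchings_def partition_on_def disjoint_def)

lemma perfect_matchings_insert:
  assumes "M \<in> perfect_matchings Z" "u \<noteq> v" "u \<notin> Z" "v \<notin> Z"
  shows "insert {u, v} M \<in> perfect_matchings (insert u (insert v Z))"
  using assms by (auto simp: perfect_matchings_def partition_on_def disjoint_def)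

lemma perfect_matchings_edge:
  assumes "M \<in> perfect_matchings Z" "v \<in> Z"
  obtains u where "u \<noteq> v" "u \<in> Z" "{v, u} \<in> M"
proof -
  obtain e where e: "e \<in> M" "v \<in> e" using assms perfect_matchingsD(1) by blast
  then obtain u where "e = {v, u}" "u \<noteq> v"
    using perfect_matchingsD(3)[OF assms(1) e(1)] by (auto simp: card_2_iff)
  then show ?thesis using that e perfect_matchingsD(1)[OF assms(1)] by auto
qed

lemma perfect_matchings_edge_unique:
  assumes "M \<in> perfect_matchings Z" "e \<in> M" "e' \<in> M" "v \<in> e" "v \<in> e'"
  shows "e = e'"
  using perfect_matchingsD(2)[OF assms(1)] assms by (auto simp: disjoint_def)

lemma perfect_matchings_Union_Diff:
  assumes "M \<in> perfect_matchings Z" "L \<subseteq> M"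
  shows "\<Union>(M - L) = Z - \<Union>L"
  using perfect_matchingsD(1)[OF assms(1)] perfect_matchings_edge_unique[OF assms(1)] assms(2) by blast

lemma perfect_matchings_Diff:
  assumes "M \<in> perfect_matchings Z" "{u, v} \<in> M"
  shows "M - {{u, v}} \<in> perfect_matchings (Z - {u, v})"
  using perfect_matchings_subset[OF assms(1), of "M - {{u, v}}"]
    perfect_matchings_Union_Diff[OF assms(1), of "{{u, v}}"] assms(2) by auto

text \<open>Pairs are split off one at a time: an element of an even fibre always has a partner in
  its fibre, and removing both keeps the parity.\<close>

lemma ex_agreeing_perfect_matching:
  fixes f :: "'v \<Rightarrow> 'b"
  assumes "finite Z" "\<And>a. even (card {v \<in> Z. f v = a})"
  shows "\<exists>M\<in>perfect_matchings Z. \<forall>e\<in>M. \<forall>u\<in>e. \<forall>v\<in>e. f u = f v"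
  using assms
proof (induction "card Z" arbitrary: Z rule: less_induct)
  case less
  show ?case
  proof (cases "Z = {}")
    case True
    then show ?thesis by (intro bexI[of _ "{}"]) (auto simp: perfect_matchings_def partition_on_def)
  next
    case False
    then obtain v where v: "v \<in> Z" by auto
    let ?A = "{w \<in> Z. f w = f v}"
    have "?A \<noteq> {v}"
      using less.prems(2)[of "f v"] by (metis One_nat_def card.empty card.insert empty_iff finite.emptyI odd_one)
    then obtain u where u: "u \<in> Z" "f u = f v" "u \<noteq> v" using v by blast
    define Y where "Y = Z - {v, u}"
    have "card Y < card Z"
      unfolding Y_def by (rule psubset_card_mono) (use v less.prems in auto)
    moreover have "even (card {w \<in> Y. f w = a})" for a
    proof (cases "a = f v")
      case True
      have "{w \<in> Z. f w = a} = insert v (insert u {w \<in> Y. f w = a})"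
        unfolding Y_def using True u v by auto
      moreover have "finite {w \<in> Y. f w = a}" "v \<notin> {w \<in> Y. f w = a}" "u \<notin> {w \<in> Y. f w = a}"
        using less.prems by (auto simp: Y_def)
      ultimately have "card {w \<in> Z. f w = a} = Suc (Suc (card {w \<in> Y. f w = a}))"
        using u(3) by simp
      then show ?thesis using less.prems(2)[of a] by simp
    next
      case False
      then have "{w \<in> Y. f w = a} = {w \<in> Z. f w = a}" using u by (auto simp: Y_def)
      then show ?thesis using less.prems(2) by simp
    qed
    ultimately obtain M where M: "M \<in> perfect_matchings Y" "\<forall>e\<in>M. \<forall>u\<in>e. \<forall>v\<in>e. f u = f v"
      using less.hyps[of Y] less.prems(1) by (auto simp: Y_def)
    have "insert {v, u} M \<in> perfect_matchings (insert v (insert u Y))"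
      by (rule perfect_matchings_insert) (use M u in \<open>auto simp: Y_def\<close>)
    moreover have "insert v (insert u Y) = Z" using u v by (auto simp: Y_def)
    moreover have "f x = f y" if "e \<in> insert {v, u} M" "x \<in> e" "y \<in> e" for e x y
    proof (cases "e = {v, u}")
      case True
      then show ?thesis using that u(2) by auto
    next
      case False
      then show ?thesis using that M(2) by blast
    qed
    ultimately show ?thesis by (intro bexI[of _ "insert {v, u} M"]) blast+
  qed
qed

text \<open>This is the double factorial \<open>(2 * w - 1)!!\<close>, the number of perfect
  matchings of \<open>2 * w\<close> points.\<close>

definition dfact :: "nat \<Rightarrow> nat" where
  "dfact w = (\<Prod>i<w. 2 * i + 1)"

lemma dfact_simps [simp]: "dfact 0 = 1" "dfact (Suc w) = (2 * w + 1) * dfact w"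
  by (simp_all add: dfact_def mult.commute)

lemma finite_perfect_matchings: "finite Z \<Longrightarrow> finite (perfect_matchings Z)"
  by (rule finite_subset[of _ "Pow (Pow Z)"]) (auto simp: perfect_matchings_def partition_on_def)

lemma card_perfect_matchings_le:
  assumes "finite Z" "card Z = 2 * w"
  shows "card (perfect_matchings Z) \<le> dfact w"
  using assms
proof (induction w arbitrary: Z)
  case 0
  then have "perfect_matchings Z \<subseteq> {{}}"
    by (auto simp: perfect_matchings_def partition_on_def)
  then show ?case using card_mono[of "{{}}" "perfect_matchings Z"] by simp
next
  case (Suc w)
  then obtain v where v: "v \<in> Z" by fastforce
  have sub: "perfect_matchings Z \<subseteq> (\<Union>u\<in>Z - {v}. insert {v, u} ` perfect_matchings (Z - {v, u}))"
  proof
    fix M assume M: "M \<in> perfect_matchings Z"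
    obtain u where u: "u \<noteq> v" "u \<in> Z" "{v, u} \<in> M" by (rule perfect_matchings_edge[OF M v])
    then have "M = insert {v, u} (M - {{v, u}})" by auto
    then show "M \<in> (\<Union>u\<in>Z - {v}. insert {v, u} ` perfect_matchings (Z - {v, u}))"
      using perfect_matchings_Diff[OF M u(3)] u by blast
  qed
  have "card (perfect_matchings Z) \<le> card (\<Union>u\<in>Z - {v}. insert {v, u} ` perfect_matchings (Z - {v, u}))"
    by (rule card_mono[OF _ sub]) (use Suc.prems in \<open>auto intro!: finite_perfect_matchings\<close>)
  also have "\<dots> \<le> (\<Sum>u\<in>Z - {v}. card (insert {v, u} ` perfect_matchings (Z - {v, u})))"
    by (rule card_UN_le) (use Suc.prems in auto)
  also have "\<dots> \<le> (\<Sum>u\<in>Z - {v}. dfact w)"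
  proof (rule sum_mono)
    fix u assume u: "u \<in> Z - {v}"
    have "card (Z - {v, u}) = 2 * w"
      using Suc.prems u v by (subst card_Diff_subset) auto
    then show "card (insert {v, u} ` perfect_matchings (Z - {v, u})) \<le> dfact w"
      using Suc.IH[of "Z - {v, u}"] Suc.prems(1)
      by (meson card_image_le finite_Diff finite_perfect_matchings order_trans)
  qed
  also have "\<dots> = dfact (Suc w)" using Suc.prems v by simp
  finally show ?case .
qed

text \<open>Adding the vectors of disjoint pairs is the same as adding those of all their keys; this
  passes between zero sets of keys and independence of pairs.\<close>

lemma odd_card_Union:
  assumes "finite J" "disjoint J" "\<And>e. e \<in> J \<Longrightarrow> finite e"
  shows "odd (card {v \<in> \<Union>J. P v}) \<longleftrightarrow> odd (card {e \<in> J. odd (card {v \<in> e. P v})})"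
  using assms
proof (induction J rule: finite_induct)
  case empty
  then show ?case by simp
next
  case (insert e J)
  have dis: "{v \<in> e. P v} \<inter> {v \<in> \<Union>J. P v} = {}"
    using insert.prems(1) insert.hyps(2) by (auto simp: disjoint_def)
  have "{v \<in> \<Union>(insert e J). P v} = {v \<in> e. P v} \<union> {v \<in> \<Union>J. P v}" by auto
  then have 1: "card {v \<in> \<Union>(insert e J). P v} = card {v \<in> e. P v} + card {v \<in> \<Union>J. P v}"
    using dis insert by (simp add: card_Un_disjoint)
  have "{e' \<in> insert e J. odd (card {v \<in> e'. P v})} =
      (if odd (card {v \<in> e. P v}) then insert e {e' \<in> J. odd (card {v \<in> e'. P v})}
       else {e' \<in> J. odd (card {v \<in> e'. P v})})"
    by auto
  then have 2: "card {e' \<in> insert e J. odd (card {v \<in> e'. P v})} =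
      (if odd (card {v \<in> e. P v}) then Suc (card {e' \<in> J. odd (card {v \<in> e'. P v})})
       else card {e' \<in> J. odd (card {v \<in> e'. P v})})"
    using insert.hyps by simp
  have "disjoint J" using insert.prems(1) by (auto simp: disjoint_def)
  then have 3: "odd (card {v \<in> \<Union>J. P v}) \<longleftrightarrow> odd (card {e \<in> J. odd (card {v \<in> e. P v})})"
    using insert by blast
  show ?case unfolding 1 2 using 3 by auto
qed

text \<open>In an agreeing pair a character at position \<open>n\<close> is taken by both ends or by
  neither, so the contributions at this position cancel.\<close>

lemma zero_upto_Suc_if_agree:
  assumes "L \<in> perfect_matchings Z" "finite Z" "agree_at K n L" "zero_upto K n Z"
  shows "zero_upto K (Suc n) Z"
proof -
  note L = perfect_matchingsD[OF assms(1)]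
  have "even (card {v \<in> e. K v ! n = a})" if "e \<in> L" for a e
  proof -
    have "{v \<in> e. K v ! n = a} = {} \<or> {v \<in> e. K v ! n = a} = e"
      using assms(3) that unfolding agree_at_def by blast
    then show ?thesis
    proof
      assume "{v \<in> e. K v ! n = a} = e"
      then show ?thesis using L(3)[OF that] by (simp only:) simp
    qed (simp only: card.empty even_zero)
  qed
  then have none: "{e \<in> L. odd (card {v \<in> e. K v ! n = a})} = {}" for a by blast
  have "odd (card {v \<in> \<Union>L. K v ! n = a}) \<longleftrightarrow> odd (card {e \<in> L. odd (card {v \<in> e. K v ! n = a})})" for a
    by (rule odd_card_Union[OF perfect_matchings_finite[OF assms(1,2)] L(2,4)])
  then have "even (card {v \<in> Z. K v ! n = a})" for a
    unfolding none L(1) by simp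
  then show ?thesis using assms(4) by (auto simp: zero_upto_def less_Suc_eq)
qed

lemma card_nth_eq:
  assumes "D \<subseteq> {..<length xs} \<times> B"
  shows "card {q \<in> D. xs ! fst q = snd q} = card {i. i < length xs \<and> (i, xs ! i) \<in> D}"
  by (rule bij_betw_same_card[of fst], rule bij_betw_byWitness[of _ "\<lambda>i. (i, xs ! i)"])
     (use assms in auto)

text \<open>A pair agrees when the xor of its two table hashes takes a prescribed value. Independent
  pairs have independent uniform xors, so each costs a factor \<open>1 / 2 ^ k\<close>. The offsets
  \<open>\<alpha>\<close> make room for the input character that is xored in at level 0.\<close>

lemma card_tables_agree:
  fixes \<kappa> :: "'v \<Rightarrow> nat list" and \<alpha> :: "'v \<Rightarrow> nat"
  assumes M: "M \<in> perfect_matchings V" and "finite V"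
    and \<kappa>: "\<And>v. v \<in> V \<Longrightarrow> length (\<kappa> v) = b \<and> set (\<kappa> v) \<subseteq> {..<s}"
    and \<alpha>: "\<And>v. v \<in> V \<Longrightarrow> \<alpha> v < 2 ^ k"
    and indep: "indep_upto \<kappa> b M"
  shows "real (card {T \<in> tab_tables s b (2 ^ k).
      \<forall>e\<in>M. \<forall>u\<in>e. \<forall>v\<in>e. xor (\<alpha> u) (simple_tab T (\<kappa> u)) = xor (\<alpha> v) (simple_tab T (\<kappa> v))})
     \<le> (1 / 2 ^ k) ^ card M * real (card (tab_tables s b (2 ^ k)))" (is "real (card ?A) \<le> _")
proof -
  note MD = perfect_matchingsD[OF M]
  have finM: "finite M" by (rule perfect_matchings_finite[OF M assms(2)])
  have "\<forall>e\<in>M. \<exists>g h. e = {g, h} \<and> g \<noteq> h" using MD(3) by (auto simp: card_2_iff)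
  then obtain g h where gh: "\<And>e. e \<in> M \<Longrightarrow> e = {g e, h e} \<and> g e \<noteq> h e" by metis
  have ghV: "g e \<in> V" "h e \<in> V" if "e \<in> M" for e using gh[OF that] that MD(1) by blast+
  define val where "val e T = xor (simple_tab T (\<kappa> (g e))) (simple_tab T (\<kappa> (h e)))" for e T
  define a where "a e q \<longleftrightarrow> odd (card {v \<in> e. \<kappa> v ! fst q = snd q})" for e :: "'v set" and q :: "nat \<times> nat"
  define R where "R e (T :: nat \<Rightarrow> nat \<Rightarrow> nat) = {xor (\<alpha> (g e)) (\<alpha> (h e))}" for e T
  have "?A \<subseteq> {T \<in> tab_tables s b (2 ^ k). \<forall>e\<in>M. val e T \<in> R e T}"
  proof clarify
    fix T e assume *: "\<forall>e\<in>M. \<forall>u\<in>e. \<forall>v\<in>e. xor (\<alpha> u) (simple_tab T (\<kappa> u)) = xor (\<alpha> v) (simple_tab T (\<kappa> v))"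
      and e: "e \<in> M"
    have "g e \<in> e" "h e \<in> e" using gh[OF e] by auto
    then have "xor (\<alpha> (g e)) (simple_tab T (\<kappa> (g e))) = xor (\<alpha> (h e)) (simple_tab T (\<kappa> (h e)))"
      using * e by blast
    then show "val e T \<in> R e T"
      unfolding val_def R_def by (metis singleton_iff xor.assoc xor.commute xor_nat_eq_iff)
  qed
  then have "real (card ?A) \<le> real (card {T \<in> tab_tables s b (2 ^ k). \<forall>e\<in>M. val e T \<in> R e T})"
    by (intro of_nat_mono card_mono) auto
  also have "\<dots> \<le> (\<Prod>e\<in>M. 1 / 2 ^ k) * real (card (tab_tables s b (2 ^ k)))"
  proof (rule card_independent_values[where a = a and Q = "{}"])
    fix J assume J: "J \<subseteq> M \<union> {}" "J \<inter> M \<noteq> {}"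
    then have "\<not> zero_upto \<kappa> b (\<Union>J)" using indep unfolding indep_upto_def by blast
    then obtain j ch where j: "j < b" "odd (card {v \<in> \<Union>J. \<kappa> v ! j = ch})"
      unfolding zero_upto_def by blast
    then have "{v \<in> \<Union>J. \<kappa> v ! j = ch} \<noteq> {}" by (metis card.empty even_zero)
    then obtain v where v: "v \<in> V" "\<kappa> v ! j = ch" using J MD(1) by auto
    then have "ch < s" using \<kappa>[OF v(1)] j(1) nth_mem by blast
    moreover have "odd (card {e \<in> J. a e (j, ch)})"
    proof -
      have "disjoint J" using J MD(2) unfolding disjoint_def by blast
      moreover have "finite J" "\<And>e. e \<in> J \<Longrightarrow> finite e"
        using J finite_subset[OF _ finM] MD(4) by auto
      ultimately show ?thesis using odd_card_Union[of J "\<lambda>v. \<kappa> v ! j = ch"] j(2) by (simp add: a_def)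
    qed
    ultimately show "\<exists>q\<in>{..<b} \<times> {..<s}. odd (card {e \<in> J. a e q})" using j(1) by auto
  next
    fix e D u T assume e: "e \<in> M \<union> {}" and D: "D \<subseteq> {..<b} \<times> {..<s}"
    have mem: "x \<in> e \<longleftrightarrow> x = g e \<or> x = h e" and ne: "g e \<noteq> h e" for x using gh[of e] e by blast+
    have "a e q \<longleftrightarrow> (\<kappa> (g e) ! fst q = snd q) \<noteq> (\<kappa> (h e) ! fst q = snd q)" for q
    proof -
      have "{v \<in> e. \<kappa> v ! fst q = snd q} = (if \<kappa> (g e) ! fst q = snd q then {g e} else {}) \<union>
         (if \<kappa> (h e) ! fst q = snd q then {h e} else {})" by (auto simp: mem)
      then show ?thesis using ne by (auto simp: a_def)
    qed
    then have "odd (card {q \<in> D. a e q}) \<longleftrightarrow>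
       odd (card {q \<in> D. \<kappa> (g e) ! fst q = snd q}) \<noteq> odd (card {q \<in> D. \<kappa> (h e) ! fst q = snd q})"
      using odd_card_xor[of D] finite_subset[OF D] by simp
    moreover have "card {q \<in> D. \<kappa> v ! fst q = snd q} = card {i. i < length (\<kappa> v) \<and> (i, \<kappa> v ! i) \<in> D}" if "v \<in> V" for v
      by (rule card_nth_eq[of _ _ "{..<s}"]) (use D \<kappa>[OF that] in auto)
    ultimately have *: "odd (card {q \<in> D. a e q}) \<longleftrightarrow>
       odd (card {i. i < length (\<kappa> (g e)) \<and> (i, \<kappa> (g e) ! i) \<in> D}) \<noteq>
       odd (card {i. i < length (\<kappa> (h e)) \<and> (i, \<kappa> (h e) ! i) \<in> D})"
      using ghV e by simp
    have uu: "xor u (xor u w) = w" for w :: nat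
      by (metis xor.assoc xor.left_neutral xor_self_eq)
    show "val e (shift_table D u T) = xor (val e T) (if odd (card {q \<in> D. a e q}) then u else 0)"
      unfolding * val_def simple_tab_shift_table
      by (auto simp: xor.assoc xor.commute xor.left_commute uu)
  next
    fix e T assume "e \<in> M"
    show "real (card {v. v < 2 ^ k \<and> v \<in> R e T}) \<le> 1 / 2 ^ k * 2 ^ k"
    proof -
      have "card {v. v < 2 ^ k \<and> v \<in> R e T} \<le> card (R e T)" by (rule card_mono) (auto simp: R_def)
      then show ?thesis by (simp add: R_def)
    qed
  qed (use finM in \<open>auto simp: val_def R_def intro!: xor_less_pow2 simple_tab_less\<close>)
  finally show ?thesis by simp
qed

subsection \<open>Derived keys\<close>

lemma finite_keys [simp]: "finite (keys s b)"
  using finite_lists_length_eq[of "{..<s}" b] by (simp add: keys_def conj_commute)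

lemma keys_length: "x \<in> keys s b \<Longrightarrow> length x = b"
  by (simp add: keys_def)

text \<open>The argument of the simple tabulation function number \<open>n\<close>. Together with
  \<open>derived_offset\<close> it puts the twisted character (\<open>n = 0\<close>) and the derived
  ones under one formula: position \<open>c + n - 1\<close>, counted from 0, is the one that
  \<open>TT n\<close> produces.\<close>

definition derived_prefix :: "(nat \<Rightarrow> nat \<Rightarrow> nat \<Rightarrow> nat) \<Rightarrow> nat \<Rightarrow> nat \<Rightarrow> nat list \<Rightarrow> nat list" where
  "derived_prefix TT c n x = (case n of 0 \<Rightarrow> take (c - 1) x | Suc m \<Rightarrow> derived_key TT c m x)"

definition derived_offset :: "nat \<Rightarrow> nat \<Rightarrow> nat list \<Rightarrow> nat" where
  "derived_offset c n x = (if n = 0 then x ! (c - 1) else 0)"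

lemma derived_key_eq_append:
  "derived_key TT c n x = derived_prefix TT c n x @
     [xor (derived_offset c n x) (simple_tab (TT n) (derived_prefix TT c n x))]"
  by (cases n) (auto simp: derived_prefix_def derived_offset_def Let_def)

lemma length_derived_key:
  assumes "length x = c" "c \<ge> 1"
  shows "length (derived_key TT c n x) = c + n"
  using assms by (induction n) (auto simp: Let_def)

lemma length_derived_prefix:
  assumes "length x = c" "c \<ge> 1"
  shows "length (derived_prefix TT c n x) = c + n - 1"
  using assms by (cases n) (auto simp: derived_prefix_def length_derived_key)

lemma derived_key_nth_prefix:
  assumes "length x = c" "c \<ge> 1" "j < c + n - 1"
  shows "derived_key TT c n x ! j = derived_prefix TT c n x ! j"
  using assms by (subst derived_key_eq_append) (simp add: nth_append length_derived_prefix)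

lemma derived_key_nth_last:
  assumes "length x = c" "c \<ge> 1"
  shows "derived_key TT c n x ! (c + n - 1) =
    xor (derived_offset c n x) (simple_tab (TT n) (derived_prefix TT c n x))"
  using assms by (subst derived_key_eq_append) (simp add: nth_append length_derived_prefix)

lemma derived_key_nth_mono:
  assumes "length x = c" "c \<ge> 1" "n \<le> m" "j < c + n"
  shows "derived_key TT c m x ! j = derived_key TT c n x ! j"
  using assms(3)
proof (induction m rule: dec_induct)
  case base
  then show ?case by simp
next
  case (step m)
  have "derived_key TT c (Suc m) x ! j = derived_key TT c m x ! j"
    using derived_key_nth_prefix[OF assms(1,2), of j "Suc m"] assms(4) step.hyps
    by (simp add: derived_prefix_def)
  then show ?case using step by simp
qed

lemma derived_key_cong:
  assumes "\<And>j. j \<le> n \<Longrightarrow> TT j = TT' j"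
  shows "derived_key TT c n x = derived_key TT' c n x"
  using assms by (induction n) (auto simp: Let_def)

lemma derived_prefix_cong:
  assumes "\<And>j. j < n \<Longrightarrow> TT j = TT' j"
  shows "derived_prefix TT c n x = derived_prefix TT' c n x"
  using assms by (cases n) (auto simp: derived_prefix_def intro!: derived_key_cong)

text \<open>The twist can be undone: the first \<open>c - 1\<close> characters are those of the key
  itself and determine the mask on its last character. Hence \<open>derived_key\<close> is injective
  on keys whatever the tables are.\<close>

lemma derived_key_inj_prefix:
  assumes "x \<in> keys s c" "y \<in> keys s c" "c \<ge> 1" "x \<noteq> y"
  shows "\<exists>j<c. derived_key TT c n x ! j \<noteq> derived_key TT c n y ! j"
proof (rule ccontr)
  assume "\<not> ?thesis"
  then have eq: "derived_key TT c 0 x ! j = derived_key TT c 0 y ! j" if "j < c" for j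
    using derived_key_nth_mono[of x c 0 n j TT] derived_key_nth_mono[of y c 0 n j TT] that assms
    by (auto simp: keys_def)
  have len: "length (derived_key TT c 0 x) = c" "length (derived_key TT c 0 y) = c"
    using assms length_derived_key[of _ c TT 0] by (auto simp: keys_def simp del: derived_key.simps)
  have "derived_key TT c 0 x = derived_key TT c 0 y"
    by (rule nth_equalityI) (use eq len in \<open>simp_all del: derived_key.simps\<close>)
  then have t: "take (c - 1) x = take (c - 1) y"
    and "xor (x ! (c - 1)) (simple_tab (TT 0) (take (c - 1) x)) = xor (y ! (c - 1)) (simple_tab (TT 0) (take (c - 1) y))"
    by auto
  then have l: "x ! (c - 1) = y ! (c - 1)"
    by (metis xor.assoc xor.right_neutral xor_self_eq)
  have "z = take (c - 1) z @ [z ! (c - 1)]" if "length z = c" for z :: "nat list"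
    using that assms(3) take_Suc_conv_app_nth[of "c - 1" z] by simp
  then show False using t l assms by (metis keys_length)
qed

text \<open>Only the tables of the levels below \<open>n\<close> vary. Fixing the rest to zero makes
  the addition of a level a function update, and a bijection with a product.\<close>

definition tt_space :: "nat \<Rightarrow> nat \<Rightarrow> nat \<Rightarrow> (nat \<Rightarrow> nat \<Rightarrow> nat \<Rightarrow> nat) set" where
  "tt_space k c n = {TT. (\<forall>j<n. TT j \<in> tab_tables (2 ^ k) (c + j - 1) (2 ^ k)) \<and> (\<forall>j\<ge>n. TT j = (\<lambda>_ _. 0))}"

lemma tornado_space_eq:
  "tornado_space k r c d = tt_space k c (Suc d) \<times> tab_tables (2 ^ k) (c + d) (2 ^ r)"
  by (auto simp: tornado_space_def tt_space_def less_Suc_eq_le Suc_le_eq)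

lemma derived_key_subset:
  assumes "TT \<in> tt_space k c N" "n < N" "x \<in> keys (2 ^ k) c" "c \<ge> 1"
  shows "set (derived_key TT c n x) \<subseteq> {..<2 ^ k}"
proof -
  have T: "simple_tab (TT j) xs < 2 ^ k" if "j < N" for j xs
    using assms(1) that by (intro simple_tab_less[of _ "2 ^ k" "c + j - 1"]) (auto simp: tt_space_def)
  show ?thesis using assms(2)
  proof (induction n)
    case 0
    have "x ! (c - 1) \<in> set x" using assms by (auto simp: keys_def)
    then have "x ! (c - 1) < 2 ^ k" using assms(3) by (auto simp: keys_def)
    then have "xor (x ! (c - 1)) (simple_tab (TT 0) (take (c - 1) x)) < 2 ^ k"
      using T 0 by (intro xor_less_pow2) auto
    moreover have "set (take (c - 1) x) \<subseteq> {..<2 ^ k}"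
      using assms(3) set_take_subset[of "c - 1" x] by (auto simp: keys_def)
    ultimately show ?case by auto
  next
    case (Suc n)
    then show ?case using T[of "Suc n"] by (auto simp: Let_def)
  qed
qed

lemma derived_prefix_subset:
  assumes "TT \<in> tt_space k c n" "x \<in> keys (2 ^ k) c" "c \<ge> 1"
  shows "set (derived_prefix TT c n x) \<subseteq> {..<2 ^ k}"
proof (cases n)
  case 0
  then show ?thesis
    using assms(2) set_take_subset[of "c - 1" x] by (auto simp: derived_prefix_def keys_def)
next
  case (Suc m)
  then show ?thesis using derived_key_subset[OF assms(1), of m x] assms by (simp add: derived_prefix_def)
qed

subsection \<open>Probability of one level\<close>

lemma tt_space_upd:
  "tt_space k c (Suc n) = (\<lambda>(TT, T). TT(n := T)) ` (tt_space k c n \<times> tab_tables (2 ^ k) (c + n - 1) (2 ^ k))"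
  (is "?L = ?R")
proof
  show "?L \<subseteq> ?R"
  proof
    fix TT assume TT: "TT \<in> ?L"
    have "TT(n := \<lambda>_ _. 0) \<in> tt_space k c n" "TT n \<in> tab_tables (2 ^ k) (c + n - 1) (2 ^ k)"
      using TT by (auto simp: tt_space_def)
    moreover have "TT = (TT(n := \<lambda>_ _. 0))(n := TT n)" by auto
    ultimately show "TT \<in> ?R"
      by (intro image_eqI[of _ _ "(TT(n := \<lambda>_ _. 0), TT n)"]) auto
  qed
qed (auto simp: tt_space_def less_Suc_eq)

lemma inj_on_tt_space_upd:
  "inj_on (\<lambda>(TT, T). TT(n := T)) (tt_space k c n \<times> A)"
proof (rule inj_onI, clarify)
  fix TT T TT' T'
  assume "TT \<in> tt_space k c n" "TT' \<in> tt_space k c n" and eq: "TT(n := T) = TT'(n := T')"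
  then have "TT n = TT' n" by (auto simp: tt_space_def)
  moreover have "TT j = TT' j" if "j \<noteq> n" for j using fun_cong[OF eq, of j] that by simp
  ultimately have "TT = TT'" by (metis ext)
  moreover have "T = T'" using fun_cong[OF eq, of n] by simp
  ultimately show "TT = TT' \<and> T = T'" by simp
qed

lemma finite_tt_space [simp]: "finite (tt_space k c n)"
proof (induction n)
  case 0
  have "tt_space k c 0 = {\<lambda>_ _ _. 0}" by (auto simp: tt_space_def)
  then show ?case by simp
next
  case (Suc n)
  then show ?case unfolding tt_space_upd by (intro finite_imageI finite_cartesian_product) auto
qed

lemma card_tt_space_pos: "0 < card (tt_space k c n)"
proof -
  have "(\<lambda>_ _ _. 0) \<in> tt_space k c n" by (auto simp: tt_space_def tab_tables_def)
  then show ?thesis by (auto simp: card_gt_0_iff)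
qed

lemma card_tt_space_Suc:
  "card {TT \<in> tt_space k c (Suc n). A TT} =
     (\<Sum>TT\<in>tt_space k c n. card {T \<in> tab_tables (2 ^ k) (c + n - 1) (2 ^ k). A (TT(n := T))})"
proof -
  let ?tab = "tab_tables (2 ^ k) (c + n - 1) (2 ^ k)"
  let ?S = "SIGMA TT:tt_space k c n. {T \<in> ?tab. A (TT(n := T))}"
  have "{TT \<in> tt_space k c (Suc n). A TT} = (\<lambda>(TT, T). TT(n := T)) ` ?S"
    unfolding tt_space_upd by auto
  moreover have "inj_on (\<lambda>(TT, T). TT(n := T)) ?S"
    by (rule inj_on_subset[OF inj_on_tt_space_upd[of n k c ?tab]]) auto
  ultimately have "card {TT \<in> tt_space k c (Suc n). A TT} = card ?S"
    by (simp add: card_image)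
  then show ?thesis by simp
qed

definition tt_prob :: "nat \<Rightarrow> nat \<Rightarrow> nat \<Rightarrow> ((nat \<Rightarrow> nat \<Rightarrow> nat \<Rightarrow> nat) \<Rightarrow> bool) \<Rightarrow> real" where
  "tt_prob k c n A = real (card {TT \<in> tt_space k c n. A TT}) / real (card (tt_space k c n))"

text \<open>Independence is about the arguments of \<open>TT n\<close>, agreement about its output.
  The first is decided by the levels below \<open>n\<close>, and given them only \<open>TT n\<close>
  decides the second.\<close>

definition level_match :: "(nat \<Rightarrow> nat \<Rightarrow> nat \<Rightarrow> nat) \<Rightarrow> nat \<Rightarrow> nat \<Rightarrow> nat list set set \<Rightarrow> bool" where
  "level_match TT c n M \<longleftrightarrow>
     indep_upto (derived_key TT c n) (c + n - 1) M \<and> agree_at (derived_key TT c n) (c + n - 1) M"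

lemma level_match_cong:
  assumes "\<And>j. j \<le> n \<Longrightarrow> TT j = TT' j"
  shows "level_match TT c n M \<longleftrightarrow> level_match TT' c n M"
proof -
  have "derived_key TT c n = derived_key TT' c n" by (rule ext, rule derived_key_cong[OF assms])
  then show ?thesis by (simp add: level_match_def)
qed

text \<open>Once the levels below \<open>n\<close> are fixed, so are \<open>G\<close> and the
  independence of \<open>M\<close>, and the fresh tables of level \<open>n\<close> have to satisfy
  \<open>card M\<close> independent equations.\<close>

lemma tt_prob_level_match:
  assumes c: "c \<ge> 1" and V: "V \<subseteq> keys (2 ^ k) c" and M: "M \<in> perfect_matchings V"
    and G: "\<And>TT TT'. (\<And>j. j < n \<Longrightarrow> TT j = TT' j) \<Longrightarrow> G TT = G TT'"
  shows "tt_prob k c (Suc n) (\<lambda>TT. G TT \<and> level_match TT c n M) \<le> (1 / 2 ^ k) ^ card M * tt_prob k c n G"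
proof -
  let ?tab = "tab_tables (2 ^ k) (c + n - 1) (2 ^ k)"
  have finV: "finite V" by (rule finite_subset[OF V]) simp
  have lenV: "length v = c" if "v \<in> V" for v using V that by (auto simp: keys_def)
  have MU: "\<Union>M = V" using perfect_matchingsD(1)[OF M] .
  have step: "real (card {T \<in> ?tab. G (TT(n := T)) \<and> level_match (TT(n := T)) c n M}) \<le>
     (if G TT then (1 / 2 ^ k) ^ card M * real (card ?tab) else 0)" if TT: "TT \<in> tt_space k c n" for TT
  proof -
    have GT: "G (TT(n := T)) = G TT" for T by (rule G) auto
    have pre: "derived_prefix (TT(n := T)) c n x = derived_prefix TT c n x" for T x
      by (rule derived_prefix_cong) auto
    have ind: "indep_upto (derived_key (TT(n := T)) c n) (c + n - 1) M \<longleftrightarrow>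
        indep_upto (derived_prefix TT c n) (c + n - 1) M" for T
      by (rule indep_upto_cong) (use MU lenV c in \<open>auto simp: derived_key_nth_prefix pre\<close>)
    have agr: "agree_at (derived_key (TT(n := T)) c n) (c + n - 1) M \<longleftrightarrow>
      (\<forall>e\<in>M. \<forall>u\<in>e. \<forall>v\<in>e. xor (derived_offset c n u) (simple_tab T (derived_prefix TT c n u)) =
         xor (derived_offset c n v) (simple_tab T (derived_prefix TT c n v)))" for T
    proof -
      have "derived_key (TT(n := T)) c n v ! (c + n - 1) =
          xor (derived_offset c n v) (simple_tab T (derived_prefix TT c n v))" if "e \<in> M" "v \<in> e" for e v
      proof -
        have "length v = c" using that MU lenV by blast
        then show ?thesis using derived_key_nth_last[of v c "TT(n := T)" n] c by (simp add: pre)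
      qed
      then show ?thesis unfolding agree_at_def by (intro ball_cong refl) simp
    qed
    show ?thesis
    proof (cases "G TT \<and> indep_upto (derived_prefix TT c n) (c + n - 1) M")
      case True
      have off: "derived_offset c n v < 2 ^ k" if "v \<in> V" for v
      proof (cases "n = 0")
        case True
        have "v ! (c - 1) \<in> set v" using lenV[OF that] c by auto
        then show ?thesis using V that True by (auto simp: derived_offset_def keys_def)
      qed (simp add: derived_offset_def)
      have "real (card {T \<in> ?tab. \<forall>e\<in>M. \<forall>u\<in>e. \<forall>v\<in>e.
           xor (derived_offset c n u) (simple_tab T (derived_prefix TT c n u)) =
           xor (derived_offset c n v) (simple_tab T (derived_prefix TT c n v))})
          \<le> (1 / 2 ^ k) ^ card M * real (card ?tab)"
        by (rule card_tables_agree[OF M finV _ off])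
           (use True lenV c V derived_prefix_subset[OF TT] in \<open>auto simp: length_derived_prefix subset_iff\<close>)
      then show ?thesis using True unfolding level_match_def GT ind agr by simp
    next
      case False
      then have "{T \<in> ?tab. G (TT(n := T)) \<and> level_match (TT(n := T)) c n M} = {}"
        unfolding level_match_def GT ind by blast
      then show ?thesis by (simp only: card.empty) simp
    qed
  qed
  have "real (card {TT \<in> tt_space k c (Suc n). G TT \<and> level_match TT c n M}) =
      (\<Sum>TT\<in>tt_space k c n. real (card {T \<in> ?tab. G (TT(n := T)) \<and> level_match (TT(n := T)) c n M}))"
    by (simp add: card_tt_space_Suc)
  also have "\<dots> \<le> (\<Sum>TT\<in>tt_space k c n. if G TT then (1 / 2 ^ k) ^ card M * real (card ?tab) else 0)"
    by (rule sum_mono) (rule step)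
  also have "\<dots> = (1 / 2 ^ k) ^ card M * real (card ?tab) * real (card {TT \<in> tt_space k c n. G TT})"
    by (simp flip: sum.inter_filter)
  finally have *: "real (card {TT \<in> tt_space k c (Suc n). G TT \<and> level_match TT c n M}) \<le>
      (1 / 2 ^ k) ^ card M * real (card ?tab) * real (card {TT \<in> tt_space k c n. G TT})" .
  have "card (tt_space k c (Suc n)) = card (tt_space k c n) * card ?tab"
    using card_tt_space_Suc[of k c n "\<lambda>_. True"] by simp
  then show ?thesis
    using * card_tt_space_pos[of k c n] card_tab_tables_pos[of "2 ^ k" "2 ^ k" "c + n - 1"]
    unfolding tt_prob_def by (simp add: field_simps)
qed

lemma tt_prob_mono:
  assumes "\<And>TT. TT \<in> tt_space k c n \<Longrightarrow> A TT \<Longrightarrow> B TT"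
  shows "tt_prob k c n A \<le> tt_prob k c n B"
  unfolding tt_prob_def by (intro divide_right_mono of_nat_mono card_mono) (use assms in auto)

lemma tt_prob_Bex_le:
  assumes "finite I"
  shows "tt_prob k c n (\<lambda>TT. \<exists>i\<in>I. A i TT) \<le> (\<Sum>i\<in>I. tt_prob k c n (A i))"
proof -
  have "{TT \<in> tt_space k c n. \<exists>i\<in>I. A i TT} = (\<Union>i\<in>I. {TT \<in> tt_space k c n. A i TT})" by auto
  then have "card {TT \<in> tt_space k c n. \<exists>i\<in>I. A i TT} \<le> (\<Sum>i\<in>I. card {TT \<in> tt_space k c n. A i TT})"
    by (simp only: card_UN_le[OF assms])
  then have "real (card {TT \<in> tt_space k c n. \<exists>i\<in>I. A i TT}) \<le> (\<Sum>i\<in>I. real (card {TT \<in> tt_space k c n. A i TT}))"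
    unfolding of_nat_sum[symmetric] by (simp only: of_nat_le_iff)
  then show ?thesis unfolding tt_prob_def sum_divide_distrib[symmetric]
    by (intro divide_right_mono) simp_all
qed

subsection \<open>Obstructions\<close>

text \<open>The empty list is not a key; it stands for a vertex whose hash values are never inspected.\<close>

definition reduce :: "nat list set set \<Rightarrow> nat list set set" where
  "reduce M = M - {SOME e. e \<in> M \<and> ([] \<in> \<Union>M \<longrightarrow> [] \<in> e)}"

lemma reduceE:
  assumes "M \<in> perfect_matchings Z" "M \<noteq> {}"
  obtains e where "e \<in> M" "reduce M = M - {e}" "[] \<notin> \<Union>(reduce M)"
proof -
  define e where "e = (SOME e. e \<in> M \<and> ([] \<in> \<Union>M \<longrightarrow> [] \<in> e))"
  have "\<exists>e. e \<in> M \<and> ([] \<in> \<Union>M \<longrightarrow> [] \<in> e)" using assms(2) by blast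
  then have e: "e \<in> M" "[] \<in> \<Union>M \<Longrightarrow> [] \<in> e"
    unfolding e_def using someI_ex[of "\<lambda>e. e \<in> M \<and> ([] \<in> \<Union>M \<longrightarrow> [] \<in> e)"] by auto
  have red: "reduce M = M - {e}" by (simp only: reduce_def e_def)
  have "[] \<notin> \<Union>(M - {e})"
    using e perfect_matchings_edge_unique[OF assms(1)] by blast
  then show ?thesis using that[OF e(1) red] unfolding red by blast
qed

lemma reduce_insert:
  assumes "M \<in> perfect_matchings Z" "[] \<notin> Z" "y \<notin> Z" "y \<noteq> []"
  shows "reduce (insert {[], y} M) = M"
proof -
  have I: "insert {[], y} M \<in> perfect_matchings (insert [] (insert y Z))"
    by (rule perfect_matchings_insert) (use assms in auto)
  obtain e where e: "e \<in> insert {[], y} M" "reduce (insert {[], y} M) = insert {[], y} M - {e}"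
      "[] \<notin> \<Union>(reduce (insert {[], y} M))"
    by (rule reduceE[OF I]) auto
  have "{[], y} \<notin> M" using perfect_matchingsD(1)[OF assms(1)] assms(2) by blast
  moreover have "e = {[], y}" using e(2,3) by blast
  ultimately show ?thesis using e(2) by simp
qed

text \<open>The recursion runs from level \<open>n - 1\<close> down to level 0 inside shrinking
  vertex sets. \<open>M\<close> is meant to be a minimal dependent matching, hence independent only
  after \<open>reduce\<close>; at least two pairs are required so that at least one agreement
  remains to be paid for.\<close>

fun obstructed :: "(nat \<Rightarrow> nat \<Rightarrow> nat \<Rightarrow> nat) \<Rightarrow> nat \<Rightarrow> nat \<Rightarrow> nat list set \<Rightarrow> bool" where
  "obstructed TT c 0 U \<longleftrightarrow> True"
| "obstructed TT c (Suc n) U \<longleftrightarrow> (\<exists>M. M \<in> perfect_matchings (\<Union>M) \<and> \<Union>M \<subseteq> U \<and> 2 \<le> card M \<and>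
     obstructed TT c n (\<Union>M) \<and> level_match TT c n (reduce M))"

lemma obstructed_cong:
  assumes "\<And>j. j < n \<Longrightarrow> TT j = TT' j"
  shows "obstructed TT c n U \<longleftrightarrow> obstructed TT' c n U"
  using assms
proof (induction n arbitrary: U)
  case 0
  then show ?case by simp
next
  case (Suc n)
  have "obstructed TT c n V = obstructed TT' c n V" for V by (rule Suc.IH) (simp add: Suc.prems)
  moreover have "level_match TT c n M = level_match TT' c n M" for M
    by (rule level_match_cong) (simp add: Suc.prems)
  ultimately show ?case by simp
qed

text \<open>A union bound over the vertex set and the matching used at the top level;
  \<open>BB\<close> says that \<open>B\<close> is a supersolution of the resulting recursion, with
  the factor \<open>3 / 2 ^ k\<close> taken out for each level.\<close>

lemma tt_prob_obstructed:
  fixes B :: "nat \<Rightarrow> real"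
  assumes c: "c \<ge> 1"
    and B1: "\<And>m. 2 \<le> m \<Longrightarrow> 1 \<le> B m"
    and BB: "\<And>m. 2 \<le> m \<Longrightarrow> m \<le> N \<Longrightarrow>
       (\<Sum>w=2..m. real ((2 * m) choose (2 * w)) * real (dfact w) * (1 / 2 ^ k) ^ (w - 1) * B w) \<le> 3 / 2 ^ k * B m"
    and "U \<subseteq> insert [] (keys (2 ^ k) c)" "card U = 2 * m" "2 \<le> m" "m \<le> N"
  shows "tt_prob k c n (\<lambda>TT. obstructed TT c n U) \<le> B m * (3 / 2 ^ k) ^ n"
  using assms(4-7)
proof (induction n arbitrary: U m)
  case 0
  then show ?case using B1[of m] card_tt_space_pos[of k c 0] by (simp add: tt_prob_def)
next
  case (Suc n)
  let ?s = "2 ^ k :: real"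
  have finU: "finite U" using Suc.prems(1) finite_subset by fastforce
  define E where "E U' M TT \<longleftrightarrow> obstructed TT c n U' \<and> level_match TT c n (reduce M)" for U' M TT
  define \<U> where "\<U> w = {U'. U' \<subseteq> U \<and> card U' = 2 * w}" for w
  have fin\<U>: "finite (\<U> w)" for w unfolding \<U>_def using finU by simp
  have fin': "finite U'" if "U' \<in> \<U> w" for U' w using that finU finite_subset unfolding \<U>_def by blast
  have single: "tt_prob k c (Suc n) (E U' M) \<le> (1 / ?s) ^ (w - 1) * (B w * (3 / ?s) ^ n)"
    if w: "w \<in> {2..m}" and U': "U' \<in> \<U> w" and M: "M \<in> perfect_matchings U'" for w U' M
  proof -
    have cM: "card M = w" using perfect_matchings_card[OF M] U' by (simp add: \<U>_def)
    then have "M \<noteq> {}" using w by auto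
    then obtain e where e: "e \<in> M" "reduce M = M - {e}" "[] \<notin> \<Union>(reduce M)" by (rule reduceE[OF M])
    have fM: "finite M" by (rule perfect_matchings_finite[OF M fin'[OF U']])
    have R: "reduce M \<in> perfect_matchings (\<Union>(reduce M))"
      by (rule perfect_matchings_subset[OF M]) (use e in auto)
    have "\<Union>(reduce M) \<subseteq> U'" using perfect_matchingsD(1)[OF M] e(2) by auto
    \<comment> \<open>\<open>reduce\<close> has dropped the pair containing \<open>[]\<close>, if
      there was one, so only genuine keys are inspected.\<close>
    then have K: "\<Union>(reduce M) \<subseteq> keys (2 ^ k) c" using U' Suc.prems(1) e(3) unfolding \<U>_def by blast
    have "card (reduce M) = w - 1" using e fM cM by simp
    then have "tt_prob k c (Suc n) (E U' M) \<le> (1 / ?s) ^ (w - 1) * tt_prob k c n (\<lambda>TT. obstructed TT c n U')"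
      using tt_prob_level_match[OF c K R, of n "\<lambda>TT. obstructed TT c n U'"] obstructed_cong
      unfolding E_def by metis
    also have "\<dots> \<le> (1 / ?s) ^ (w - 1) * (B w * (3 / ?s) ^ n)"
      by (intro mult_left_mono Suc.IH) (use Suc.prems U' w in \<open>auto simp: \<U>_def\<close>)
    finally show ?thesis .
  qed
  have "tt_prob k c (Suc n) (\<lambda>TT. obstructed TT c (Suc n) U) \<le>
     tt_prob k c (Suc n) (\<lambda>TT. \<exists>w\<in>{2..m}. \<exists>U'\<in>\<U> w. \<exists>M\<in>perfect_matchings U'. E U' M TT)"
  proof (rule tt_prob_mono)
    fix TT assume "obstructed TT c (Suc n) U"
    then obtain M where M: "M \<in> perfect_matchings (\<Union>M)" "\<Union>M \<subseteq> U" "2 \<le> card M" "E (\<Union>M) M TT"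
      unfolding E_def by auto
    have "card (\<Union>M) = 2 * card M" by (rule perfect_matchings_card[OF M(1)])
    moreover have "card (\<Union>M) \<le> card U" by (rule card_mono[OF finU M(2)])
    ultimately have "card M \<in> {2..m}" "\<Union>M \<in> \<U> (card M)" using M Suc.prems(2) by (auto simp: \<U>_def)
    then show "\<exists>w\<in>{2..m}. \<exists>U'\<in>\<U> w. \<exists>M\<in>perfect_matchings U'. E U' M TT" using M by blast
  qed
  also have "\<dots> \<le> (\<Sum>w=2..m. tt_prob k c (Suc n) (\<lambda>TT. \<exists>U'\<in>\<U> w. \<exists>M\<in>perfect_matchings U'. E U' M TT))"
    by (rule tt_prob_Bex_le) simp
  also have "\<dots> \<le> (\<Sum>w=2..m. \<Sum>U'\<in>\<U> w. tt_prob k c (Suc n) (\<lambda>TT. \<exists>M\<in>perfect_matchings U'. E U' M TT))"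
    by (intro sum_mono tt_prob_Bex_le fin\<U>)
  also have "\<dots> \<le> (\<Sum>w=2..m. \<Sum>U'\<in>\<U> w. \<Sum>M\<in>perfect_matchings U'. tt_prob k c (Suc n) (E U' M))"
    by (intro sum_mono tt_prob_Bex_le finite_perfect_matchings fin')
  also have "\<dots> \<le> (\<Sum>w=2..m. \<Sum>U'\<in>\<U> w. \<Sum>M\<in>perfect_matchings U'. (1 / ?s) ^ (w - 1) * (B w * (3 / ?s) ^ n))"
    by (intro sum_mono single)
  also have "\<dots> \<le> (\<Sum>w=2..m. \<Sum>U'\<in>\<U> w. real (dfact w) * ((1 / ?s) ^ (w - 1) * (B w * (3 / ?s) ^ n)))"
  proof (intro sum_mono)
    fix w U' assume w: "w \<in> {2..m}" and U': "U' \<in> \<U> w"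
    have "card (perfect_matchings U') \<le> dfact w"
      by (rule card_perfect_matchings_le[OF fin'[OF U']]) (use U' in \<open>simp add: \<U>_def\<close>)
    moreover have "0 \<le> (1 / ?s) ^ (w - 1) * (B w * (3 / ?s) ^ n)"
      using B1[of w] w by (intro mult_nonneg_nonneg) auto
    ultimately show "(\<Sum>M\<in>perfect_matchings U'. (1 / ?s) ^ (w - 1) * (B w * (3 / ?s) ^ n))
        \<le> real (dfact w) * ((1 / ?s) ^ (w - 1) * (B w * (3 / ?s) ^ n))"
      unfolding sum_constant by (intro mult_right_mono of_nat_mono)
  qed
  also have "\<dots> = (\<Sum>w=2..m. real ((2 * m) choose (2 * w)) * real (dfact w) * (1 / ?s) ^ (w - 1) * B w) * (3 / ?s) ^ n"
  proof -
    have "card (\<U> w) = (2 * m) choose (2 * w)" for w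
      unfolding \<U>_def using n_subsets[OF finU, of "2 * w"] Suc.prems(2) by simp
    then show ?thesis by (simp add: sum_distrib_right mult.assoc)
  qed
  also have "\<dots> \<le> (3 / ?s * B m) * (3 / ?s) ^ n"
    by (intro mult_right_mono BB) (use Suc.prems in auto)
  finally show ?case by (simp add: mult_ac)
qed

section \<open>Zero sets force obstructions\<close>

lemma zero_upto_pair:
  assumes "zero_upto K n {u, v}" "u \<noteq> v" "j < n"
  shows "K u ! j = K v ! j"
proof (rule ccontr)
  assume "K u ! j \<noteq> K v ! j"
  then have "{w \<in> {u, v}. K w ! j = K u ! j} = {u}" using assms(2) by auto
  moreover have "even (card {w \<in> {u, v}. K w ! j = K u ! j})" using assms(1,3) unfolding zero_upto_def by blast
  ultimately show False by simp
qed

text \<open>One dependent agreeing pair would consist of two vertices that share their first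
  \<open>c\<close> characters: those before position \<open>c + n - 1\<close> by dependence, and
  that position, which is among them when \<open>n = 0\<close>, by agreement.\<close>

lemma card_matching_ge_2:
  assumes M: "M \<in> perfect_matchings Z" "finite Z" "M \<noteq> {}" and "zero_upto K (c + n - 1) (\<Union>M)"
    and agree: "agree_at K (c + n - 1) M" and "c \<ge> 1"
    and inj: "\<And>u v. u \<in> Z \<Longrightarrow> v \<in> Z \<Longrightarrow> u \<noteq> v \<Longrightarrow> \<exists>j<c. K u ! j \<noteq> K v ! j"
  shows "2 \<le> card M"
proof (rule ccontr)
  assume "\<not> ?thesis"
  moreover have "finite M" by (rule perfect_matchings_finite[OF M(1,2)])
  ultimately have "card M = 1" using M(3) by (metis Suc_leI card_gt_0_iff le_antisym not_less_eq_eq numeral_2_eq_2 One_nat_def)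
  then obtain e where e: "M = {e}" by (auto simp: card_1_singleton_iff)
  then obtain u v where uv: "e = {u, v}" "u \<noteq> v"
    using perfect_matchingsD(3)[OF M(1), of e] by (auto simp: card_2_iff)
  then obtain j where j: "j < c" "K u ! j \<noteq> K v ! j"
    using inj[of u v] perfect_matchingsD(1)[OF M(1)] e by auto
  then consider "j < c + n - 1" | "j = c + n - 1" using assms(6) by linarith
  then show False
  proof cases
    case 1
    then show False using zero_upto_pair[of K "c + n - 1" u v j] assms(4) e uv j by simp
  next
    case 2
    then show False using agree e uv j unfolding agree_at_def by blast
  qed
qed

text \<open>A zero set on \<open>c + n\<close> positions has a matching that agrees at position
  \<open>c + n - 1\<close>; a minimal dependent part of it covers a zero set on one position fewer,
  and the induction descends. The value \<open>K []\<close> is constrained only by injectivity: it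
  will be the derived key of the vertex that \<open>[]\<close> replaces.\<close>

lemma obstructed_if_zero:
  assumes c: "c \<ge> 1" and "finite U" and n: "n \<le> Suc d"
    and K: "\<And>v. v \<in> U \<Longrightarrow> v \<noteq> [] \<Longrightarrow> length v = c \<and> K v = derived_key TT c d v"
    and inj: "\<And>u v. u \<in> U \<Longrightarrow> v \<in> U \<Longrightarrow> u \<noteq> v \<Longrightarrow> \<exists>j<c. K u ! j \<noteq> K v ! j"
    and "Z \<subseteq> U" "Z \<noteq> {}" "zero_upto K (c + n - 1) Z"
  shows "obstructed TT c n U"
  using assms(2-)
proof (induction n arbitrary: U Z)
  case 0
  then show ?case by simp
next
  case (Suc n)
  have finZ: "finite Z" using Suc.prems finite_subset by blast
  have zero: "zero_upto K (c + n) Z" using Suc.prems by simp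
  have "\<exists>M\<in>perfect_matchings Z. \<forall>e\<in>M. \<forall>u\<in>e. \<forall>v\<in>e. K u ! (c + n - 1) = K v ! (c + n - 1)"
    by (rule ex_agreeing_perfect_matching[OF finZ]) (use zero c in \<open>auto simp: zero_upto_def\<close>)
  then obtain M0 where M0: "M0 \<in> perfect_matchings Z" "agree_at K (c + n - 1) M0"
    unfolding agree_at_def by blast
  define P where "P M \<longleftrightarrow> M \<subseteq> M0 \<and> M \<noteq> {} \<and> zero_upto K (c + n - 1) (\<Union>M)" for M
  have "P M0" unfolding P_def
    using perfect_matchingsD(1)[OF M0(1)] Suc.prems zero_upto_mono[OF zero, of "c + n - 1"] by auto
  \<comment> \<open>Least cardinality makes \<open>M\<close> minimal under inclusion, so dropping
    any pair, in particular the one chosen by \<open>reduce\<close>, leaves an independent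
    set.\<close>
  then obtain M where PM: "P M" and min: "\<And>L. P L \<Longrightarrow> card M \<le> card L"
    using ex_has_least_nat[of P M0 card] by blast
  have M: "M \<in> perfect_matchings (\<Union>M)"
    by (rule perfect_matchings_subset[OF M0(1)]) (use PM in \<open>simp add: P_def\<close>)
  have MU: "\<Union>M \<subseteq> U" using PM perfect_matchingsD(1)[OF M0(1)] Suc.prems(5) unfolding P_def by blast
  have finUM: "finite (\<Union>M)" using MU Suc.prems(1) finite_subset by blast
  have agree: "agree_at K (c + n - 1) M"
    by (rule agree_at_subset[OF M0(2)]) (use PM in \<open>simp add: P_def\<close>)
  have c2: "2 \<le> card M"
    by (rule card_matching_ge_2[OF M finUM _ _ agree c]) (use PM Suc.prems(4) MU in \<open>auto simp: P_def\<close>)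
  obtain e where e: "e \<in> M" "reduce M = M - {e}" "[] \<notin> \<Union>(reduce M)"
    by (rule reduceE[OF M]) (use PM in \<open>simp add: P_def\<close>)
  have finM: "finite M" by (rule perfect_matchings_finite[OF M finUM])
  have "indep_upto K (c + n - 1) (reduce M)"
    unfolding indep_upto_def
  proof (intro allI impI notI)
    fix L assume L: "L \<subseteq> reduce M" "L \<noteq> {}" "zero_upto K (c + n - 1) (\<Union>L)"
    then have "P L" using PM e unfolding P_def by blast
    moreover have "card L < card M" by (rule psubset_card_mono[OF finM]) (use L e in auto)
    ultimately show False using min[of L] by simp
  qed
  moreover have eqK: "K v ! j = derived_key TT c n v ! j" if "v \<in> \<Union>(reduce M)" "j < c + n" for v j
  proof -
    have "v \<in> \<Union>M" using that(1) e(2) by blast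
    then have "v \<in> U" "v \<noteq> []" using that(1) MU e(3) by blast+
    then show ?thesis using Suc.prems(2,3) derived_key_nth_mono[of v c n d j TT] that c by simp
  qed
  have "agree_at K (c + n - 1) (reduce M)" by (rule agree_at_subset[OF agree]) (use e in auto)
  have "level_match TT c n (reduce M)"
    unfolding level_match_def
  proof
    show "indep_upto (derived_key TT c n) (c + n - 1) (reduce M)"
      using calculation indep_upto_cong[of "reduce M" "c + n - 1" K "derived_key TT c n"] eqK by simp
    show "agree_at (derived_key TT c n) (c + n - 1) (reduce M)"
      using \<open>agree_at K (c + n - 1) (reduce M)\<close>
        agree_at_cong[of "reduce M" K "c + n - 1" "derived_key TT c n"] eqK c by simp
  qed
  moreover have "obstructed TT c n (\<Union>M)"
  proof (rule Suc.IH[of "\<Union>M" "\<Union>M"])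
    show "\<Union>M \<noteq> {}"
    proof
      assume "\<Union>M = {}"
      then have "card (\<Union>M) = 0" by (simp only: card.empty)
      then show False using c2 perfect_matchings_card[OF M] by simp
    qed
    show "length v = c \<and> K v = derived_key TT c d v" if "v \<in> \<Union>M" "v \<noteq> []" for v
      using that Suc.prems(3) MU by blast
    show "\<exists>j<c. K u ! j \<noteq> K v ! j" if "u \<in> \<Union>M" "v \<in> \<Union>M" "u \<noteq> v" for u v
      using that Suc.prems(4) MU by blast
  qed (use Suc.prems(2) finUM PM in \<open>auto simp: P_def\<close>)
  ultimately show ?case using M MU c2 by auto
qed

section \<open>Minimal zero sets and alternating walks\<close>

text \<open>Independence of the keys of \<open>S\<close> outside \<open>Q\<close> modulo the span of
  \<open>Q\<close>. This lets the hash values of all queries, on which the selection of a key may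
  depend, be held fixed.\<close>

definition indep_mod :: "('v \<Rightarrow> nat list) \<Rightarrow> nat \<Rightarrow> 'v set \<Rightarrow> 'v set \<Rightarrow> bool" where
  "indep_mod K n S Q \<longleftrightarrow> (\<forall>A\<subseteq>S \<union> Q. A \<inter> (S - Q) \<noteq> {} \<longrightarrow> \<not> zero_upto K n A)"

text \<open>Minimising first the number of elements outside \<open>Q\<close> makes \<open>Z - {x}\<close> independent modulo \<open>Q\<close>.\<close>

lemma ex_minimal_zero_set:
  assumes "finite X" "Q \<subseteq> X" and A: "A \<subseteq> X" "A \<noteq> {}" "zero_upto K n A"
  obtains Z x where "Z \<subseteq> X" "x \<in> Z" "zero_upto K n Z"
    "\<And>Y. Y \<subset> Z \<Longrightarrow> Y \<noteq> {} \<Longrightarrow> \<not> zero_upto K n Y"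
    "indep_mod K n (Z - {x}) Q"
proof -
  define P where "P Z \<longleftrightarrow> Z \<subseteq> X \<and> Z \<noteq> {} \<and> zero_upto K n Z" for Z
  have "P A" using A by (simp add: P_def)
  then obtain Z1 where Z1: "P Z1" "\<And>Y. P Y \<Longrightarrow> card (Z1 - Q) \<le> card (Y - Q)"
    using ex_has_least_nat[of P A "\<lambda>Y. card (Y - Q)"] by blast
  define P' where "P' Z \<longleftrightarrow> P Z \<and> card (Z - Q) = card (Z1 - Q)" for Z
  have "P' Z1" using Z1 by (simp add: P'_def)
  \<comment> \<open>The second minimisation, of the whole cardinality, excludes proper nonempty zero
    subsets.\<close>
  then obtain Z where Z: "P' Z" "\<And>Y. P' Y \<Longrightarrow> card Z \<le> card Y"
    using ex_has_least_nat[of P' Z1 card] by blast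
  have PZ: "P Z" and cZ: "card (Z - Q) = card (Z1 - Q)" using Z(1) by (auto simp: P'_def)
  have finZ: "finite Z" using PZ assms(1) finite_subset unfolding P_def by blast
  \<comment> \<open>With \<open>x\<close> outside \<open>Q\<close>, a zero set inside the union of
    \<open>Z - {x}\<close> and \<open>Q\<close> has fewer elements outside \<open>Q\<close> than
    \<open>Z\<close> has. If no such \<open>x\<close> exists, \<open>Z\<close> lies in
    \<open>Q\<close> and there is nothing to show.\<close>
  obtain x where x: "x \<in> Z" "Z - Q \<noteq> {} \<Longrightarrow> x \<in> Z - Q"
    using PZ unfolding P_def by blast
  show ?thesis
  proof (rule that[of Z x])
    show "Z \<subseteq> X" "zero_upto K n Z" using PZ by (auto simp: P_def)
    show "x \<in> Z" by (rule x(1))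
    fix Y assume Y: "Y \<subset> Z" "Y \<noteq> {}"
    show "\<not> zero_upto K n Y"
    proof
      assume "zero_upto K n Y"
      then have PY: "P Y" using Y PZ by (auto simp: P_def)
      have "card (Y - Q) \<le> card (Z - Q)" by (rule card_mono) (use Y finZ in auto)
      then have "P' Y" using Z1(2)[OF PY] PY cZ by (simp add: P'_def)
      then show False using Z(2)[of Y] psubset_card_mono[OF finZ Y(1)] by simp
    qed
  next
    show "indep_mod K n (Z - {x}) Q"
      unfolding indep_mod_def
    proof (intro allI impI notI)
      fix Y assume Y: "Y \<subseteq> Z - {x} \<union> Q" "Y \<inter> (Z - {x} - Q) \<noteq> {}" "zero_upto K n Y"
      then have "P Y" using PZ assms(2) unfolding P_def by blast
      moreover have "card (Y - Q) < card (Z - Q)"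
        by (rule psubset_card_mono) (use Y x finZ in auto)
      ultimately show False using Z1(2) cZ by fastforce
    qed
  qed
qed

lemma indep_mod_subset: "indep_mod K n S Q \<Longrightarrow> S' \<subseteq> S \<Longrightarrow> indep_mod K n S' Q"
  unfolding indep_mod_def by blast

text \<open>Serves to put the stand-in \<open>[]\<close> in the place of the vertex
  \<open>b\<close>.\<close>

lemma zero_upto_rename:
  assumes "zero_upto K n Z" "b \<in> Z" "a \<notin> Z" "K' a = K b" "\<And>v. v \<in> Z \<Longrightarrow> v \<noteq> b \<Longrightarrow> K' v = K v"
  shows "zero_upto K' n (insert a (Z - {b}))"
proof -
  have "card {v \<in> insert a (Z - {b}). K' v ! j = ch} = card {v \<in> Z. K v ! j = ch}" for j ch
    by (rule bij_betw_same_card[of "\<lambda>v. if v = a then b else v"],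
        rule bij_betw_byWitness[of _ "\<lambda>v. if v = b then a else v"])
       (use assms(2-) in \<open>auto split: if_splits\<close>)
  then show ?thesis using assms(1) by (simp only: zero_upto_def)
qed

text \<open>Walking along the alternating cycles of two perfect matchings \<open>M1\<close> and \<open>M2\<close>:
  \<open>A \<subseteq> M1\<close> is what is left of the walk that ends in the vertex \<open>b\<close>, and \<open>N \<subseteq> M2\<close> covers
  all the vertices of \<open>A\<close> but \<open>b\<close> and \<open>t\<close>.\<close>

definition alternating :: "'v set set \<Rightarrow> 'v set set \<Rightarrow> 'v \<Rightarrow> 'v set set \<Rightarrow> 'v \<Rightarrow> 'v \<Rightarrow> 'v set set \<Rightarrow> bool" where
  "alternating M1 M2 x A b t N \<longleftrightarrow> A \<subseteq> M1 \<and> N \<subseteq> M2 \<and> b \<noteq> t \<and> b \<notin> \<Union>N \<and> t \<notin> \<Union>N \<and>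
     \<Union>A = insert b (insert t (\<Union>N)) \<and> x \<notin> \<Union>A - {b}"

lemma alternatingD:
  assumes "alternating M1 M2 x A b t N"
  shows "A \<subseteq> M1" "N \<subseteq> M2" "b \<noteq> t" "b \<notin> \<Union>N" "t \<notin> \<Union>N"
    "\<Union>A = insert b (insert t (\<Union>N))" "x \<notin> \<Union>A - {b}"
  using assms unfolding alternating_def by - (elim conjE, assumption)+

lemma alternating_start:
  assumes "M1 \<in> perfect_matchings Z" "M2 \<in> perfect_matchings Z" "x \<in> Z"
  obtains t N where "alternating M1 M2 x M1 x t N"
proof -
  obtain t where t: "t \<noteq> x" "t \<in> Z" "{x, t} \<in> M2" by (rule perfect_matchings_edge[OF assms(2,3)])
  have "\<Union>(M2 - {{x, t}}) = Z - {x, t}"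
    using perfect_matchings_Union_Diff[OF assms(2), of "{{x, t}}"] t by auto
  then have "alternating M1 M2 x M1 x t (M2 - {{x, t}})"
    using perfect_matchingsD(1)[OF assms(1)] t assms(3) unfolding alternating_def by auto
  then show ?thesis by (rule that)
qed

lemma alternating_step:
  assumes M1: "M1 \<in> perfect_matchings Z" and M2: "M2 \<in> perfect_matchings Z"
    and alt: "alternating M1 M2 x A b t N" and y: "{b, y} \<in> A" "y \<noteq> b" and "A - {{b, y}} \<noteq> {}"
  obtains b' t' N' where "alternating M1 M2 x (A - {{b, y}}) b' t' N'"
proof -
  let ?A = "A - {{b, y}}"
  have sub: "A \<subseteq> M1" "N \<subseteq> M2" and bt: "b \<noteq> t" "b \<notin> \<Union>N" "t \<notin> \<Union>N"
    and UA: "\<Union>A = insert b (insert t (\<Union>N))" and x: "x \<notin> \<Union>A - {b}"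
    by (fact alternatingD[OF alt])+
  have pA: "A \<in> perfect_matchings (\<Union>A)" by (rule perfect_matchings_subset[OF M1 sub(1)])
  have pN: "N \<in> perfect_matchings (\<Union>N)" by (rule perfect_matchings_subset[OF M2 sub(2)])
  have UA': "\<Union>?A = \<Union>A - {b, y}"
    using perfect_matchings_Union_Diff[OF pA, of "{{b, y}}"] y by auto
  have yA: "y \<in> \<Union>A" using y by blast
  \<comment> \<open>The excluded key \<open>x\<close> can only be the current end \<open>b\<close>,
    which is removed in this step.\<close>
  have xA: "x \<notin> \<Union>?A" using UA' x by blast
  show ?thesis
  proof (cases "y = t")
    \<comment> \<open>The removed pair closes a cycle. The remaining pairs and \<open>N\<close> now
      cover the same vertices, so the walk may resume anywhere.\<close>
    case True
    then have UN: "\<Union>?A = \<Union>N" using UA' UA bt by auto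
    moreover have "\<Union>?A \<noteq> {}"
    proof -
      obtain e where "e \<in> ?A" using assms(6) by blast
      moreover then have "card e = 2" using perfect_matchingsD(3)[OF pA] by blast
      ultimately show ?thesis by (metis Sup_upper card.empty subset_empty zero_neq_numeral)
    qed
    ultimately obtain b' where b': "b' \<in> \<Union>N" by blast
    obtain t' where t': "t' \<noteq> b'" "t' \<in> \<Union>N" "{b', t'} \<in> N" by (rule perfect_matchings_edge[OF pN b'])
    have "\<Union>(N - {{b', t'}}) = \<Union>N - {b', t'}"
      using perfect_matchings_Union_Diff[OF pN, of "{{b', t'}}"] t' by auto
    then have "alternating M1 M2 x ?A b' t' (N - {{b', t'}})"
      unfolding alternating_def UN using sub b' t' xA UN by auto
    then show ?thesis by (rule that)
  next
    \<comment> \<open>The walk proceeds from \<open>y\<close> along its \<open>M2\<close> pair to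
      \<open>b'\<close>; \<open>t\<close> stays the other vertex that \<open>N\<close>
      misses.\<close>
    case False
    then have yN: "y \<in> \<Union>N" using yA UA y by auto
    obtain b' where b': "b' \<noteq> y" "b' \<in> \<Union>N" "{y, b'} \<in> N" by (rule perfect_matchings_edge[OF pN yN])
    have UN: "\<Union>(N - {{y, b'}}) = \<Union>N - {y, b'}"
      using perfect_matchings_Union_Diff[OF pN, of "{{y, b'}}"] b' by auto
    have "\<Union>?A = insert t (\<Union>N - {y})" using UA' UA bt False by auto
    then have "\<Union>?A = insert b' (insert t (\<Union>(N - {{y, b'}})))" unfolding UN using b' by auto
    moreover have "b' \<noteq> t" using b' bt by auto
    ultimately have "alternating M1 M2 x ?A b' t (N - {{y, b'}})"
      unfolding alternating_def UN using sub b' bt xA UN by auto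
    then show ?thesis by (rule that)
  qed
qed

text \<open>The exploration is run backwards: all of \<open>M1\<close> is dependent, and the walk
  removes its pairs one by one. A dependent remainder of least size becomes independent with its
  next removal; if it has at least \<open>m0\<close> pairs, the walk goes on until exactly
  \<open>m0\<close> are left, where independence after the next removal persists but dependence
  before it is no longer claimed. In both cases \<open>m\<close> is the number of pairs
  left.\<close>

lemma obstruction_exists:
  assumes c: "c \<ge> 1" and X: "X \<subseteq> keys s c" "Q \<subseteq> X"
    and A: "A \<subseteq> X" "A \<noteq> {}" "zero_upto (derived_key TT c (Suc d)) (c + Suc d) A"
    and m0: "m0 \<ge> 1"
  shows "\<exists>m S M1 M2. S \<subseteq> X \<and> card S = 2 * m - 1 \<and>
    M1 \<in> perfect_matchings (insert [] S) \<and> M2 \<in> perfect_matchings (insert [] S) \<and>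
    level_match TT c d (reduce M1) \<and> level_match TT c (Suc d) (reduce M2) \<and>
    indep_mod (derived_key TT c (Suc d)) (c + Suc d) S Q \<and>
    (2 \<le> m \<and> m < m0 \<and> obstructed TT c d (insert [] S) \<or> m = m0)"
proof -
  define K where "K = derived_key TT c (Suc d)"
  have finX: "finite X" by (rule finite_subset[OF X(1)]) simp
  have lenX: "length v = c" if "v \<in> X" for v using that X by (auto simp: keys_def)
  have inj: "\<exists>j<c. K u ! j \<noteq> K v ! j" if "u \<in> X" "v \<in> X" "u \<noteq> v" for u v
    unfolding K_def using derived_key_inj_prefix[of u s c v] that X c by blast
  obtain Z x where Z: "Z \<subseteq> X" "x \<in> Z" "zero_upto K (c + Suc d) Z"
    and min: "\<And>Y. Y \<subset> Z \<Longrightarrow> Y \<noteq> {} \<Longrightarrow> \<not> zero_upto K (c + Suc d) Y"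
    and ind: "indep_mod K (c + Suc d) (Z - {x}) Q"
    by (rule ex_minimal_zero_set[OF finX X(2) A(1,2), of K "c + Suc d"]) (use A K_def in auto)
  have finZ: "finite Z" using Z finX finite_subset by blast
  have ev: "even (card {v \<in> Z. K v ! p = a})" if "p < c + Suc d" for p a
    using Z(3) that unfolding zero_upto_def by blast
  have match: "\<exists>M\<in>perfect_matchings Z. agree_at K p M" if "p < c + Suc d" for p
    unfolding agree_at_def by (rule ex_agreeing_perfect_matching[OF finZ ev[OF that]])
  have "c + d - 1 < c + Suc d" by simp
  then obtain M1 where M1: "M1 \<in> perfect_matchings Z" "agree_at K (c + d - 1) M1" using match by blast
  have "c + d < c + Suc d" by simp
  then obtain M2 where M2: "M2 \<in> perfect_matchings Z" "agree_at K (c + d) M2" using match by blast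
  define dep where "dep A \<longleftrightarrow> \<not> indep_upto K (c + d - 1) A" for A
  define alt where "alt A \<longleftrightarrow> (\<exists>b t N. alternating M1 M2 x A b t N)" for A
  have edge: "\<exists>y. {b, y} \<in> A \<and> y \<noteq> b" if "alternating M1 M2 x A b t N" for A b t N
  proof -
    have bA: "b \<in> \<Union>A" by (subst alternatingD(6)[OF that]) simp
    have pA: "A \<in> perfect_matchings (\<Union>A)"
      by (rule perfect_matchings_subset[OF M1(1) alternatingD(1)[OF that]])
    show ?thesis by (rule perfect_matchings_edge[OF pA bA]) blast
  qed
  have finM1: "finite M1" by (rule perfect_matchings_finite[OF M1(1) finZ])
  have finA: "finite A" if "alternating M1 M2 x A b t N" for A b t N
    by (rule finite_subset[OF alternatingD(1)[OF that] finM1])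

  define good where "good A b t N y \<longleftrightarrow> alternating M1 M2 x A b t N \<and> {b, y} \<in> A \<and> y \<noteq> b \<and>
     \<not> dep (A - {{b, y}})" for A b t N y

  have "alt M1 \<and> dep M1"
  proof
    show "alt M1" unfolding alt_def using alternating_start[OF M1(1) M2(1) Z(2)] by blast
    have "zero_upto K (c + d - 1) (\<Union>M1)"
      using zero_upto_mono[OF Z(3)] perfect_matchingsD(1)[OF M1(1)] by simp
    moreover have "M1 \<noteq> {}" using perfect_matchingsD(1)[OF M1(1)] Z(2) by auto
    ultimately show "dep M1" unfolding dep_def indep_upto_def by blast
  qed
  then obtain A0 where A0: "alt A0" "dep A0" and A0min: "\<And>A. alt A \<Longrightarrow> dep A \<Longrightarrow> card A0 \<le> card A"
    using ex_has_least_nat[of "\<lambda>A. alt A \<and> dep A" M1 card] by blast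
  obtain b0 t0 N0 where alt0: "alternating M1 M2 x A0 b0 t0 N0" using A0 unfolding alt_def by blast
  obtain y0 where y0: "{b0, y0} \<in> A0" "y0 \<noteq> b0" using edge[OF alt0] by blast
  \<comment> \<open>Otherwise the walk could go on from here to a smaller dependent
    remainder.\<close>
  have "\<not> dep (A0 - {{b0, y0}})"
  proof
    assume dep: "dep (A0 - {{b0, y0}})"
    then have "A0 - {{b0, y0}} \<noteq> {}" unfolding dep_def indep_upto_def by blast
    then have "alt (A0 - {{b0, y0}})"
      unfolding alt_def using alternating_step[OF M1(1) M2(1) alt0 y0] by blast
    then have "card A0 \<le> card (A0 - {{b0, y0}})" using A0min dep by blast
    moreover have "card (A0 - {{b0, y0}}) < card A0"
      by (rule card_Diff1_less[OF finA[OF alt0] y0(1)])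
    ultimately show False by simp
  qed
  then have good0: "good A0 b0 t0 N0 y0" unfolding good_def using alt0 y0 by simp
  have descend: "\<exists>A b t N y. good A b t N y \<and> card A = m0" if "good A b t N y" "card A = m0 + i" for A b t N y i
    using that
  proof (induction i arbitrary: A b t N y)
    case 0
    then have "card A = m0" by simp
    then show ?case using 0(1) by blast
  next
    case (Suc i)
    have g: "alternating M1 M2 x A b t N" "{b, y} \<in> A" "y \<noteq> b" "\<not> dep (A - {{b, y}})"
      using Suc.prems(1) unfolding good_def by auto
    let ?A = "A - {{b, y}}"
    have card: "card ?A = m0 + i" using g(2) finA[OF g(1)] Suc.prems(2) by simp
    then have "?A \<noteq> {}" using m0 by (metis add_is_0 card.empty not_one_le_zero)
    then obtain b' t' N' where alt': "alternating M1 M2 x ?A b' t' N'"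
      using alternating_step[OF M1(1) M2(1) g(1-3)] by blast
    obtain y' where y': "{b', y'} \<in> ?A" "y' \<noteq> b'" using edge[OF alt'] by blast
    have "\<not> dep (?A - {{b', y'}})"
      using g(4) indep_upto_subset[of K "c + d - 1" ?A "?A - {{b', y'}}"] unfolding dep_def by blast
    then have "good ?A b' t' N' y'" unfolding good_def using alt' y' by simp
    then show ?case by (rule Suc.IH[OF _ card])
  qed
  obtain A b t N y where good: "good A b t N y" and size: "dep A \<and> card A < m0 \<or> card A = m0"
  proof (cases "card A0 < m0")
    case True
    then show ?thesis using that good0 A0 by blast
  next
    case False
    then have "card A0 = m0 + (card A0 - m0)" by simp
    then obtain A b t N y where "good A b t N y" "card A = m0" using descend[OF good0] by blast
    then show ?thesis using that by blast
  qed
  have alt: "alternating M1 M2 x A b t N" and y: "{b, y} \<in> A" "y \<noteq> b" and indA: "\<not> dep (A - {{b, y}})"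
    using good unfolding good_def by auto
  have sub: "A \<subseteq> M1" "N \<subseteq> M2" and bt: "b \<noteq> t" "b \<notin> \<Union>N" "t \<notin> \<Union>N"
    and UA: "\<Union>A = insert b (insert t (\<Union>N))" and xA: "x \<notin> \<Union>A - {b}"
    by (fact alternatingD[OF alt])+
  have pA: "A \<in> perfect_matchings (\<Union>A)" by (rule perfect_matchings_subset[OF M1(1) sub(1)])
  have pN: "N \<in> perfect_matchings (\<Union>N)" by (rule perfect_matchings_subset[OF M2(1) sub(2)])
  have AZ: "\<Union>A \<subseteq> Z" using perfect_matchingsD(1)[OF M1(1)] sub(1) by blast
  have finUA: "finite (\<Union>A)" using AZ finZ finite_subset by blast
  have nil: "[] \<notin> \<Union>A" using AZ Z(1) lenX[of "[]"] c by auto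
  \<comment> \<open>Dropping \<open>b\<close> leaves \<open>2 * card A - 1\<close> keys, and
    \<open>x\<close> is not among them.\<close>
  define S where "S = \<Union>A - {b}"
  have bA: "b \<in> \<Union>A" "y \<in> \<Union>A" using y by blast+
  have SZ: "S \<subseteq> Z - {x}" using AZ xA unfolding S_def by blast
  have cS: "card S = 2 * card A - 1"
    using perfect_matchings_card[OF pA] bA finUA unfolding S_def by simp
  have pA': "A - {{b, y}} \<in> perfect_matchings (\<Union>A - {b, y})" by (rule perfect_matchings_Diff[OF pA y(1)])
  \<comment> \<open>In each matching one vertex has lost its partner, \<open>y\<close> in
    \<open>A\<close> and \<open>t\<close> in \<open>N\<close>; \<open>[]\<close> is paired with it,
    and \<open>reduce\<close> removes exactly this pair again.\<close>
  define L1 where "L1 = insert {[], y} (A - {{b, y}})"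
  define L2 where "L2 = insert {[], t} N"
  have nilt: "t \<noteq> []" "y \<noteq> []" "[] \<notin> \<Union>N" using nil bA UA by auto
  have "L1 \<in> perfect_matchings (insert [] (insert y (\<Union>A - {b, y})))"
    unfolding L1_def by (rule perfect_matchings_insert[OF pA']) (use nil nilt in auto)
  moreover have "insert y (\<Union>A - {b, y}) = S" unfolding S_def using bA y by auto
  ultimately have L1: "L1 \<in> perfect_matchings (insert [] S)" by simp
  have "L2 \<in> perfect_matchings (insert [] (insert t (\<Union>N)))"
    unfolding L2_def by (rule perfect_matchings_insert[OF pN]) (use nilt bt in auto)
  moreover have "insert t (\<Union>N) = S" unfolding S_def UA using bt by auto
  ultimately have L2: "L2 \<in> perfect_matchings (insert [] S)" by simp
  have r1: "reduce L1 = A - {{b, y}}"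
    unfolding L1_def by (rule reduce_insert[OF pA']) (use nil nilt in auto)
  have r2: "reduce L2 = N" unfolding L2_def by (rule reduce_insert[OF pN]) (use nilt bt in auto)

  have lev1: "level_match TT c d (A - {{b, y}})"
    unfolding level_match_def
  proof
    have eq: "K v ! j = derived_key TT c d v ! j" if "v \<in> \<Union>(A - {{b, y}})" "j < c + d" for v j
      unfolding K_def by (rule derived_key_nth_mono) (use that AZ Z(1) lenX c in auto)
    show "indep_upto (derived_key TT c d) (c + d - 1) (A - {{b, y}})"
      using indA indep_upto_cong[of "A - {{b, y}}" "c + d - 1" K "derived_key TT c d"] eq
      unfolding dep_def by simp
    have "agree_at K (c + d - 1) (A - {{b, y}})"
      by (rule agree_at_subset[OF M1(2)]) (use sub in auto)
    then show "agree_at (derived_key TT c d) (c + d - 1) (A - {{b, y}})"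
      using agree_at_cong[of "A - {{b, y}}" K "c + d - 1" "derived_key TT c d"] eq c by simp
  qed
  \<comment> \<open>Here the inclusion minimality of \<open>Z\<close> is used: \<open>N\<close>
    misses \<open>b\<close>, so by agreement at the last position a zero set made of its pairs would
    be a proper nonempty zero subset of \<open>Z\<close>.\<close>
  have lev2: "level_match TT c (Suc d) N"
    unfolding level_match_def K_def[symmetric]
  proof
    show "agree_at K (c + Suc d - 1) N" using agree_at_subset[OF M2(2) sub(2)] by simp
    show "indep_upto K (c + Suc d - 1) N"
      unfolding indep_upto_def
    proof (intro allI impI notI)
      fix L assume L: "L \<subseteq> N" "L \<noteq> {}" "zero_upto K (c + Suc d - 1) (\<Union>L)"
      have pL: "L \<in> perfect_matchings (\<Union>L)" by (rule perfect_matchings_subset[OF pN L(1)])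
      have "\<Union>L \<subseteq> \<Union>N" by (rule Union_mono[OF L(1)])
      moreover have "insert b (insert t (\<Union>N)) \<subseteq> Z" using AZ unfolding UA .
      ultimately have LZ: "\<Union>L \<subset> Z" using bt(2) by blast
      have finUL: "finite (\<Union>L)" by (rule finite_subset[OF _ finZ]) (use LZ in blast)
      have "zero_upto K (Suc (c + d)) (\<Union>L)"
        by (rule zero_upto_Suc_if_agree[OF pL finUL agree_at_subset[OF M2(2)]])
           (use L(1,3) sub(2) in auto)
      moreover have "\<Union>L \<noteq> {}"
      proof
        assume "\<Union>L = {}"
        then have "card (\<Union>L) = 0" by (simp only: card.empty)
        then have "card L = 0" using perfect_matchings_card[OF pL] by simp
        moreover have "finite L" by (rule perfect_matchings_finite[OF pL finUL])
        ultimately show False using L(2) by simp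
      qed
      ultimately show False using min[OF LZ] by simp
    qed
  qed
  have indS: "indep_mod K (c + Suc d) S Q" by (rule indep_mod_subset[OF ind SZ])
  have small: "2 \<le> card A \<and> obstructed TT c d (insert [] S)" if depA: "dep A"
  proof -
    obtain L where L: "L \<subseteq> A" "L \<noteq> {}" "zero_upto K (c + d - 1) (\<Union>L)"
      using depA unfolding dep_def indep_upto_def by blast
    have pL: "L \<in> perfect_matchings (\<Union>L)" by (rule perfect_matchings_subset[OF pA L(1)])
    have LA: "\<Union>L \<subseteq> \<Union>A" using L(1) by blast
    have finL: "finite (\<Union>L)" using LA finUA finite_subset by blast
    have aL: "agree_at K (c + d - 1) L" by (rule agree_at_subset[OF M1(2)]) (use L sub in auto)
    have "2 \<le> card L"
    proof (rule card_matching_ge_2[OF pL finL L(2,3) aL c])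
      fix u v assume "u \<in> \<Union>L" "v \<in> \<Union>L" "u \<noteq> v"
      then show "\<exists>j<c. K u ! j \<noteq> K v ! j" using LA AZ Z(1) by (intro inj) blast+
    qed
    moreover have "card L \<le> card A" by (rule card_mono[OF finA[OF alt] L(1)])
    ultimately have "2 \<le> card A" by simp
    have LU: "\<Union>L \<noteq> {}"
    proof
      assume "\<Union>L = {}"
      then have "card (\<Union>L) = 0" by (simp only: card.empty)
      then show False using \<open>2 \<le> card L\<close> perfect_matchings_card[OF pL] by simp
    qed
    \<comment> \<open>\<open>[]\<close> inherits the derived key of \<open>b\<close>, so the zero
      set provided by the dependence of \<open>A\<close> survives the exchange of \<open>b\<close>
      for \<open>[]\<close>.\<close>
    define K' where "K' v = (if v = [] then K b else K v)" for v
    have AX: "\<Union>A \<subseteq> X" using AZ Z(1) by blast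
    have inj': "\<exists>j<c. K' u ! j \<noteq> K' v ! j" if "u \<in> insert [] S" "v \<in> insert [] S" "u \<noteq> v" for u v
    proof -
      define g where "g w = (if w = [] then b else w)" for w
      have "g u \<in> X" "g v \<in> X" "g u \<noteq> g v" using that AX bA nil unfolding g_def S_def by (auto split: if_splits)
      then have "\<exists>j<c. K (g u) ! j \<noteq> K (g v) ! j" by (rule inj)
      moreover have "K' w = K (g w)" for w by (simp add: K'_def g_def)
      ultimately show ?thesis by simp
    qed
    have K'S: "length v = c \<and> K' v = derived_key TT c (Suc d) v" if "v \<in> insert [] S" "v \<noteq> []" for v
      using that AX lenX unfolding K'_def K_def S_def by auto
    define Z' where "Z' = (if b \<in> \<Union>L then insert [] (\<Union>L - {b}) else \<Union>L)"
    have "zero_upto K' (c + d - 1) Z'"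
    proof (cases "b \<in> \<Union>L")
      case True
      have nilL: "[] \<notin> \<Union>L" using nil LA by blast
      have "zero_upto K' (c + d - 1) (insert [] (\<Union>L - {b}))"
        by (rule zero_upto_rename[OF L(3) True nilL]) (use nilL in \<open>auto simp: K'_def\<close>)
      then show ?thesis unfolding Z'_def using True by (simp only: if_True)
    next
      case False
      have "zero_upto K' (c + d - 1) (\<Union>L) \<longleftrightarrow> zero_upto K (c + d - 1) (\<Union>L)"
        by (rule zero_upto_cong) (use nil LA in \<open>auto simp: K'_def\<close>)
      then show ?thesis unfolding Z'_def using L(3) False by simp
    qed
    moreover have "Z' \<subseteq> insert [] S" "Z' \<noteq> {}" using LA LU unfolding Z'_def S_def by auto
    moreover have "finite (insert [] S)" using finUA unfolding S_def by simp
    ultimately have "obstructed TT c d (insert [] S)"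
      using obstructed_if_zero[of c "insert [] S" d "Suc d" K' TT Z'] c inj' K'S by simp
    then show ?thesis using \<open>2 \<le> card A\<close> by simp
  qed
  have "S \<subseteq> X" using SZ Z(1) by blast
  moreover have "2 \<le> card A \<and> card A < m0 \<and> obstructed TT c d (insert [] S) \<or> card A = m0"
    using size small by blast
  ultimately show ?thesis
    using cS L1 L2 lev1[folded r1] lev2[folded r2] indS[unfolded K_def] by blast
qed

subsection \<open>Numerical estimates\<close>

text \<open>\<open>obstruction_bound\<close> has to solve the recursion \<open>obstruction_bound_rec\<close>. Splitting off the dominant
  factor \<open>2 m choose 4\<close> leaves a quantity of exponential growth, whose base, in thousandths, is chosen
  so that it is large enough for the recursion at \<open>|\<Sigma>| = 256\<close> (the worst case for small \<open>m\<close>) and at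
  \<open>m = 17 |\<Sigma>| / 64\<close>, and small enough for \<open>sum_obstruction_term_le\<close>.\<close>

definition growth_num :: "nat \<Rightarrow> nat" where
  "growth_num n = (if n \<le> 16 then 1000 + 36 * n else if n \<le> 22 then 1600 else if n \<le> 32 then 1900
     else if n \<le> 48 then 2300 else if n \<le> 60 then 2600 else 2900)"

definition growth :: "nat \<Rightarrow> real" where
  "growth n = real (growth_num n) / 1000"

definition obstruction_bound :: "nat \<Rightarrow> real" where
  "obstruction_bound m = real ((2 * m) choose 4) * growth (m - 2) ^ (m - 2)"

lemma growth_num_mono: "i \<le> j \<Longrightarrow> growth_num i \<le> growth_num j"
  by (auto simp: growth_num_def)

lemma growth_mono: "i \<le> j \<Longrightarrow> growth i \<le> growth j"
  using growth_num_mono by (simp add: growth_def divide_right_mono)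

lemma growth_ge_1: "1 \<le> growth n"
  by (auto simp: growth_def growth_num_def)

lemma obstruction_bound_ge_1:
  assumes "2 \<le> m"
  shows "1 \<le> obstruction_bound m"
proof -
  have "1 \<le> (2 * m) choose 4" using assms by (simp add: Suc_le_eq)
  then have "1 \<le> real ((2 * m) choose 4)" by linarith
  then show ?thesis unfolding obstruction_bound_def
    using mult_mono[of 1 "real ((2 * m) choose 4)" 1 "growth (m - 2) ^ (m - 2)"] one_le_power[OF growth_ge_1]
    by simp
qed

section \<open>Binomial sums behind the recursion\<close>

lemma Suc_times_choose_Suc: "Suc k * (n choose Suc k) = (n - k) * (n choose k)"
proof (cases n)
  case (Suc m)
  then show ?thesis using Suc_times_binomial[of k m] binomial_absorb_comp[of n k] by simp
qed simp

lemma choose_even_dfact_Suc: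
  "Suc j * (((2 * n) choose (2 * Suc j)) * dfact (Suc j)) =
     (n - j) * (2 * n - 2 * j - 1) * (((2 * n) choose (2 * j)) * dfact j)"
proof -
  have 1: "(2 * j + 1) * ((2 * n) choose (2 * j + 1)) = 2 * (n - j) * ((2 * n) choose (2 * j))"
    using Suc_times_choose_Suc[of "2 * j" "2 * n"] by (simp add: diff_mult_distrib2)
  have 2: "(2 * j + 2) * ((2 * n) choose (2 * j + 2)) = (2 * n - 2 * j - 1) * ((2 * n) choose (2 * j + 1))"
    using Suc_times_choose_Suc[of "2 * j + 1" "2 * n"] by simp
  have "2 * (Suc j * (((2 * n) choose (2 * Suc j)) * dfact (Suc j))) =
      ((2 * j + 2) * ((2 * n) choose (2 * j + 2))) * ((2 * j + 1) * dfact j)"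
    by (simp add: algebra_simps)
  also have "\<dots> = (2 * n - 2 * j - 1) * ((2 * j + 1) * ((2 * n) choose (2 * j + 1))) * dfact j"
    unfolding 2 by (simp only: mult_ac)
  also have "\<dots> = 2 * ((n - j) * (2 * n - 2 * j - 1) * (((2 * n) choose (2 * j)) * dfact j))"
    unfolding 1 by (simp only: mult_ac)
  finally show ?thesis by simp
qed

text \<open>On the left is the number of matchings with \<open>j\<close> pairs on
  \<open>2 * n\<close> points. The bound trades the even binomial coefficient for an ordinary one,
  to which the binomial theorem applies. Both sides start equal, and up to a common factor their
  consecutive ratios are \<open>2 * n - 2 * j - 1\<close> and \<open>2 * n - 1\<close>.\<close>

lemma choose_even_dfact_le:
  "((2 * n) choose (2 * j)) * dfact j \<le> (n choose j) * (2 * n - 1) ^ j"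
proof (induction j)
  case 0
  then show ?case by simp
next
  case (Suc j)
  have "Suc j * (((2 * n) choose (2 * Suc j)) * dfact (Suc j)) =
      (n - j) * (2 * n - 2 * j - 1) * (((2 * n) choose (2 * j)) * dfact j)"
    by (rule choose_even_dfact_Suc)
  also have "\<dots> \<le> (n - j) * (2 * n - 1) * ((n choose j) * (2 * n - 1) ^ j)"
    by (intro mult_le_mono Suc.IH) auto
  also have "\<dots> = ((n - j) * (n choose j)) * (2 * n - 1) ^ Suc j"
    by (simp only: mult_ac power_Suc)
  also have "\<dots> = Suc j * ((n choose Suc j) * (2 * n - 1) ^ Suc j)"
    unfolding Suc_times_choose_Suc[symmetric] by (simp only: mult_ac)
  finally show ?case by (simp only: mult_le_cancel1)
qed

lemma sum_index_binomial:
  fixes z :: real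
  shows "(\<Sum>j\<le>Suc n. real (Suc n choose j) * real j * z ^ j * f j) =
    real (Suc n) * z * (\<Sum>j\<le>n. real (n choose j) * z ^ j * f (Suc j))"
proof -
  have "real (Suc n choose Suc j) * real (Suc j) = real (Suc n) * real (n choose j)" for j
    using Suc_times_binomial[of j n] by (metis mult.commute of_nat_mult)
  then have "(\<Sum>j\<le>n. real (Suc n choose Suc j) * real (Suc j) * z ^ Suc j * f (Suc j)) =
     (\<Sum>j\<le>n. real (Suc n) * real (n choose j) * z ^ Suc j * f (Suc j))" by simp
  then show ?thesis
    by (simp add: sum.atMost_Suc_shift sum_distrib_left mult_ac del: binomial_Suc_Suc sum.atMost_Suc of_nat_Suc)
qed

lemma sum_binomial_pow: "(\<Sum>j\<le>n. real (n choose j) * z ^ j) = (1 + z) ^ n" for z :: real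
  using binomial_ring[of z 1 n] by (simp add: add.commute)

text \<open>The weight is written as \<open>1 + 4 * j + 4 / 3 * j * (j - 1)\<close>, whose falling
  factorials are absorbed into the binomial coefficients.\<close>

lemma sum_binomial_quadratic:
  fixes z :: real
  shows "(\<Sum>j\<le>Suc (Suc n). real (Suc (Suc n) choose j) * (real ((2 * j + 1) * (2 * j + 3)) / 3) * z ^ j) =
    (1 + z) ^ n * ((1 + z)\<^sup>2 + 4 * real (n + 2) * z * (1 + z) + 4 / 3 * real (n + 2) * real (n + 1) * z\<^sup>2)"
proof -
  let ?N = "Suc (Suc n)"
  have split: "real ((2 * j + 1) * (2 * j + 3)) / 3 = 1 + 4 * real j + 4 / 3 * (real j * (real j - 1))" for j
    by (simp add: field_simps)
  have 1: "(\<Sum>j\<le>?N. real (?N choose j) * real j * z ^ j) = real ?N * z * (1 + z) ^ Suc n"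
    using sum_index_binomial[of "Suc n" z "\<lambda>_. 1"] sum_binomial_pow[of "Suc n" z]
    by (simp del: binomial_Suc_Suc sum.atMost_Suc of_nat_Suc)
  have "(\<Sum>j\<le>?N. real (?N choose j) * real j * z ^ j * (real j - 1)) =
      real ?N * z * (\<Sum>j\<le>Suc n. real (Suc n choose j) * real j * z ^ j)"
    using sum_index_binomial[of "Suc n" z "\<lambda>j. real j - 1"]
    by (simp add: mult_ac del: binomial_Suc_Suc sum.atMost_Suc)
  also have "(\<Sum>j\<le>Suc n. real (Suc n choose j) * real j * z ^ j) = real (Suc n) * z * (1 + z) ^ n"
    using sum_index_binomial[of n z "\<lambda>_. 1"] sum_binomial_pow[of n z]
    by (simp del: binomial_Suc_Suc sum.atMost_Suc of_nat_Suc)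
  finally have 2: "(\<Sum>j\<le>?N. real (?N choose j) * real j * z ^ j * (real j - 1)) =
      real ?N * z * (real (Suc n) * z * (1 + z) ^ n)" .
  have "(\<Sum>j\<le>?N. real (?N choose j) * (real ((2 * j + 1) * (2 * j + 3)) / 3) * z ^ j) =
     (\<Sum>j\<le>?N. real (?N choose j) * z ^ j) + 4 * (\<Sum>j\<le>?N. real (?N choose j) * real j * z ^ j) +
     4 / 3 * (\<Sum>j\<le>?N. real (?N choose j) * real j * z ^ j * (real j - 1))"
    unfolding sum_distrib_left sum.distrib[symmetric] split
    by (rule sum.cong[OF refl]) (simp add: field_simps del: binomial_Suc_Suc)
  also have "\<dots> = (1 + z) ^ ?N + 4 * (real ?N * z * (1 + z) ^ Suc n) + 4 / 3 * (real ?N * z * (real (Suc n) * z * (1 + z) ^ n))"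
    unfolding sum_binomial_pow 1 2 ..
  also have "\<dots> = (1 + z) ^ n * ((1 + z)\<^sup>2 + 4 * real (n + 2) * z * (1 + z) + 4 / 3 * real (n + 2) * real (n + 1) * z\<^sup>2)"
    by (simp add: field_simps power2_eq_square)
  finally show ?thesis .
qed

text \<open>For \<open>n\<close> at least 2, the closed form of the sum over \<open>j\<close> of
  \<open>(n choose j) * z ^ j\<close> with weight \<open>(2 * j + 1) * (2 * j + 3) / 3\<close>; this
  weight is \<open>dfact (j + 2) / (3 * dfact j)\<close>.\<close>

definition quad_sum :: "nat \<Rightarrow> real \<Rightarrow> real" where
  "quad_sum n z = (1 + z) ^ (n - 2) *
     ((1 + z)\<^sup>2 + 4 * real n * z * (1 + z) + 4 / 3 * real n * real (n - 1) * z\<^sup>2)"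

lemma quad_sum_mono:
  assumes "0 \<le> x" "x \<le> z"
  shows "quad_sum n x \<le> quad_sum n z"
  unfolding quad_sum_def using assms
  by (intro mult_mono add_mono power_mono) (auto intro!: mult_nonneg_nonneg add_nonneg_nonneg)

lemma power_minus_2: "2 \<le> n \<Longrightarrow> (x :: real) ^ n = x ^ (n - 2) * x\<^sup>2"
  by (metis le_add_diff_inverse2 power_add)

text \<open>Reduces the estimate for all \<open>n\<close> from \<open>N\<close> on to one numerical
  check at \<open>N\<close>. As \<open>\<zeta>\<close> bounds \<open>Z / (1 + Z)\<close>, the
  left-hand side is at most \<open>(1 + Z) ^ n\<close> times a quadratic polynomial \<open>R\<close>
  in \<open>n\<close>, and the slack \<open>\<kappa>\<close> of \<open>Y\<close> over
  \<open>1 + Z\<close> gives a power that outgrows \<open>R\<close>.\<close>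

lemma quad_sum_le_pow:
  fixes Y Z \<kappa> \<zeta> :: real
  assumes "0 \<le> Z" "0 \<le> \<zeta>" "Z \<le> \<zeta> * (1 + Z)" "(1 + Z) * \<kappa> \<le> Y" "0 \<le> \<kappa>"
    and N: "3 \<le> N" "N \<le> n" "3 \<le> real N * (\<kappa> - 1)"
    and base: "1 + 4 * real N * \<zeta> + 4 / 3 * real N * (real N - 1) * \<zeta>\<^sup>2 \<le> \<kappa> ^ N"
  shows "quad_sum n Z \<le> Y ^ n"
proof -
  define R where "R m = 1 + 4 * real m * \<zeta> + 4 / 3 * real m * (real m - 1) * \<zeta>\<^sup>2" for m
  have R: "R m \<le> \<kappa> ^ m" if "N \<le> m" for m
    using that
  proof (induction m rule: dec_induct)
    case base
    then show ?case using assms(9) by (simp add: R_def)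
  next
    case (step m)
    have m: "3 \<le> real m" using N(1) step.hyps by linarith
    \<comment> \<open>For \<open>m\<close> at least 3 the increment of \<open>R\<close> at
      \<open>m\<close> is at most \<open>3 / m\<close> times \<open>R m\<close>, hence at most
      \<open>(\<kappa> - 1) * R m\<close>.\<close>
    have "3 \<le> real m * (\<kappa> - 1)"
    proof -
      have "0 < \<kappa> - 1" using N(3) by (smt (verit) mult_nonneg_nonpos of_nat_0_le_iff)
      then have "real N * (\<kappa> - 1) \<le> real m * (\<kappa> - 1)" using step.hyps by (intro mult_right_mono) auto
      then show ?thesis using N(3) by linarith
    qed
    then have "3 * (4 * \<zeta> + 4 / 3 * (real m - 1) * \<zeta>\<^sup>2) \<le>
        real m * (\<kappa> - 1) * (4 * \<zeta> + 4 / 3 * (real m - 1) * \<zeta>\<^sup>2)"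
      using m assms(2) by (intro mult_right_mono add_nonneg_nonneg mult_nonneg_nonneg) auto
    moreover have "4 * \<zeta> + 8 / 3 * real m * \<zeta>\<^sup>2 \<le> 3 * (4 * \<zeta> + 4 / 3 * (real m - 1) * \<zeta>\<^sup>2)"
    proof -
      have "8 / 3 * real m * \<zeta>\<^sup>2 \<le> 4 * (real m - 1) * \<zeta>\<^sup>2"
        by (rule mult_right_mono) (use m in auto)
      moreover have "3 * (4 * \<zeta> + 4 / 3 * (real m - 1) * \<zeta>\<^sup>2) = 12 * \<zeta> + 4 * (real m - 1) * \<zeta>\<^sup>2"
        by (simp add: field_simps)
      ultimately show ?thesis using assms(2) by linarith
    qed
    moreover have "real m * (\<kappa> - 1) * (4 * \<zeta> + 4 / 3 * (real m - 1) * \<zeta>\<^sup>2) \<le> (\<kappa> - 1) * R m"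
    proof -
      have "1 \<le> \<kappa>" using N(3) by (smt (verit) mult_nonneg_nonpos of_nat_0_le_iff)
      then show ?thesis unfolding R_def by (simp add: algebra_simps)
    qed
    moreover have "R (Suc m) = R m + (4 * \<zeta> + 8 / 3 * real m * \<zeta>\<^sup>2)"
      unfolding R_def by (simp add: field_simps)
    ultimately have "R (Suc m) \<le> R m + (\<kappa> - 1) * R m" by linarith
    also have "\<dots> = \<kappa> * R m" by (simp add: algebra_simps)
    also have "\<dots> \<le> \<kappa> * \<kappa> ^ m" by (intro mult_left_mono step.IH assms)
    finally show ?case by simp
  qed
  have n: "2 \<le> n" using N by simp
  have "(1 + Z)\<^sup>2 + 4 * real n * Z * (1 + Z) + 4 / 3 * real n * real (n - 1) * Z\<^sup>2 \<le> (1 + Z)\<^sup>2 * R n"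
  proof -
    have "4 * real n * (1 + Z) * Z \<le> 4 * real n * (1 + Z) * (\<zeta> * (1 + Z))"
      using assms by (intro mult_left_mono) auto
    moreover have n1: "real (n - 1) = real n - 1" using n by simp
    have "4 / 3 * real n * real (n - 1) * Z\<^sup>2 \<le> 4 / 3 * real n * real (n - 1) * (\<zeta> * (1 + Z))\<^sup>2"
      using assms by (intro mult_left_mono power_mono) auto
    note this[unfolded n1]
    moreover have "(1 + Z)\<^sup>2 * R n = (1 + Z)\<^sup>2 + 4 * real n * (1 + Z) * (\<zeta> * (1 + Z))
        + 4 / 3 * real n * (real n - 1) * (\<zeta> * (1 + Z))\<^sup>2"
      unfolding R_def power_mult_distrib by (simp only: power2_eq_square) algebra
    moreover have "4 * real n * Z * (1 + Z) = 4 * real n * (1 + Z) * Z" by simp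
    ultimately show ?thesis unfolding n1 by linarith
  qed
  then have "quad_sum n Z \<le> (1 + Z) ^ (n - 2) * ((1 + Z)\<^sup>2 * R n)"
    unfolding quad_sum_def using assms by (intro mult_left_mono) auto
  also have "\<dots> = (1 + Z) ^ n * R n"
    using power_minus_2[of n "1 + Z"] n by simp
  also have "\<dots> \<le> (1 + Z) ^ n * \<kappa> ^ n" using assms R[OF N(2)] by (intro mult_left_mono) auto
  also have "\<dots> = ((1 + Z) * \<kappa>) ^ n" by (simp add: power_mult_distrib)
  also have "\<dots> \<le> Y ^ n" using assms by (intro power_mono) auto
  finally show ?thesis .
qed

text \<open>The case \<open>s = 256\<close> of the estimate by \<open>growth n ^ n\<close> for
  \<open>n\<close> from 2 to 16, multiplied by \<open>3 * 256000 ^ n\<close> so that it becomes a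
  comparison of natural numbers.\<close>

lemma growth_check:
  assumes "n \<in> set [2..<17]"
  shows "(256000 + (2 * n - 1) * (1000 + 36 * n)) ^ (n - 2) *
     (3 * (256000 + (2 * n - 1) * (1000 + 36 * n))\<^sup>2
      + 12 * n * ((2 * n - 1) * (1000 + 36 * n)) * (256000 + (2 * n - 1) * (1000 + 36 * n))
      + 4 * n * (n - 1) * ((2 * n - 1) * (1000 + 36 * n))\<^sup>2) \<le> 3 * (256 * (1000 + 36 * n)) ^ n"
proof -
  have "\<forall>n \<in> set [2..<17]. (256000 + (2 * n - 1) * (1000 + 36 * n)) ^ (n - 2) *
     (3 * (256000 + (2 * n - 1) * (1000 + 36 * n))\<^sup>2
      + 12 * n * ((2 * n - 1) * (1000 + 36 * n)) * (256000 + (2 * n - 1) * (1000 + 36 * n))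
      + 4 * n * (n - 1) * ((2 * n - 1) * (1000 + 36 * n))\<^sup>2) \<le> 3 * (256 * (1000 + 36 * n)) ^ n"
    by simp
  then show ?thesis using assms by blast
qed

lemma quad_sum_le_growth_small:
  assumes "2 \<le> n" "n \<le> 16"
  shows "quad_sum n (real (2 * n - 1) * growth n / 256) \<le> growth n ^ n"
proof -
  define a where "a = 1000 + 36 * n"
  define q where "q = (2 * n - 1) * a"
  define p where "p = 256000 + q"
  have g: "growth n = real a / 1000" using assms by (simp add: growth_def growth_num_def a_def)
  have z: "real (2 * n - 1) * growth n / 256 = real q / 256000" by (simp add: g q_def)
  have z1: "1 + real q / 256000 = real p / 256000" by (simp add: p_def)
  have "n \<in> set [2..<17]" unfolding set_upt atLeastLessThan_iff using assms by simp
  from growth_check[OF this] have "p ^ (n - 2) * (3 * p\<^sup>2 + 12 * n * q * p + 4 * n * (n - 1) * q\<^sup>2) \<le> 3 * (256 * a) ^ n"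
    unfolding p_def q_def a_def .
  then have *: "real (p ^ (n - 2) * (3 * p\<^sup>2 + 12 * n * q * p + 4 * n * (n - 1) * q\<^sup>2)) \<le> real (3 * (256 * a) ^ n)"
    by (simp only: of_nat_le_iff)
  have n: "(256000 :: real) ^ n = 256000 ^ (n - 2) * 256000\<^sup>2"
    by (rule power_minus_2[OF assms(1)])
  have "quad_sum n (real q / 256000) = real (p ^ (n - 2) * (3 * p\<^sup>2 + 12 * n * q * p + 4 * n * (n - 1) * q\<^sup>2)) / (3 * 256000 ^ n)"
    unfolding quad_sum_def z1 n by (simp add: power_divide field_simps power2_eq_square)
  also have "\<dots> \<le> real (3 * (256 * a) ^ n) / (3 * 256000 ^ n)"
    using * by (intro divide_right_mono) auto
  also have "\<dots> = (real a / 1000) ^ n"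
  proof -
    have "(256000 :: real) ^ n = 256 ^ n * 1000 ^ n" by (simp flip: power_mult_distrib)
    then show ?thesis by (simp add: power_mult_distrib power_divide)
  qed
  finally show ?thesis unfolding z by (simp only: g)
qed

text \<open>On each bounded stretch of constant \<open>growth\<close> beyond 16, the argument of
  \<open>quad_sum\<close> is replaced by its value at the right end and \<open>s = 256\<close>;
  \<open>N\<close> is the left end.\<close>

lemma quad_sum_le_growth:
  fixes s :: real
  assumes "2 \<le> n" "256 \<le> s" "64 * real n \<le> 17 * s"
  shows "quad_sum n (real (2 * n - 1) * growth n / s) \<le> growth n ^ n"
proof -
  have le256: "real (2 * n - 1) * growth n / s \<le> real (2 * n - 1) * growth n / 256"
    using assms growth_ge_1[of n] by (intro divide_left_mono mult_nonneg_nonneg) auto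
  have nonneg: "0 \<le> real (2 * n - 1) * growth n / s"
    using assms growth_ge_1[of n] by (intro divide_nonneg_nonneg mult_nonneg_nonneg) auto
  have le: "real (2 * n - 1) * growth n / s \<le> real (2 * b - 1) * growth n / 256" if "n \<le> b" for b
  proof -
    have "real (2 * n - 1) \<le> real (2 * b - 1)" using that by simp
    then have "real (2 * n - 1) * growth n / 256 \<le> real (2 * b - 1) * growth n / 256"
      using growth_ge_1[of n] by (intro divide_right_mono mult_right_mono) auto
    then show ?thesis using le256 by linarith
  qed
  consider "n \<le> 16" | "17 \<le> n" "n \<le> 22" | "23 \<le> n" "n \<le> 32" | "33 \<le> n" "n \<le> 48" | "49 \<le> n" "n \<le> 60" | "61 \<le> n"
    by linarith
  then show ?thesis
  proof cases
    case 1
    then show ?thesis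
      using quad_sum_mono[OF nonneg le256, of n] quad_sum_le_growth_small[OF assms(1)] by linarith
  next
    case 2
    then have g: "growth n = 16 / 10" by (simp add: growth_def growth_num_def)
    \<comment> \<open>\<open>43 / 160\<close> is \<open>(2 * 22 - 1) * (16 / 10) / 256\<close>;
      \<open>\<zeta>\<close> is a little above \<open>Z / (1 + Z)\<close> and
      \<open>\<kappa>\<close> a little below \<open>Y / (1 + Z)\<close>. The other stretches follow
      the same pattern.\<close>
    have "quad_sum n (43 / 160) \<le> (16 / 10) ^ n"
      by (rule quad_sum_le_pow[where \<zeta> = "212 / 1000" and \<kappa> = "126 / 100" and N = 17])
         (use 2 in \<open>simp_all add: power2_eq_square power_divide\<close>)
    then show ?thesis using quad_sum_mono[OF nonneg le[OF 2(2)], of n] unfolding g by simp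
  next
    case 3
    then have g: "growth n = 19 / 10" by (simp add: growth_def growth_num_def)
    have "quad_sum n (63 * (19 / 10) / 256) \<le> (19 / 10) ^ n"
      by (rule quad_sum_le_pow[where \<zeta> = "32 / 100" and \<kappa> = "129 / 100" and N = 23])
         (use 3 in \<open>simp_all add: power2_eq_square power_divide\<close>)
    then show ?thesis using quad_sum_mono[OF nonneg le[OF 3(2)], of n] unfolding g by simp
  next
    case 4
    then have g: "growth n = 23 / 10" by (simp add: growth_def growth_num_def)
    have "quad_sum n (95 * (23 / 10) / 256) \<le> (23 / 10) ^ n"
      by (rule quad_sum_le_pow[where \<zeta> = "461 / 1000" and \<kappa> = "124 / 100" and N = 33])
         (use 4 in \<open>simp_all add: power2_eq_square power_divide\<close>)
    then show ?thesis using quad_sum_mono[OF nonneg le[OF 4(2)], of n] unfolding g by simp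
  next
    case 5
    then have g: "growth n = 26 / 10" by (simp add: growth_def growth_num_def)
    have "quad_sum n (119 * (26 / 10) / 256) \<le> (26 / 10) ^ n"
      by (rule quad_sum_le_pow[where \<zeta> = "548 / 1000" and \<kappa> = "117 / 100" and N = 49])
         (use 5 in \<open>simp_all add: power2_eq_square power_divide\<close>)
    then show ?thesis using quad_sum_mono[OF nonneg le[OF 5(2)], of n] unfolding g by simp
  next
    case 6
    then have g: "growth n = 29 / 10" by (simp add: growth_def growth_num_def)
    \<comment> \<open>On the unbounded stretch it is the size of \<open>n\<close> relative to
      \<open>s\<close> that counts: \<open>493 / 320\<close> is
      \<open>2 * (17 / 64) * (29 / 10)\<close>.\<close>
    have "quad_sum n (493 / 320) \<le> (29 / 10) ^ n"
      by (rule quad_sum_le_pow[where \<zeta> = "607 / 1000" and \<kappa> = "114 / 100" and N = 61])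
         (use 6 in \<open>simp_all add: power2_eq_square power_divide\<close>)
    moreover have "real (2 * n - 1) * (29 / 10) / s \<le> 493 / 320"
    proof -
      have "real (2 * n - 1) \<le> 2 * real n" by simp
      then have "real (2 * n - 1) * (29 / 10) \<le> 493 / 320 * s" using assms(3) by linarith
      then show ?thesis using assms(2) by (simp add: divide_le_eq)
    qed
    ultimately show ?thesis using quad_sum_mono[OF nonneg, of "493 / 320" n] unfolding g by simp
  qed
qed

text \<open>Choosing \<open>2 * w\<close> of \<open>2 * m\<close> points and then 4 of these amounts
  to choosing the 4 first, so \<open>(2 * m) choose 4\<close> comes out of the sum. With
  \<open>n = m - 2\<close> and \<open>j = w - 2\<close> the rest, once \<open>growth j\<close> is
  raised to \<open>growth n\<close>, is the binomial sum behind \<open>quad_sum n\<close>.\<close>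

lemma obstruction_bound_rec:
  fixes s :: real
  assumes m: "2 \<le> m" and s: "256 \<le> s" and "64 * real (m - 2) \<le> 17 * s"
  shows "(\<Sum>w=2..m. real ((2 * m) choose (2 * w)) * real (dfact w) * (1 / s) ^ (w - 1) * obstruction_bound w)
    \<le> 3 / s * obstruction_bound m"
proof -
  define n where "n = m - 2"
  have mn: "m = n + 2" using m by (simp add: n_def)
  define z where "z = real (2 * n - 1) * growth n / s"
  define q where "q j = real (n choose j) * (real ((2 * j + 1) * (2 * j + 3)) / 3) * z ^ j" for j
  have shift: "(\<Sum>w=2..m. h w) = (\<Sum>j\<le>n. h (j + 2))" for h :: "nat \<Rightarrow> real"
    using sum.shift_bounds_cl_nat_ivl[of h 0 2 n] by (simp only: mn atMost_atLeast0 add_0)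
  have j1: "j + 2 - 1 = j + 1" for j :: nat by simp
  have "(\<Sum>w=2..m. real ((2 * m) choose (2 * w)) * real (dfact w) * (1 / s) ^ (w - 1) * obstruction_bound w)
      = (\<Sum>j\<le>n. real ((2 * m) choose (2 * (j + 2))) * real (dfact (j + 2)) * (1 / s) ^ (j + 1) * obstruction_bound (j + 2))"
    unfolding shift j1 ..
  also have "\<dots> \<le> (\<Sum>j\<le>n. real ((2 * m) choose 4) * (3 / s) * q j)"
  proof (rule sum_mono)
    fix j assume "j \<in> {..n}"
    then have j: "j \<le> n" by simp
    have "((2 * m) choose (2 * (j + 2))) * ((2 * (j + 2)) choose 4) = ((2 * m) choose 4) * ((2 * m - 4) choose (2 * (j + 2) - 4))"
      by (rule choose_mult) (use j mn in auto)
    then have ch: "((2 * m) choose (2 * (j + 2))) * ((2 * (j + 2)) choose 4) = ((2 * m) choose 4) * ((2 * n) choose (2 * j))"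
      by (simp add: mn)
    have "real ((2 * m) choose (2 * (j + 2))) * real (dfact (j + 2)) * (1 / s) ^ (j + 1) * obstruction_bound (j + 2)
       = real (((2 * m) choose (2 * (j + 2))) * ((2 * (j + 2)) choose 4)) * real (dfact (j + 2)) * (1 / s) ^ (j + 1) * growth j ^ j"
      by (simp add: obstruction_bound_def mult_ac)
    also have "\<dots> = real ((2 * m) choose 4) * (1 / s) * real ((2 * j + 1) * (2 * j + 3)) *
         (real (((2 * n) choose (2 * j)) * dfact j) * (growth j / s) ^ j)"
      unfolding ch by (simp add: power_divide field_simps)
    also have "\<dots> \<le> real ((2 * m) choose 4) * (1 / s) * real ((2 * j + 1) * (2 * j + 3)) *
         (real ((n choose j) * (2 * n - 1) ^ j) * (growth n / s) ^ j)"
      using s growth_ge_1[of j] growth_mono[OF j]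
      by (intro mult_left_mono mult_mono of_nat_mono choose_even_dfact_le power_mono divide_right_mono)
         (auto intro!: mult_nonneg_nonneg)
    also have "\<dots> = real ((2 * m) choose 4) * (3 / s) * q j"
    proof -
      have "z ^ j = real ((2 * n - 1) ^ j) * (growth n / s) ^ j"
        by (simp add: z_def power_divide power_mult_distrib)
      moreover have "C * (1 / s) * X * (real (k * l) * w) = C * (3 / s) * (real k * (X / 3) * (real l * w))"
        for C X w :: real and k l by simp
      ultimately show ?thesis unfolding q_def by presburger
    qed
    finally show "real ((2 * m) choose (2 * (j + 2))) * real (dfact (j + 2)) * (1 / s) ^ (j + 1) * obstruction_bound (j + 2)
       \<le> real ((2 * m) choose 4) * (3 / s) * q j" .
  qed
  also have "\<dots> = real ((2 * m) choose 4) * (3 / s) * (\<Sum>j\<le>n. q j)" by (simp add: sum_distrib_left)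
  also have "\<dots> \<le> real ((2 * m) choose 4) * (3 / s) * growth n ^ n"
  proof (rule mult_left_mono)
    consider "n = 0" | "n = 1" | "2 \<le> n" by linarith
    then show "(\<Sum>j\<le>n. q j) \<le> growth n ^ n"
    proof cases
      case 1
      then show ?thesis by (simp add: q_def)
    next
      case 2
      have "z \<le> 1036 / 1000 / 256"
        unfolding z_def using 2 s by (auto simp: growth_def growth_num_def field_simps)
      then show ?thesis using 2 by (simp add: q_def growth_def growth_num_def)
    next
      case 3
      then obtain i where i: "n = Suc (Suc i)" by (metis Suc_diff_le diff_Suc_Suc le_add_diff_inverse numeral_2_eq_2 plus_nat.simps(1) plus_nat.simps(2))
      have "(\<Sum>j\<le>n. q j) = quad_sum n z"
        using sum_binomial_quadratic[of i z] unfolding q_def quad_sum_def i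
        by (simp del: binomial_Suc_Suc sum.atMost_Suc)
      also have "\<dots> \<le> growth n ^ n"
        unfolding z_def by (rule quad_sum_le_growth[OF 3 s]) (use assms(3) n_def in simp)
      finally show ?thesis .
    qed
  qed (use s in auto)
  finally show ?thesis by (simp add: obstruction_bound_def n_def mult_ac)
qed

section \<open>The series over the size of the exploration\<close>

text \<open>For positive \<open>m\<close> this is \<open>(2 * m - 1)!! / (2 * m - 2)!!\<close>, of
  order \<open>sqrt m\<close>. The two matchings contribute the squared double factorial, the choice
  of the keys the factorial in the denominator.\<close>

definition wallis :: "nat \<Rightarrow> real" where
  "wallis m = (real (dfact m))\<^sup>2 / fact (2 * m - 1)"

lemma wallis_nonneg: "0 \<le> wallis m"
  by (simp add: wallis_def)

lemma wallis_Suc: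
  assumes "1 \<le> m"
  shows "wallis (Suc m) = wallis m * real (2 * m + 1) / real (2 * m)"
proof -
  have "(fact (2 * Suc m - 1) :: real) = real (2 * m + 1) * fact (2 * m)"
    by (simp only: mult_Suc_right) simp
  also have "(fact (2 * m) :: real) = real (2 * m) * fact (2 * m - 1)"
    using assms by (intro fact_reduce) simp
  finally have "(fact (2 * Suc m - 1) :: real) = real (2 * m + 1) * (real (2 * m) * fact (2 * m - 1))" .
  moreover have "real (dfact (Suc m)) = real (2 * m + 1) * real (dfact m)" by (simp only: dfact_simps of_nat_mult)
  moreover have "(A * D)\<^sup>2 / (A * (B * F)) = D\<^sup>2 / F * A / B" if "A \<noteq> 0" for A B D F :: real
    using that by (simp add: power2_eq_square mult_ac)
  moreover have "real (2 * m + 1) \<noteq> 0" by (simp only: of_nat_eq_0_iff)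
  ultimately show ?thesis unfolding wallis_def by presburger
qed

text \<open>The constant \<open>9 / 28\<close> gives equality at \<open>m = 2\<close>. The inductive
  step works because \<open>(4 * x - 1) * (2 * x + 1) ^ 2\<close> is smaller by exactly 1 than
  \<open>(4 * x + 3) * (2 * x) ^ 2\<close>.\<close>

lemma wallis_squared_le:
  assumes "2 \<le> m"
  shows "(wallis m)\<^sup>2 \<le> 9 / 28 * (4 * real m - 1)"
  using assms
proof (induction m rule: dec_induct)
  case base
  have "dfact 2 = 3" by (simp add: numeral_2_eq_2)
  then show ?case by (simp add: wallis_def fact_numeral power2_eq_square)
next
  case (step m)
  define x where "x = real m"
  have x: "2 \<le> x" using step.hyps by (simp add: x_def)
  have "(wallis (Suc m))\<^sup>2 = (wallis m)\<^sup>2 * ((2 * x + 1) / (2 * x))\<^sup>2"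
    using wallis_Suc[of m] step.hyps by (simp add: x_def power_mult_distrib power_divide)
  also have "\<dots> \<le> 9 / 28 * (4 * x - 1) * ((2 * x + 1) / (2 * x))\<^sup>2"
    using step.IH by (intro mult_right_mono) (auto simp: x_def)
  also have "\<dots> \<le> 9 / 28 * (4 * x + 3)"
    using x by (simp add: power_divide field_simps power2_eq_square)
  finally show ?case by (simp add: x_def)
qed

lemma wallis_le:
  assumes "2 \<le> m" "0 \<le> u" "9 / 28 * (4 * real m - 1) \<le> u\<^sup>2"
  shows "wallis m \<le> u"
  using power2_le_imp_le[of "wallis m" u] wallis_squared_le[OF assms(1)] assms by linarith

lemma choose_4: "real ((2 * n + 4) choose 4) = real ((2 * n + 4) * (2 * n + 3) * (2 * n + 2) * (2 * n + 1)) / 24"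
proof -
  let ?N = "2 * n + 4"
  have "24 * (?N choose 4) = 6 * (Suc 3 * (?N choose Suc 3))" by simp
  also have "\<dots> = 2 * (2 * n + 1) * (Suc 2 * (?N choose Suc 2))"
    unfolding Suc_times_choose_Suc[of 3] by simp
  also have "\<dots> = (2 * n + 1) * (2 * n + 2) * (Suc 1 * (?N choose Suc 1))"
    unfolding Suc_times_choose_Suc[of 2] by (simp add: algebra_simps flip: numeral_2_eq_2)
  also have "\<dots> = (2 * n + 1) * (2 * n + 2) * ((2 * n + 3) * ?N)"
    unfolding Suc_times_choose_Suc[of 1] by (simp add: algebra_simps)
  finally have "24 * (?N choose 4) = ?N * (2 * n + 3) * (2 * n + 2) * (2 * n + 1)"
    by (simp only: mult_ac)
  then show ?thesis
    by (metis (no_types, lifting) nonzero_mult_div_cancel_left of_nat_mult of_nat_numeral zero_neq_numeral)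
qed

text \<open>The summand for \<open>m = n + 2\<close> in the final sum, in units of
  \<open>\<mu> ^ 3 / s ^ 2\<close> and with \<open>(\<mu> / s) ^ 2\<close> replaced by its largest
  value \<open>1 / 4\<close> in the remaining powers.\<close>

definition obstruction_term :: "nat \<Rightarrow> real" where
  "obstruction_term n = wallis (n + 2) * real ((2 * n + 4) choose 4) * (growth n / 4) ^ n"

lemma obstruction_term_nonneg: "0 \<le> obstruction_term n"
  unfolding obstruction_term_def using wallis_nonneg growth_ge_1[of n] by simp

lemma sum_geometric_le:
  fixes f :: "nat \<Rightarrow> real"
  assumes "\<And>n. a \<le> n \<Longrightarrow> n < b \<Longrightarrow> f (Suc n) \<le> \<rho> * f n" "0 \<le> f a" "0 \<le> \<rho>" "\<rho> < 1"
  shows "(\<Sum>n=a..b. f n) \<le> f a / (1 - \<rho>)"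
proof (cases "a \<le> b")
  case True
  have "f (a + i) \<le> \<rho> ^ i * f a" if "a + i \<le> b" for i
    using that
  proof (induction i)
    case (Suc i)
    have "f (a + Suc i) \<le> \<rho> * f (a + i)" using assms(1)[of "a + i"] Suc.prems by simp
    also have "\<dots> \<le> \<rho> * (\<rho> ^ i * f a)" using Suc assms by (intro mult_left_mono) auto
    finally show ?case by simp
  qed simp
  then have "(\<Sum>i\<le>b - a. f (a + i)) \<le> (\<Sum>i\<le>b - a. \<rho> ^ i * f a)"
    using True by (intro sum_mono) auto
  also have "\<dots> = (\<Sum>i\<le>b - a. \<rho> ^ i) * f a" by (simp add: sum_distrib_right)
  also have "\<dots> \<le> 1 / (1 - \<rho>) * f a"
  proof (rule mult_right_mono)
    have "(\<Sum>i\<le>b - a. \<rho> ^ i) = (1 - \<rho> ^ Suc (b - a)) / (1 - \<rho>)"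
      using assms by (subst sum_gp_basic[symmetric, THEN arg_cong[of _ _ "\<lambda>x. x / (1 - \<rho>)"]])
        (simp_all add: sum_gp0 lessThan_Suc_atMost[symmetric])
    also have "\<dots> \<le> 1 / (1 - \<rho>)" using assms by (intro divide_right_mono) auto
    finally show "(\<Sum>i\<le>b - a. \<rho> ^ i) \<le> 1 / (1 - \<rho>)" .
  qed (rule assms)
  finally have "(\<Sum>i\<le>b - a. f (a + i)) \<le> f a / (1 - \<rho>)" by simp
  moreover have "(\<Sum>n=a..b. f n) = (\<Sum>i\<le>b - a. f (a + i))"
    using sum.shift_bounds_cl_nat_ivl[of f 0 a "b - a"] True by (simp add: atMost_atLeast0 add.commute)
  ultimately show ?thesis by simp
qed (use assms in simp)

text \<open>While \<open>growth\<close> is constant, the ratio of consecutive terms is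
  \<open>y\<close> times a product of fractions that decrease in \<open>n\<close>. The ratio at the
  left end \<open>N\<close> therefore bounds all later ones.\<close>

lemma obstruction_term_Suc_le:
  assumes N: "1 \<le> N" "N \<le> n" and g: "growth (Suc n) = growth N" "growth n = growth N" "growth N = 4 * y"
    and \<rho>: "(2 * real N + 5) * ((2 * real N + 6) * (2 * real N + 5)) * y \<le>
       \<rho> * ((2 * real N + 4) * ((2 * real N + 2) * (2 * real N + 1)))"
  shows "obstruction_term (Suc n) \<le> \<rho> * obstruction_term n"
proof -
  define x where "x = real n"
  define X where "X = real N"
  have xX: "1 \<le> X" "X \<le> x" using N by (simp_all add: x_def X_def)
  have y: "0 < y" using g(3) growth_ge_1[of N] by linarith
  have A: "wallis (Suc n + 2) = wallis (n + 2) * ((2 * x + 5) / (2 * x + 4))"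
    using wallis_Suc[of "n + 2"] by (simp add: x_def algebra_simps)
  have C1: "real ((2 * Suc n + 4) choose 4) = (2 * x + 6) * (2 * x + 5) * (2 * x + 4) * (2 * x + 3) / 24"
    unfolding choose_4 by (simp add: x_def algebra_simps)
  have C0: "real ((2 * n + 4) choose 4) = (2 * x + 4) * (2 * x + 3) * (2 * x + 2) * (2 * x + 1) / 24"
    unfolding choose_4 by (simp add: x_def algebra_simps)
  have cancel: "p6 * p5 * p4 * p3 / 24 = p4 * p3 * p2 * p1 / 24 * ((p6 / p2) * (p5 / p1))"
    if "p2 \<noteq> 0" "p1 \<noteq> 0" for p1 p2 p3 p4 p5 p6 :: real
    using that by simp
  have C: "real ((2 * Suc n + 4) choose 4) =
      real ((2 * n + 4) choose 4) * (((2 * x + 6) / (2 * x + 2)) * ((2 * x + 5) / (2 * x + 1)))"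
    unfolding C0 C1 by (rule cancel) (use xX in auto)
  have dec: "(2 * x + a) / (2 * x + b) \<le> (2 * X + a) / (2 * X + b)" if "b \<le> a" "0 < b" for a b
  proof -
    have "(a - b) * X \<le> (a - b) * x" using that xX by (intro mult_left_mono) auto
    then show ?thesis using xX that by (simp add: field_simps)
  qed
  have "(2 * x + 5) / (2 * x + 4) * (((2 * x + 6) / (2 * x + 2)) * ((2 * x + 5) / (2 * x + 1))) \<le>
      (2 * X + 5) / (2 * X + 4) * (((2 * X + 6) / (2 * X + 2)) * ((2 * X + 5) / (2 * X + 1)))"
    using xX by (intro mult_mono dec) (auto intro!: mult_nonneg_nonneg divide_nonneg_nonneg)
  then have "(2 * x + 5) / (2 * x + 4) * (((2 * x + 6) / (2 * x + 2)) * ((2 * x + 5) / (2 * x + 1))) * y \<le>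
      (2 * X + 5) / (2 * X + 4) * (((2 * X + 6) / (2 * X + 2)) * ((2 * X + 5) / (2 * X + 1))) * y"
    using y by (intro mult_right_mono) auto
  also have "\<dots> \<le> \<rho>"
  proof -
    have "0 < (2 * X + 4) * ((2 * X + 2) * (2 * X + 1))" using xX by (intro mult_pos_pos) auto
    then show ?thesis using \<rho> unfolding X_def[symmetric] by (simp add: pos_divide_le_eq)
  qed
  finally have r: "(2 * x + 5) / (2 * x + 4) * (((2 * x + 6) / (2 * x + 2)) * ((2 * x + 5) / (2 * x + 1))) * y \<le> \<rho>" .
  have gy: "growth n / 4 = y" "growth (Suc n) / 4 = y" using g by auto
  have "obstruction_term (Suc n) = (2 * x + 5) / (2 * x + 4) * (((2 * x + 6) / (2 * x + 2)) * ((2 * x + 5) / (2 * x + 1))) * y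
      * obstruction_term n"
    unfolding obstruction_term_def A C gy power_Suc by (simp only: mult_ac)
  also have "\<dots> \<le> \<rho> * obstruction_term n"
    by (intro mult_right_mono r obstruction_term_nonneg)
  finally show ?thesis .
qed

lemma obstruction_term_le:
  assumes "0 \<le> u" "9 / 28 * (4 * real n + 7) \<le> u\<^sup>2"
    "u * (real ((2 * n + 4) * (2 * n + 3) * (2 * n + 2) * (2 * n + 1)) / 24) * (growth n / 4) ^ n \<le> t"
  shows "obstruction_term n \<le> t"
proof -
  have "wallis (n + 2) \<le> u" by (rule wallis_le) (use assms in auto)
  then have "obstruction_term n \<le> u * real ((2 * n + 4) choose 4) * (growth n / 4) ^ n"
    unfolding obstruction_term_def using growth_ge_1[of n] by (intro mult_right_mono) auto
  then show ?thesis using assms(3) unfolding choose_4 by linarith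
qed

text \<open>The second entries are upper bounds, in thousandths, for \<open>wallis (n + 2)\<close>.\<close>

lemma obstruction_term_small:
  fixes n u t :: nat
  assumes "(n, u, t) \<in> set
    [(0, 1500, 1500), (1, 1881, 7308), (2, 2196, 11041), (3, 2472, 11034), (4, 2719, 9005),
     (5, 2946, 6589), (6, 3157, 4536), (7, 3355, 3022), (8, 3541, 1983), (9, 3718, 1298),
     (10, 3887, 853), (11, 4049, 567), (12, 4205, 382), (13, 4355, 262), (14, 4500, 183),
     (15, 4641, 131), (16, 4778, 95)]" (is "_ \<in> set ?tab")
  shows "obstruction_term n \<le> real t / 1000"
proof -
  have "\<forall>(n, u, t) \<in> set ?tab. n \<le> 16 \<and> 9 * (4 * n + 7) * 1000000 \<le> 28 * u\<^sup>2 \<and>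
     u * ((2 * n + 4) * (2 * n + 3) * (2 * n + 2) * (2 * n + 1)) * (1000 + 36 * n) ^ n \<le> 24 * t * 4000 ^ n"
    by (simp add: power2_eq_square)
  then have n: "n \<le> 16" and 1: "9 * (4 * n + 7) * 1000000 \<le> 28 * u\<^sup>2"
    and 2: "u * ((2 * n + 4) * (2 * n + 3) * (2 * n + 2) * (2 * n + 1)) * (1000 + 36 * n) ^ n \<le> 24 * t * 4000 ^ n"
    using assms by blast+
  define c where "c = (2 * n + 4) * (2 * n + 3) * (2 * n + 2) * (2 * n + 1)"
  show ?thesis
  proof (rule obstruction_term_le[where u = "real u / 1000"])
    show "0 \<le> real u / 1000" by simp
    have "real (9 * (4 * n + 7) * 1000000) \<le> real (28 * u\<^sup>2)" using 1 by (simp only: of_nat_le_iff)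
    then show "9 / 28 * (4 * real n + 7) \<le> (real u / 1000)\<^sup>2" by (simp add: power_divide)
    have "real (u * c * (1000 + 36 * n) ^ n) \<le> real (24 * t * 4000 ^ n)"
      using 2 unfolding c_def by (simp only: of_nat_le_iff)
    then have "real u * real c * real (1000 + 36 * n) ^ n / 4000 ^ n \<le> 24 * real t"
      by (simp add: pos_divide_le_eq)
    moreover have "(growth n / 4) ^ n = real (1000 + 36 * n) ^ n / 4000 ^ n"
    proof -
      have "growth n / 4 = real (1000 + 36 * n) / 4000" using n by (simp add: growth_def growth_num_def)
      then show ?thesis by (simp only: power_divide)
    qed
    ultimately have "real u * real c * (growth n / 4) ^ n \<le> 24 * real t" by (simp only: times_divide_eq_right)
    then have "real u * real c * (growth n / 4) ^ n / 24000 \<le> 24 * real t / 24000" by (rule divide_right_mono) simp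
    then show "real u / 1000 * (real ((2 * n + 4) * (2 * n + 3) * (2 * n + 2) * (2 * n + 1)) / 24) * (growth n / 4) ^ n
        \<le> real t / 1000"
      unfolding c_def[symmetric] by (simp del: power_divide)
  qed
qed

lemma sum_obstruction_term_small: "(\<Sum>n=0..16. obstruction_term n) \<le> 59789 / 1000"
proof -
  have "(\<Sum>n=0..16. obstruction_term n) = sum_list (map obstruction_term [0..<17])"
    unfolding interv_sum_list_conv_sum_set_nat by (rule sum.cong) auto
  also have "[0..<17] = [0, 1, 2, 3, 4, 5, 6, 7, 8, 9, 10, 11, 12, 13, 14, 15, 16 :: nat]"
    by (simp add: upt_rec)
  finally show ?thesis
    using obstruction_term_small[of 0 1500 1500] obstruction_term_small[of 1 1881 7308]
      obstruction_term_small[of 2 2196 11041] obstruction_term_small[of 3 2472 11034]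
      obstruction_term_small[of 4 2719 9005] obstruction_term_small[of 5 2946 6589]
      obstruction_term_small[of 6 3157 4536] obstruction_term_small[of 7 3355 3022]
      obstruction_term_small[of 8 3541 1983] obstruction_term_small[of 9 3718 1298]
      obstruction_term_small[of 10 3887 853] obstruction_term_small[of 11 4049 567]
      obstruction_term_small[of 12 4205 382] obstruction_term_small[of 13 4355 262]
      obstruction_term_small[of 14 4500 183] obstruction_term_small[of 15 4641 131]
      obstruction_term_small[of 16 4778 95]
    by simp
qed

lemma sum_obstruction_term_segment:
  assumes "1 \<le> a" "\<And>n. a \<le> n \<Longrightarrow> n \<le> b \<Longrightarrow> growth n = 4 * y"
    and "(2 * real a + 5) * ((2 * real a + 6) * (2 * real a + 5)) * y \<le>
       \<rho> * ((2 * real a + 4) * ((2 * real a + 2) * (2 * real a + 1)))"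
    and "0 \<le> \<rho>" "\<rho> < 1"
    and "0 \<le> u" "9 / 28 * (4 * real a + 7) \<le> u\<^sup>2"
    and "u * (real ((2 * a + 4) * (2 * a + 3) * (2 * a + 2) * (2 * a + 1)) / 24) * y ^ a \<le> t * (1 - \<rho>)"
    and "a \<le> b"
  shows "(\<Sum>n=a..b. obstruction_term n) \<le> t"
proof -
  have "(\<Sum>n=a..b. obstruction_term n) \<le> obstruction_term a / (1 - \<rho>)"
  proof (rule sum_geometric_le)
    fix n assume "a \<le> n" "n < b"
    then show "obstruction_term (Suc n) \<le> \<rho> * obstruction_term n"
      using assms by (intro obstruction_term_Suc_le[of a n y]) auto
  qed (use assms obstruction_term_nonneg in auto)
  moreover have "obstruction_term a \<le> t * (1 - \<rho>)"
    by (rule obstruction_term_le[of u]) (use assms in auto)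
  then have "obstruction_term a / (1 - \<rho>) \<le> t" using assms by (simp add: pos_divide_le_eq)
  ultimately show ?thesis by linarith
qed

text \<open>\<open>63 = 7 * 3 ^ 2\<close>: the unit \<open>\<mu> ^ 3 / s ^ 2\<close> has
  \<open>1 / s\<close> for each of the two top levels where the claim allows \<open>3 / s\<close>.
  This surplus of 9, together with the leading 7, pays for the sum over all sizes.\<close>

lemma sum_obstruction_term_le: "(\<Sum>n<L. obstruction_term n) \<le> 63"
proof -
  \<comment> \<open>The maximum makes the last stretch nonempty and long enough to cover
    \<open>L\<close>.\<close>
  define b where "b = max 61 L"
  \<comment> \<open>One geometric series for each stretch of constant \<open>growth\<close>:
    \<open>y\<close> is a quarter of it, \<open>\<rho>\<close> bounds the ratio of consecutive
    terms, and \<open>u\<close> bounds \<open>wallis\<close> at the left end.\<close>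
  have 1: "(\<Sum>n=17..22. obstruction_term n) \<le> 130 / 1000"
    by (rule sum_obstruction_term_segment[where y = "4 / 10" and \<rho> = "51 / 100" and u = "4910 / 1000"])
       (simp_all add: growth_def growth_num_def power2_eq_square power_divide)
  have 2: "(\<Sum>n=23..32. obstruction_term n) \<le> 113 / 1000"
    by (rule sum_obstruction_term_segment[where y = "19 / 40" and \<rho> = "57 / 100" and u = "5642 / 1000"])
       (simp_all add: growth_def growth_num_def power2_eq_square power_divide)
  have 3: "(\<Sum>n=33..48. obstruction_term n) \<le> 215 / 1000"
    by (rule sum_obstruction_term_segment[where y = "23 / 40" and \<rho> = "66 / 100" and u = "6685 / 1000"])
       (simp_all add: growth_def growth_num_def power2_eq_square power_divide)
  have 4: "(\<Sum>n=49..60. obstruction_term n) \<le> 90 / 1000"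
    by (rule sum_obstruction_term_segment[where y = "26 / 40" and \<rho> = "72 / 100" and u = "8078 / 1000"])
       (simp_all add: growth_def growth_num_def power2_eq_square power_divide)
  have 5: "(\<Sum>n=61..b. obstruction_term n) \<le> 1240 / 1000"
    by (rule sum_obstruction_term_segment[where y = "29 / 40" and \<rho> = "78 / 100" and u = "8983 / 1000"])
       (simp_all add: growth_def growth_num_def power2_eq_square power_divide b_def)
  have concat: "(\<Sum>n=i..j. obstruction_term n) = (\<Sum>n=i..l. obstruction_term n) + (\<Sum>n=Suc l..j. obstruction_term n)"
    if "i \<le> l" "l \<le> j" for i j l :: nat
    using sum.ub_add_nat[of i l obstruction_term "j - l"] that by simp
  have "(\<Sum>n<L. obstruction_term n) \<le> (\<Sum>n=0..b. obstruction_term n)"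
    by (rule sum_mono2) (auto simp: b_def obstruction_term_nonneg)
  also have "\<dots> = (\<Sum>n=0..16. obstruction_term n) + ((\<Sum>n=17..22. obstruction_term n) + ((\<Sum>n=23..32. obstruction_term n) +
     ((\<Sum>n=33..48. obstruction_term n) + ((\<Sum>n=49..60. obstruction_term n) + (\<Sum>n=61..b. obstruction_term n)))))"
    using concat[of 0 16 b] concat[of 17 22 b] concat[of 23 32 b] concat[of 33 48 b] concat[of 49 60 b]
    by (simp add: b_def)
  finally show ?thesis using sum_obstruction_term_small 1 2 3 4 5 by linarith
qed

text \<open>The factors stand for the choice of \<open>2 * m - 1\<close> keys, the two matchings on
  \<open>2 * m\<close> points, and the agreements of the \<open>m - 1\<close> pairs left in
  each.\<close>

lemma weight_eq:
  fixes \<mu> s :: real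
  assumes "1 \<le> m" "0 < s"
  shows "\<mu> ^ (2 * m - 1) / fact (2 * m - 1) * (real (dfact m))\<^sup>2 * ((1 / s) ^ (m - 1))\<^sup>2 =
    wallis m * \<mu> * ((\<mu> / s)\<^sup>2) ^ (m - 1)"
proof -
  obtain i where m: "m = Suc i" using assms(1) by (cases m) auto
  show ?thesis unfolding m wallis_def
    by (simp add: power_divide power_mult[symmetric] mult.commute del: dfact_simps fact_Suc)
qed

text \<open>The bound \<open>s / 2\<close> on \<open>\<mu>\<close> is applied only to the powers of
  \<open>(\<mu> / s) ^ 2\<close> beyond the first, so that the factor
  \<open>\<mu> ^ 3 / s ^ 2\<close> is kept exactly.\<close>

lemma sum_weight_le:
  fixes \<mu> s :: real
  assumes "0 \<le> \<mu>" "\<mu> \<le> s / 2" "0 < s"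
  shows "(\<Sum>m=2..<N + 2. \<mu> ^ (2 * m - 1) / fact (2 * m - 1) * (real (dfact m))\<^sup>2 * ((1 / s) ^ (m - 1))\<^sup>2 * obstruction_bound m)
    \<le> 63 * (\<mu> ^ 3 / s\<^sup>2)"
proof -
  have q: "(\<mu> / s)\<^sup>2 \<le> 1 / 4" "0 \<le> (\<mu> / s)\<^sup>2"
  proof -
    have "\<mu> / s \<le> 1 / 2" using assms by (simp add: divide_le_eq)
    then have "(\<mu> / s)\<^sup>2 \<le> (1 / 2)\<^sup>2" using assms by (intro power_mono) auto
    then show "(\<mu> / s)\<^sup>2 \<le> 1 / 4" by (simp add: power_divide)
  qed simp
  have "(\<Sum>m=2..<N + 2. \<mu> ^ (2 * m - 1) / fact (2 * m - 1) * (real (dfact m))\<^sup>2 * ((1 / s) ^ (m - 1))\<^sup>2 * obstruction_bound m)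
      = (\<Sum>m=2..<N + 2. wallis m * \<mu> * ((\<mu> / s)\<^sup>2) ^ (m - 1) * obstruction_bound m)"
    by (intro sum.cong refl arg_cong2[of _ _ _ _ "(*)"] weight_eq) (use assms in auto)
  also have "\<dots> = (\<Sum>n<N. wallis (n + 2) * \<mu> * ((\<mu> / s)\<^sup>2) ^ (n + 2 - 1) * obstruction_bound (n + 2))"
    using sum.shift_bounds_nat_ivl[of "\<lambda>m. wallis m * \<mu> * ((\<mu> / s)\<^sup>2) ^ (m - 1) * obstruction_bound m" 0 2 N]
    by (simp only: atLeast0LessThan add_0)
  also have "\<dots> \<le> (\<Sum>n<N. \<mu> ^ 3 / s\<^sup>2 * obstruction_term n)"
  proof (rule sum_mono)
    fix n :: nat
    have "2 * (n + 2) = 2 * n + 4" by simp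
    then have ob: "obstruction_bound (n + 2) = real ((2 * n + 4) choose 4) * growth n ^ n"
      by (simp only: obstruction_bound_def add_diff_cancel_right')
    have "wallis (n + 2) * \<mu> * ((\<mu> / s)\<^sup>2) ^ (n + 2 - 1) * obstruction_bound (n + 2) =
       \<mu> ^ 3 / s\<^sup>2 * (wallis (n + 2) * real ((2 * n + 4) choose 4) * growth n ^ n) * ((\<mu> / s)\<^sup>2) ^ n"
      unfolding ob by (simp add: power_divide power3_eq_cube power2_eq_square)
    also have "\<dots> \<le> \<mu> ^ 3 / s\<^sup>2 * (wallis (n + 2) * real ((2 * n + 4) choose 4) * growth n ^ n) * (1 / 4) ^ n"
      using assms q growth_ge_1[of n] wallis_nonneg[of "n + 2"]
      by (intro mult_left_mono power_mono) (auto intro!: mult_nonneg_nonneg)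
    also have "\<dots> = \<mu> ^ 3 / s\<^sup>2 * obstruction_term n"
      by (simp add: obstruction_term_def power_divide)
    finally show "wallis (n + 2) * \<mu> * ((\<mu> / s)\<^sup>2) ^ (n + 2 - 1) * obstruction_bound (n + 2) \<le> \<mu> ^ 3 / s\<^sup>2 * obstruction_term n" .
  qed
  also have "\<dots> = \<mu> ^ 3 / s\<^sup>2 * (\<Sum>n<N. obstruction_term n)" by (simp add: sum_distrib_left)
  also have "\<dots> \<le> \<mu> ^ 3 / s\<^sup>2 * 63"
    using assms by (intro mult_left_mono sum_obstruction_term_le) auto
  also have "\<dots> = 63 * (\<mu> ^ 3 / s\<^sup>2)" by (rule mult.commute)
  finally show ?thesis .
qed

text \<open>With \<open>e = 2 ^ (k - 8)\<close> the alphabet has size \<open>256 * e\<close> and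
  \<open>m = 68 * e + 3\<close>. So \<open>(1 / 4) ^ (m - 1)\<close> is the claimed bound
  \<open>2 ^ -(128 * e)\<close> times \<open>2 ^ -(8 * e + 4)\<close>, and the latter outweighs
  \<open>wallis m * \<mu>\<close>, which is at most \<open>16 * e * 128 * e\<close>.\<close>

lemma weight_large_le:
  fixes \<mu> :: real
  assumes k: "8 \<le> k" and \<mu>: "0 \<le> \<mu>" "\<mu> \<le> 2 ^ k / 2" and m: "m = 17 * 2 ^ (k - 6) + 3"
  shows "\<mu> ^ (2 * m - 1) / fact (2 * m - 1) * (real (dfact m))\<^sup>2 * ((1 / 2 ^ k) ^ (m - 1))\<^sup>2 \<le> 1 / 2 powr (2 ^ k / 2)"
proof -
  define i where "i = k - 8"
  have ki: "k = i + 8" using k by (simp add: i_def)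
  define e :: nat where "e = 2 ^ i"
  have e1: "1 \<le> e" by (simp add: e_def)
  have s: "(2 :: real) ^ k = 256 * real e" by (simp add: ki power_add e_def)
  have me: "m = 68 * e + 3" by (simp add: m ki e_def power_add)
  have ie: "2 * i + 1 \<le> 8 * e - 7"
    unfolding e_def by (induction i) auto
  have "wallis m \<le> 16 * real e"
  proof (rule wallis_le)
    have e2: "1 \<le> real e" "real e \<le> real e * real e" using e1 by simp_all
    have "9 / 28 * (4 * real m - 1) = 9 / 28 * (272 * real e + 11)" by (simp add: me)
    also have "\<dots> \<le> 256 * (real e * real e)"
    proof -
      have "9 / 28 * (272 * x + 11) \<le> 256 * y" if "1 \<le> x" "x \<le> y" for x y :: real
        using that by simp
      then show ?thesis using e2 by blast
    qed
    also have "\<dots> = (16 * real e)\<^sup>2" by (simp add: power2_eq_square)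
    finally show "9 / 28 * (4 * real m - 1) \<le> (16 * real e)\<^sup>2" .
  qed (use me in auto)
  moreover have "((\<mu> / 2 ^ k)\<^sup>2) ^ (m - 1) \<le> (1 / 4) ^ (m - 1)"
  proof (rule power_mono)
    have "\<mu> / 2 ^ k \<le> 1 / 2" using \<mu> by (simp add: divide_le_eq)
    then have "(\<mu> / 2 ^ k)\<^sup>2 \<le> (1 / 2)\<^sup>2" using \<mu> by (intro power_mono) auto
    then show "(\<mu> / 2 ^ k)\<^sup>2 \<le> 1 / 4" by (simp add: power_divide)
  qed simp
  ultimately have "wallis m * \<mu> * ((\<mu> / 2 ^ k)\<^sup>2) ^ (m - 1) \<le> (16 * real e) * (128 * real e) * (1 / 4) ^ (m - 1)"
    using \<mu> wallis_nonneg[of m] unfolding s by (intro mult_mono) (auto intro!: mult_nonneg_nonneg)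
  also have "\<dots> \<le> 1 / 2 ^ (128 * e)"
  proof -
    have "(16 * real e) * (128 * real e) = 2 ^ (2 * i + 11)"
      by (simp add: e_def power_add power_mult power2_eq_square power_mult_distrib[symmetric])
    also have "\<dots> \<le> 2 ^ (8 * e + 4)"
      using ie e1 by (intro power_increasing) auto
    finally have "(16 * real e) * (128 * real e) \<le> 2 ^ (8 * e + 4)" .
    moreover have "(1 / 4 :: real) ^ (m - 1) = 1 / (2 ^ (128 * e) * 2 ^ (8 * e + 4))"
    proof -
      have "(4 :: real) ^ (m - 1) = 2 ^ (2 * (m - 1))" by (simp add: power_mult)
      also have "2 * (m - 1) = 128 * e + (8 * e + 4)" by (simp add: me)
      finally show ?thesis by (simp only: power_divide power_one power_add)
    qed
    ultimately show ?thesis by (simp add: field_simps)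
  qed
  also have "\<dots> = 1 / 2 powr (2 ^ k / 2)"
  proof -
    have "2 powr (2 ^ k / 2) = 2 powr (real (128 * e))" by (simp add: s)
    then show ?thesis by (simp only: powr_realpow zero_less_numeral)
  qed
  finally show ?thesis using weight_eq[of m "2 ^ k" \<mu>] me by simp
qed

subsection \<open>Selected keys\<close>

lemma finite_query_vals:
  assumes "finite Q"
  shows "finite (query_vals Q r)"
proof -
  have "query_vals Q r \<subseteq> (\<lambda>g q. if q \<in> Q then g q else 0) ` (Q \<rightarrow>\<^sub>E {..<2 ^ r})"
  proof
    fix \<phi> assume \<phi>: "\<phi> \<in> query_vals Q r"
    have "\<phi> = (\<lambda>q. if q \<in> Q then restrict \<phi> Q q else 0)" using \<phi> by (auto simp: query_vals_def)
    moreover have "restrict \<phi> Q \<in> Q \<rightarrow>\<^sub>E {..<2 ^ r}" using \<phi> by (auto simp: query_vals_def)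
    ultimately show "\<phi> \<in> (\<lambda>g q. if q \<in> Q then g q else 0) ` (Q \<rightarrow>\<^sub>E {..<2 ^ r})" by blast
  qed
  then show ?thesis by (rule finite_subset) (auto intro!: finite_imageI finite_PiE assms)
qed

lemma sel_prob_ge:
  assumes "finite Q" "\<phi> \<in> query_vals Q r"
  shows "real (card {v. v < 2 ^ r \<and> f x v \<phi>}) \<le> sel_prob r Q f x * 2 ^ r"
proof -
  have "real (card {v. v < 2 ^ r \<and> f x v \<phi>}) / 2 ^ r \<le> sel_prob r Q f x"
    unfolding sel_prob_def by (rule Max_ge) (use assms finite_query_vals in auto)
  then show ?thesis by (simp add: pos_divide_le_eq)
qed

lemma zero_in_query_vals: "(\<lambda>_. 0) \<in> query_vals Q r"
  by (simp add: query_vals_def)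

lemma sel_prob_nonneg:
  assumes "finite Q"
  shows "0 \<le> sel_prob r Q f x"
proof -
  have "0 \<le> sel_prob r Q f x * 2 ^ r"
    using sel_prob_ge[OF assms zero_in_query_vals, of r f x] by (meson of_nat_0_le_iff order_trans)
  then show ?thesis
    using mult_neg_pos[of "sel_prob r Q f x" "2 ^ r"] zero_less_power[of "2 :: real" r] by linarith
qed

lemma sel_prob_query:
  assumes "is_selector k r c Q f" "q \<in> Q"
  shows "sel_prob r Q f q = 1"
proof -
  have "real (card {v. v < 2 ^ r \<and> f q v \<phi>}) / 2 ^ r = 1" if "\<phi> \<in> query_vals Q r" for \<phi>
  proof -
    have "{v. v < 2 ^ r \<and> f q v \<phi>} = {..<2 ^ r}" using assms that by (auto simp: is_selector_def)
    then show ?thesis by simp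
  qed
  then have "(\<lambda>\<phi>. real (card {v. v < 2 ^ r \<and> f q v \<phi>}) / 2 ^ r) ` query_vals Q r = {1}"
    using zero_in_query_vals[of Q r] by (auto simp: image_iff)
  then show ?thesis by (simp add: sel_prob_def)
qed

text \<open>Given the hash values of the queries, those of the keys in \<open>S - Q\<close> are
  independent and uniform, so each is selected with probability at most \<open>sel_prob\<close>, a
  maximum over all query answers. Queries in \<open>S\<close> have factor 1.\<close>

lemma card_tables_selected:
  fixes \<kappa> :: "nat list \<Rightarrow> nat list"
  assumes sel: "is_selector k r c Q f" and "finite S"
    and \<kappa>: "\<And>v. v \<in> S \<union> Q \<Longrightarrow> length (\<kappa> v) = b \<and> set (\<kappa> v) \<subseteq> {..<s}"
    and indep: "indep_mod \<kappa> b S Q"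
  shows "real (card {H \<in> tab_tables s b (2 ^ r).
      \<forall>v\<in>S. f v (simple_tab H (\<kappa> v)) (restr Q (\<lambda>x. simple_tab H (\<kappa> x)))})
     \<le> (\<Prod>v\<in>S. sel_prob r Q f v) * real (card (tab_tables s b (2 ^ r)))" (is "real (card ?A) \<le> _")
proof -
  have finQ: "finite Q" using sel finite_subset[of Q "keys (2 ^ k) c"] by (auto simp: is_selector_def)
  define val where "val v H = simple_tab H (\<kappa> v)" for v H
  define a where "a v q \<longleftrightarrow> \<kappa> v ! fst q = snd q" for v and q :: "nat \<times> nat"
  define R where "R v H = {w. f v w (restr Q (\<lambda>x. val x H))}" for v H
  have "real (card ?A) \<le> real (card {H \<in> tab_tables s b (2 ^ r). \<forall>v\<in>S - Q. val v H \<in> R v H})"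
    by (intro of_nat_mono card_mono) (auto simp: val_def R_def)
  also have "\<dots> \<le> (\<Prod>v\<in>S - Q. sel_prob r Q f v) * real (card (tab_tables s b (2 ^ r)))"
  proof (rule card_independent_values[where a = a and Q = Q])
    fix J assume J: "J \<subseteq> S - Q \<union> Q" "J \<inter> (S - Q) \<noteq> {}"
    then have "\<not> zero_upto \<kappa> b J" using indep unfolding indep_mod_def by blast
    then obtain j ch where j: "j < b" "odd (card {v \<in> J. \<kappa> v ! j = ch})"
      unfolding zero_upto_def by blast
    then have "{v \<in> J. \<kappa> v ! j = ch} \<noteq> {}" by (metis card.empty even_zero)
    then obtain v where v: "v \<in> S \<union> Q" "\<kappa> v ! j = ch" using J by blast
    then have "ch < s" using \<kappa>[OF v(1)] j(1) nth_mem by blast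
    then show "\<exists>q\<in>{..<b} \<times> {..<s}. odd (card {v \<in> J. a v q})"
      using j by (intro bexI[of _ "(j, ch)"]) (auto simp: a_def)
  next
    fix v D u H assume v: "v \<in> S - Q \<union> Q" and D: "D \<subseteq> {..<b} \<times> {..<s}"
    have "card {q \<in> D. \<kappa> v ! fst q = snd q} = card {i. i < length (\<kappa> v) \<and> (i, \<kappa> v ! i) \<in> D}"
      by (rule card_nth_eq[of _ _ "{..<s}"]) (use D \<kappa>[of v] v in auto)
    then show "val v (shift_table D u H) = xor (val v H) (if odd (card {q \<in> D. a v q}) then u else 0)"
      unfolding val_def simple_tab_shift_table a_def by simp
  next
    fix v H H' assume "\<And>q. q \<in> Q \<Longrightarrow> val q H = val q H'"
    then have "restr Q (\<lambda>x. val x H) = restr Q (\<lambda>x. val x H')" by (auto simp: restr_def)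
    then show "R v H = R v H'" by (simp add: R_def)
  next
    fix v H assume H: "H \<in> tab_tables s b (2 ^ r)"
    have "restr Q (\<lambda>x. val x H) \<in> query_vals Q r"
      using simple_tab_less[OF H] by (simp add: query_vals_def restr_def val_def)
    from sel_prob_ge[OF finQ this, of f v]
    show "real (card {w. w < 2 ^ r \<and> w \<in> R v H}) \<le> sel_prob r Q f v * 2 ^ r" by (simp add: R_def)
  qed (use assms finQ simple_tab_less in \<open>auto simp: val_def\<close>)
  also have "(\<Prod>v\<in>S - Q. sel_prob r Q f v) = (\<Prod>v\<in>S. sel_prob r Q f v)"
    by (rule prod.mono_neutral_left) (use assms sel_prob_query[OF sel] in auto)
  finally show ?thesis .
qed

text \<open>Splitting by whether \<open>x\<close> belongs to \<open>S\<close> gives the recursion of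
  the elementary symmetric polynomials. The right-hand side dominates it because a power of
  \<open>?\<mu> + p x\<close> is at least the sum of its first two binomial terms.\<close>

lemma sum_prod_subsets_le:
  fixes p :: "'a \<Rightarrow> real"
  assumes "finite A" "\<And>x. x \<in> A \<Longrightarrow> 0 \<le> p x"
  shows "(\<Sum>S | S \<subseteq> A \<and> card S = n. \<Prod>x\<in>S. p x) \<le> (\<Sum>x\<in>A. p x) ^ n / fact n"
  using assms
proof (induction A arbitrary: n rule: finite_induct)
  case empty
  have eq: "{S :: 'a set. S \<subseteq> {} \<and> card S = n} = (if n = 0 then {{}} else {})" by auto
  show ?case unfolding eq by simp
next
  case (insert x A)
  let ?\<mu> = "\<Sum>x\<in>A. p x"
  have p: "0 \<le> p x" "0 \<le> ?\<mu>" using insert.prems by (auto intro: sum_nonneg)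
  show ?case
  proof (cases n)
    case 0
    have eq: "{S. S \<subseteq> insert x A \<and> card S = 0} = {{}}"
      using insert.hyps finite_subset[of _ "insert x A"] by auto
    show ?thesis unfolding 0 eq by simp
  next
    case (Suc i)
    have fin: "finite {S. S \<subseteq> A \<and> card S = j}" for j using insert.hyps by simp
    have eq: "{S. S \<subseteq> insert x A \<and> card S = Suc i} =
       {S. S \<subseteq> A \<and> card S = Suc i} \<union> insert x ` {S. S \<subseteq> A \<and> card S = i}" (is "?L = ?R1 \<union> ?R2")
    proof
      show "?L \<subseteq> ?R1 \<union> ?R2"
      proof
        fix S assume S: "S \<in> ?L"
        then have fS: "finite S" using finite_subset[of S "insert x A"] insert.hyps by auto
        show "S \<in> ?R1 \<union> ?R2"
        proof (cases "x \<in> S")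
          case True
          then have "S = insert x (S - {x})" "S - {x} \<subseteq> A" "card (S - {x}) = i" using S fS by auto
          then show ?thesis by blast
        next
          case False
          then show ?thesis using S by auto
        qed
      qed
      show "?R1 \<union> ?R2 \<subseteq> ?L"
        using insert.hyps finite_subset[of _ A] by (auto simp: card_insert_if subset_iff)
    qed
    have inj: "inj_on (insert x) {S. S \<subseteq> A \<and> card S = i}"
      using insert.hyps(2) by (intro inj_onI) (metis (no_types, lifting) Diff_insert_absorb mem_Collect_eq subsetD)
    have "(\<Sum>S | S \<subseteq> insert x A \<and> card S = Suc i. \<Prod>x\<in>S. p x) =
       (\<Sum>S | S \<subseteq> A \<and> card S = Suc i. \<Prod>x\<in>S. p x) + (\<Sum>S\<in>insert x ` {S. S \<subseteq> A \<and> card S = i}. \<Prod>x\<in>S. p x)"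
      unfolding eq by (rule sum.union_disjoint) (use insert.hyps fin in auto)
    also have "(\<Sum>S\<in>insert x ` {S. S \<subseteq> A \<and> card S = i}. \<Prod>x\<in>S. p x) = (\<Sum>S | S \<subseteq> A \<and> card S = i. p x * (\<Prod>x\<in>S. p x))"
      unfolding sum.reindex[OF inj] o_def
    proof (rule sum.cong[OF refl])
      fix S assume "S \<in> {S. S \<subseteq> A \<and> card S = i}"
      then have "finite S" "x \<notin> S" using insert.hyps finite_subset by auto
      then show "(\<Prod>x\<in>insert x S. p x) = p x * (\<Prod>x\<in>S. p x)" by simp
    qed
    also have "\<dots> = p x * (\<Sum>S | S \<subseteq> A \<and> card S = i. \<Prod>x\<in>S. p x)" by (simp add: sum_distrib_left)
    also have "(\<Sum>S | S \<subseteq> A \<and> card S = Suc i. \<Prod>x\<in>S. p x) + \<dots> \<le> ?\<mu> ^ Suc i / fact (Suc i) + p x * (?\<mu> ^ i / fact i)"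
      by (intro add_mono mult_left_mono insert.IH p) (use insert.prems in auto)
    also have "\<dots> = (?\<mu> ^ Suc i + real (Suc i) * ?\<mu> ^ i * p x) / fact (Suc i)"
    proof -
      have "a / (N * F) + q * (b / F) = (a + N * b * q) / (N * F)" if "N \<noteq> 0" "F \<noteq> 0" for a b q N F :: real
        using that by (simp add: field_simps)
      moreover have "real (Suc i) \<noteq> 0" "(fact i :: real) \<noteq> 0" by simp_all
      ultimately show ?thesis unfolding fact_Suc by blast
    qed
    also have "\<dots> \<le> (?\<mu> + p x) ^ Suc i / fact (Suc i)"
    proof (rule divide_right_mono)
      have "?\<mu> ^ j + real j * ?\<mu> ^ (j - 1) * p x \<le> (?\<mu> + p x) ^ j" for j
      proof (induction j)
        case (Suc j)
        have "?\<mu> ^ Suc j + real (Suc j) * ?\<mu> ^ (Suc j - 1) * p x \<le> (?\<mu> ^ j + real j * ?\<mu> ^ (j - 1) * p x) * (?\<mu> + p x)"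
        proof (cases j)
          case (Suc l)
          have "0 \<le> real j * ?\<mu> ^ (j - 1) * p x * p x" using p by simp
          then show ?thesis unfolding Suc by (simp add: algebra_simps)
        qed simp
        also have "\<dots> \<le> (?\<mu> + p x) ^ j * (?\<mu> + p x)" using Suc p by (intro mult_right_mono) auto
        finally show ?case by (simp add: mult.commute)
      qed simp
      from this[of "Suc i"] show "?\<mu> ^ Suc i + real (Suc i) * ?\<mu> ^ i * p x \<le> (?\<mu> + p x) ^ Suc i" by simp
    qed simp
    finally show ?thesis using Suc insert.hyps by (simp add: add.commute)
  qed
qed


section \<open>From linear dependence to the union bound\<close>

text \<open>Injectivity of \<open>derived_key\<close> transfers the dependent subset from derived
  keys back to keys. Characters outside the alphabet do not occur, which gives the evenness that
  \<open>zero_upto\<close> demands for them.\<close>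

lemma zero_set_if_lin_dep:
  assumes c: "c \<ge> 1" and TT: "TT \<in> tt_space k c (Suc d)" and X: "X \<subseteq> keys (2 ^ k) c"
    and dep: "lin_dep (2 ^ k) (c + d) (derived_key TT c d ` X)"
  obtains A where "A \<subseteq> X" "A \<noteq> {}" "zero_upto (derived_key TT c d) (c + d) A"
proof -
  let ?K = "derived_key TT c d"
  obtain Y where Y: "Y \<subseteq> ?K ` X" "Y \<noteq> {}" "\<forall>i<c + d. \<forall>a<2 ^ k. even (card {y \<in> Y. y ! i = a})"
    using dep unfolding lin_dep_def by blast
  define A where "A = {x \<in> X. ?K x \<in> Y}"
  have inj: "inj_on ?K A"
  proof (rule inj_onI)
    fix x y assume "x \<in> A" "y \<in> A" "?K x = ?K y"
    then show "x = y" using derived_key_inj_prefix[of x "2 ^ k" c y TT d] X c unfolding A_def by auto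
  qed
  have KA: "?K ` A = Y" using Y(1) unfolding A_def by blast
  have "even (card {v \<in> A. ?K v ! j = a})" if j: "j < c + d" for j a
  proof -
    have img: "?K ` {v \<in> A. ?K v ! j = a} = {y \<in> Y. y ! j = a}" unfolding KA[symmetric] by blast
    have "inj_on ?K {v \<in> A. ?K v ! j = a}" by (rule inj_on_subset[OF inj]) auto
    from card_image[OF this] have eq: "card {v \<in> A. ?K v ! j = a} = card {y \<in> Y. y ! j = a}"
      unfolding img by (rule sym)
    show ?thesis
    proof (cases "a < 2 ^ k")
      case True
      then show ?thesis using Y(3) j unfolding eq by blast
    next
      case False
      have "y ! j < 2 ^ k" if y: "y \<in> Y" for y
      proof -
        obtain x where x: "x \<in> X" "y = ?K x" using Y(1) y by blast
        then have "x \<in> keys (2 ^ k) c" using X by blast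
        then have "set y \<subseteq> {..<2 ^ k}" "length y = c + d"
          using derived_key_subset[OF TT, of d x] length_derived_key[of x c TT d] c x by (auto simp: keys_def)
        moreover from this j have "y ! j \<in> set y" by simp
        ultimately show ?thesis by blast
      qed
      then have none: "{y \<in> Y. y ! j = a} = {}" using False by blast
      show ?thesis unfolding eq none by simp
    qed
  qed
  then have "zero_upto ?K (c + d) A" unfolding zero_upto_def by blast
  moreover have "A \<noteq> {}" using KA Y(2) by blast
  moreover have "A \<subseteq> X" by (auto simp: A_def)
  ultimately show ?thesis using that by blast
qed

text \<open>The final tables \<open>H\<close> are independent of \<open>TT\<close>. For each fixed
  \<open>TT\<close> that makes \<open>S\<close> independent modulo \<open>Q\<close> they yield the
  product of the selection probabilities; averaging over \<open>TT\<close> leaves the probability of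
  \<open>G\<close>.\<close>

lemma card_obstruction_event:
  fixes S Q :: "nat list set" and f :: "nat list \<Rightarrow> nat \<Rightarrow> (nat list \<Rightarrow> nat) \<Rightarrow> bool" and c d :: nat
  defines "sel TT H \<equiv> \<forall>v\<in>S. f v (tornado TT H c d v) (restr Q (tornado TT H c d))"
  assumes c: "c \<ge> 1" and sel: "is_selector k r c Q f" and S: "S \<subseteq> keys (2 ^ k) c"
  shows "real (card {(TT, H) \<in> tornado_space k r c d. G TT \<and> indep_mod (derived_key TT c d) (c + d) S Q \<and> sel TT H})
    \<le> (\<Prod>v\<in>S. sel_prob r Q f v) * tt_prob k c (Suc d) G * real (card (tornado_space k r c d))"
proof -
  let ?\<Omega> = "tt_space k c (Suc d)" and ?H = "tab_tables (2 ^ k) (c + d) (2 ^ r)"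
  let ?p = "\<Prod>v\<in>S. sel_prob r Q f v"
  have finS: "finite S" by (rule finite_subset[OF S]) simp
  have QK: "Q \<subseteq> keys (2 ^ k) c" using sel by (simp add: is_selector_def)
  have finQ: "finite Q" by (rule finite_subset[OF QK]) simp
  have p: "0 \<le> ?p" by (intro prod_nonneg) (use sel_prob_nonneg[OF finQ] in auto)
  have "{(TT, H) \<in> tornado_space k r c d. G TT \<and> indep_mod (derived_key TT c d) (c + d) S Q \<and> sel TT H} =
     (SIGMA TT:{TT \<in> ?\<Omega>. G TT \<and> indep_mod (derived_key TT c d) (c + d) S Q}. {H \<in> ?H. sel TT H})"
    unfolding tornado_space_eq by auto
  then have "real (card {(TT, H) \<in> tornado_space k r c d. G TT \<and> indep_mod (derived_key TT c d) (c + d) S Q \<and> sel TT H}) =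
     (\<Sum>TT\<in>{TT \<in> ?\<Omega>. G TT \<and> indep_mod (derived_key TT c d) (c + d) S Q}. real (card {H \<in> ?H. sel TT H}))"
    by simp
  also have "\<dots> \<le> (\<Sum>TT\<in>{TT \<in> ?\<Omega>. G TT \<and> indep_mod (derived_key TT c d) (c + d) S Q}. ?p * real (card ?H))"
  proof (rule sum_mono)
    fix TT assume "TT \<in> {TT \<in> ?\<Omega>. G TT \<and> indep_mod (derived_key TT c d) (c + d) S Q}"
    then have TT: "TT \<in> ?\<Omega>" and ind: "indep_mod (derived_key TT c d) (c + d) S Q" by auto
    have "length (derived_key TT c d v) = c + d \<and> set (derived_key TT c d v) \<subseteq> {..<2 ^ k}" if "v \<in> S \<union> Q" for v
    proof -
      have v: "v \<in> keys (2 ^ k) c" using that S QK by blast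
      then show ?thesis
        using length_derived_key[of v c TT d] derived_key_subset[OF TT _ v c, of d] c by (auto simp: keys_def)
    qed
    from card_tables_selected[OF sel finS this ind]
    show "real (card {H \<in> ?H. sel TT H}) \<le> ?p * real (card ?H)"
      unfolding sel_def tornado_def .
  qed
  also have "\<dots> \<le> (\<Sum>TT\<in>{TT \<in> ?\<Omega>. G TT}. ?p * real (card ?H))"
    by (rule sum_mono2) (use p in auto)
  also have "\<dots> = ?p * tt_prob k c (Suc d) G * real (card (tornado_space k r c d))"
    using card_tt_space_pos[of k c "Suc d"]
    by (simp add: tt_prob_def tornado_space_eq card_cartesian_product)
  finally show ?thesis .
qed

theorem theorem1p4:
  fixes k r c d :: nat
    and Q :: "nat list set"
    and f :: "nat list \<Rightarrow> nat \<Rightarrow> (nat list \<Rightarrow> nat) \<Rightarrow> bool"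
  assumes "k \<ge> 8" and "c \<ge> 1" and "d \<ge> 1"
    and "is_selector k r c Q f"
    and "sel_mu k r c Q f \<le> real (2^k) / 2"
  shows "measure_pmf.prob (pmf_of_set (tornado_space k r c d))
           {(TT, H). lin_dep (2^k) (c + d)
              (derived_key TT c d ` selected k c Q f (tornado TT H c d))}
         \<le> dependence_prob (sel_mu k r c Q f) d (2^k)"
proof -
  note c = assms(2) and sel = assms(4)
  let ?K = "keys (2 ^ k) c" and ?\<Omega> = "tornado_space k r c d"
  let ?bad = "{(TT, H). lin_dep (2^k) (c + d) (derived_key TT c d ` selected k c Q f (tornado TT H c d))}"
  define \<mu> where "\<mu> = sel_mu k r c Q f"
  define s where "s = (2 ^ k :: real)"
  \<comment> \<open>Levels \<open>d = Suc e\<close> and \<open>e\<close> carry the two matchings of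
    the walk, and the \<open>e\<close> levels below carry the obstruction.\<close>
  define e where "e = d - 1"
  have d: "d = Suc e" using assms(3) by (simp add: e_def)
  have s256: "256 \<le> s"
    using power_increasing[of 8 k "2 :: real"] assms(1) by (simp add: s_def)
  have QK: "Q \<subseteq> ?K" using sel by (simp add: is_selector_def)
  have finQ: "finite Q" by (rule finite_subset[OF QK]) simp
  have p0: "0 \<le> sel_prob r Q f x" for x by (rule sel_prob_nonneg[OF finQ])
  have \<mu>0: "0 \<le> \<mu>" unfolding \<mu>_def sel_mu_def by (intro sum_nonneg p0)
  have \<mu>s: "\<mu> \<le> s / 2" using assms(5) by (simp add: \<mu>_def s_def)
  \<comment> \<open>Every \<open>m < m0\<close> then satisfies
    \<open>64 * (m - 2) \<le> 17 * 2 ^ k\<close>, the range in which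
    \<open>obstruction_bound\<close> solves its recursion.\<close>
  define m0 where "m0 = (17 * 2 ^ (k - 6) + 3 :: nat)"
  \<comment> \<open>At the cut-off nothing is claimed about the lower levels, hence the trivial
    bound 1.\<close>
  define B where "B m = (if m < m0 then obstruction_bound m * (3 / s) ^ e else 1)" for m
  define \<S> where "\<S> m = {S. S \<subseteq> ?K \<and> card S = 2 * m - 1}" for m
  \<comment> \<open>The nesting of the conjunction lets the levels be peeled off from the top, each
    inner part depending on lower levels only.\<close>
  define G where "G m S M1 M2 TT \<longleftrightarrow> ((m < m0 \<longrightarrow> obstructed TT c e (insert [] S)) \<and> level_match TT c e (reduce M1)) \<and>
     level_match TT c (Suc e) (reduce M2)" for m S M1 M2 TT
  define E where "E m S M1 M2 = {(TT, H) \<in> ?\<Omega>. G m S M1 M2 TT \<and> indep_mod (derived_key TT c d) (c + d) S Q \<and>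
     (\<forall>v\<in>S. f v (tornado TT H c d v) (restr Q (tornado TT H c d)))}" for m S M1 M2
  have fin\<S>: "finite (\<S> m)" for m
    by (rule finite_subset[of _ "Pow ?K"]) (auto simp: \<S>_def)
  have finS: "finite S" if "S \<in> \<S> m" for S m
    using that finite_subset[of S ?K] by (auto simp: \<S>_def)
  have fin\<Omega>: "finite ?\<Omega>" unfolding tornado_space_eq by (intro finite_cartesian_product) auto
  have pos\<Omega>: "0 < card ?\<Omega>"
    unfolding tornado_space_eq card_cartesian_product
    using card_tt_space_pos[of k c "Suc d"] card_tab_tables_pos[of "2 ^ r" "2 ^ k" "c + d"] by simp

  have cover: "?\<Omega> \<inter> ?bad \<subseteq> (\<Union>m\<in>{2..m0}. \<Union>S\<in>\<S> m. \<Union>M1\<in>perfect_matchings (insert [] S).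
      \<Union>M2\<in>perfect_matchings (insert [] S). E m S M1 M2)"
  proof clarify
    fix TT H
    assume \<Omega>: "(TT, H) \<in> ?\<Omega>"
      and dep: "lin_dep (2^k) (c + d) (derived_key TT c d ` selected k c Q f (tornado TT H c d))"
    let ?h = "tornado TT H c d" and ?X = "selected k c Q f (tornado TT H c d)"
    have TT: "TT \<in> tt_space k c (Suc d)" and H: "H \<in> tab_tables (2 ^ k) (c + d) (2 ^ r)"
      using \<Omega> by (auto simp: tornado_space_eq)
    have XK: "?X \<subseteq> ?K" by (auto simp: selected_def)
    have h: "?h x < 2 ^ r" for x unfolding tornado_def by (rule simple_tab_less[OF H])
    then have "restr Q ?h \<in> query_vals Q r" by (simp add: restr_def query_vals_def)
    \<comment> \<open>Queries are always selected, so the zero set can be minimised relative to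
      \<open>Q\<close> inside the selected set.\<close>
    then have QX: "Q \<subseteq> ?X" using sel h by (auto simp: selected_def is_selector_def)
    obtain A where A: "A \<subseteq> ?X" "A \<noteq> {}" "zero_upto (derived_key TT c d) (c + d) A"
      by (rule zero_set_if_lin_dep[OF c TT XK dep])
    have m0: "1 \<le> m0" "2 \<le> m0" by (simp_all add: m0_def)
    obtain m S M1 M2 where *: "S \<subseteq> ?X" "card S = 2 * m - 1"
       "M1 \<in> perfect_matchings (insert [] S)" "M2 \<in> perfect_matchings (insert [] S)"
       "level_match TT c e (reduce M1)" "level_match TT c (Suc e) (reduce M2)"
       "indep_mod (derived_key TT c d) (c + d) S Q"
       "2 \<le> m \<and> m < m0 \<and> obstructed TT c e (insert [] S) \<or> m = m0"
      using obstruction_exists[OF c XK QX A(1,2) A(3)[unfolded d] m0(1)] unfolding d by blast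
    have "m \<in> {2..m0}" using *(8) m0(2) by auto
    moreover have "S \<in> \<S> m" using *(1,2) XK by (auto simp: \<S>_def)
    moreover have "(TT, H) \<in> E m S M1 M2"
      using \<Omega> * unfolding E_def G_def selected_def by auto
    ultimately show "(TT, H) \<in> (\<Union>m\<in>{2..m0}. \<Union>S\<in>\<S> m. \<Union>M1\<in>perfect_matchings (insert [] S).
      \<Union>M2\<in>perfect_matchings (insert [] S). E m S M1 M2)"
      using *(3,4) by blast
  qed

  have single: "real (card (E m S M1 M2)) \<le> (\<Prod>v\<in>S. sel_prob r Q f v) * (((1 / s) ^ (m - 1))\<^sup>2 * B m) * real (card ?\<Omega>)"
    if m: "m \<in> {2..m0}" and S: "S \<in> \<S> m" and M1: "M1 \<in> perfect_matchings (insert [] S)"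
      and M2: "M2 \<in> perfect_matchings (insert [] S)" for m S M1 M2
  proof -
    have SK: "S \<subseteq> ?K" and cS: "card S = 2 * m - 1" using S by (auto simp: \<S>_def)
    have nil: "[] \<notin> S" using SK c by (auto simp: keys_def)
    have cU: "card (insert [] S) = 2 * m" using cS nil finS[OF S] m by simp
    have red: "\<Union>(reduce M) \<subseteq> ?K \<and> reduce M \<in> perfect_matchings (\<Union>(reduce M)) \<and> card (reduce M) = m - 1"
      if M: "M \<in> perfect_matchings (insert [] S)" for M
    proof -
      have cM: "card M = m" using perfect_matchings_card[OF M] cU by simp
      then have "M \<noteq> {}" using m by auto
      then obtain e where e: "e \<in> M" "reduce M = M - {e}" "[] \<notin> \<Union>(reduce M)" by (rule reduceE[OF M])
      have "finite M" by (rule perfect_matchings_finite[OF M]) (simp add: finS[OF S])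
      then have "card (reduce M) = m - 1" using e cM by simp
      moreover have "reduce M \<in> perfect_matchings (\<Union>(reduce M))"
        by (rule perfect_matchings_subset[OF M]) (use e in auto)
      moreover have "\<Union>(reduce M) \<subseteq> insert [] S" using perfect_matchingsD(1)[OF M] e(2) by auto
      ultimately show ?thesis using e(3) SK by blast
    qed
    define W where "W TT \<longleftrightarrow> (m < m0 \<longrightarrow> obstructed TT c e (insert [] S))" for TT
    have W_cong: "W TT = W TT'" if "\<And>j. j < e \<Longrightarrow> TT j = TT' j" for TT TT'
      using obstructed_cong[OF that] by (simp add: W_def)
    have W_eq: "W = (\<lambda>TT. m < m0 \<longrightarrow> obstructed TT c e (insert [] S))" by (rule ext) (rule W_def)
    have G_eq: "G m S M1 M2 = (\<lambda>TT. (W TT \<and> level_match TT c e (reduce M1)) \<and> level_match TT c (Suc e) (reduce M2))"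
      by (rule ext) (simp only: G_def W_eq)
    have W_prob: "tt_prob k c e W \<le> B m"
    proof (cases "m < m0")
      case True
      have rec: "(\<Sum>w=2..m. real ((2 * m) choose (2 * w)) * real (dfact w) * (1 / 2 ^ k) ^ (w - 1) * obstruction_bound w)
          \<le> 3 / 2 ^ k * obstruction_bound m" if "2 \<le> m" "m \<le> m0 - 1" for m
      proof -
        have "64 * (m - 2) \<le> 17 * 2 ^ k"
        proof -
          have "(2 :: nat) ^ k = 64 * 2 ^ (k - 6)"
            using power_add[of "2 :: nat" 6 "k - 6"] assms(1) by simp
          then show ?thesis using that by (simp add: m0_def)
        qed
        then have "64 * real (m - 2) \<le> 17 * 2 ^ k"
          by (metis (mono_tags, lifting) of_nat_le_iff of_nat_mult of_nat_numeral of_nat_power)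
        then show ?thesis using obstruction_bound_rec[of m s] that s256 unfolding s_def by simp
      qed
      have "tt_prob k c e (\<lambda>TT. obstructed TT c e (insert [] S)) \<le> obstruction_bound m * (3 / 2 ^ k) ^ e"
        by (rule tt_prob_obstructed[OF c obstruction_bound_ge_1 rec])
           (use SK cU m True in auto)
      then show ?thesis using True by (simp add: W_eq B_def s_def)
    next
      case False
      then show ?thesis using card_tt_space_pos[of k c e] by (simp add: W_eq B_def tt_prob_def)
    qed
    note r1 = red[OF M1, THEN conjunct1] red[OF M1, THEN conjunct2, THEN conjunct1]
      red[OF M1, THEN conjunct2, THEN conjunct2]
    note r2 = red[OF M2, THEN conjunct1] red[OF M2, THEN conjunct2, THEN conjunct1]
      red[OF M2, THEN conjunct2, THEN conjunct2]
    have "tt_prob k c (Suc e) (\<lambda>TT. W TT \<and> level_match TT c e (reduce M1)) \<le> (1 / s) ^ (m - 1) * tt_prob k c e W"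
      unfolding s_def r1(3)[symmetric] by (rule tt_prob_level_match[OF c r1(1,2) W_cong])
    also have "\<dots> \<le> (1 / s) ^ (m - 1) * B m"
      by (intro mult_left_mono W_prob) (simp add: s_def)
    finally have 1: "tt_prob k c (Suc e) (\<lambda>TT. W TT \<and> level_match TT c e (reduce M1)) \<le> (1 / s) ^ (m - 1) * B m" .
    have "(W TT \<and> level_match TT c e (reduce M1)) = (W TT' \<and> level_match TT' c e (reduce M1))"
      if eq: "\<And>j. j < Suc e \<Longrightarrow> TT j = TT' j" for TT TT'
    proof -
      have "W TT = W TT'" by (rule W_cong) (simp add: eq)
      moreover have "level_match TT c e (reduce M1) = level_match TT' c e (reduce M1)"
        by (rule level_match_cong) (simp add: eq)
      ultimately show ?thesis by simp
    qed
    then have "tt_prob k c (Suc (Suc e)) (\<lambda>TT. (W TT \<and> level_match TT c e (reduce M1)) \<and> level_match TT c (Suc e) (reduce M2))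
       \<le> (1 / s) ^ (m - 1) * tt_prob k c (Suc e) (\<lambda>TT. W TT \<and> level_match TT c e (reduce M1))"
      unfolding s_def r2(3)[symmetric] by (rule tt_prob_level_match[OF c r2(1,2)])
    also have "\<dots> \<le> (1 / s) ^ (m - 1) * ((1 / s) ^ (m - 1) * B m)"
      by (intro mult_left_mono 1) (simp add: s_def)
    finally have "tt_prob k c (Suc d) (G m S M1 M2) \<le> ((1 / s) ^ (m - 1))\<^sup>2 * B m"
      unfolding G_eq d by (simp add: power2_eq_square mult.assoc)
    then have "(\<Prod>v\<in>S. sel_prob r Q f v) * tt_prob k c (Suc d) (G m S M1 M2) * real (card ?\<Omega>) \<le>
       (\<Prod>v\<in>S. sel_prob r Q f v) * (((1 / s) ^ (m - 1))\<^sup>2 * B m) * real (card ?\<Omega>)"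
      by (intro mult_right_mono mult_left_mono prod_nonneg) (auto simp: p0)
    then show ?thesis using card_obstruction_event[OF c sel SK, of d "G m S M1 M2"] unfolding E_def by linarith
  qed

  have B0: "0 \<le> B m" if "2 \<le> m" for m
    using obstruction_bound_ge_1[OF that] s256 by (simp add: B_def)
  have "real (card (?\<Omega> \<inter> ?bad)) \<le> (\<Sum>m=2..m0. \<Sum>S\<in>\<S> m. \<Sum>M1\<in>perfect_matchings (insert [] S).
      \<Sum>M2\<in>perfect_matchings (insert [] S). real (card (E m S M1 M2)))"
  proof -
    have finE: "finite (E m S M1 M2)" for m S M1 M2 unfolding E_def by (rule finite_subset[OF _ fin\<Omega>]) auto
    have "card (?\<Omega> \<inter> ?bad) \<le> card (\<Union>m\<in>{2..m0}. \<Union>S\<in>\<S> m. \<Union>M1\<in>perfect_matchings (insert [] S).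
      \<Union>M2\<in>perfect_matchings (insert [] S). E m S M1 M2)"
      by (rule card_mono[OF _ cover])
         (intro finite_UN_I finite_perfect_matchings fin\<S> finE finite_insert[THEN iffD2] finite_atLeastAtMost finS)
    also have "\<dots> \<le> (\<Sum>m=2..m0. card (\<Union>S\<in>\<S> m. \<Union>M1\<in>perfect_matchings (insert [] S).
      \<Union>M2\<in>perfect_matchings (insert [] S). E m S M1 M2))" by (rule card_UN_le) simp
    also have "\<dots> \<le> (\<Sum>m=2..m0. \<Sum>S\<in>\<S> m. card (\<Union>M1\<in>perfect_matchings (insert [] S).
      \<Union>M2\<in>perfect_matchings (insert [] S). E m S M1 M2))" by (intro sum_mono card_UN_le fin\<S>)
    also have "\<dots> \<le> (\<Sum>m=2..m0. \<Sum>S\<in>\<S> m. \<Sum>M1\<in>perfect_matchings (insert [] S).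
      card (\<Union>M2\<in>perfect_matchings (insert [] S). E m S M1 M2))"
      by (intro sum_mono card_UN_le finite_perfect_matchings finite_insert[THEN iffD2] finS)
    also have "\<dots> \<le> (\<Sum>m=2..m0. \<Sum>S\<in>\<S> m. \<Sum>M1\<in>perfect_matchings (insert [] S).
      \<Sum>M2\<in>perfect_matchings (insert [] S). card (E m S M1 M2))"
      by (intro sum_mono card_UN_le finite_perfect_matchings finite_insert[THEN iffD2] finS)
    finally show ?thesis by (simp only: of_nat_sum[symmetric] of_nat_le_iff)
  qed
  also have "\<dots> \<le> (\<Sum>m=2..m0. \<Sum>S\<in>\<S> m. \<Sum>M1\<in>perfect_matchings (insert [] S).
      \<Sum>M2\<in>perfect_matchings (insert [] S).
        (\<Prod>v\<in>S. sel_prob r Q f v) * (((1 / s) ^ (m - 1))\<^sup>2 * B m) * real (card ?\<Omega>))"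
    by (intro sum_mono single)
  also have "\<dots> \<le> (\<Sum>m=2..m0. \<Sum>S\<in>\<S> m. (\<Prod>v\<in>S. sel_prob r Q f v) *
      ((real (dfact m))\<^sup>2 * ((1 / s) ^ (m - 1))\<^sup>2 * B m * real (card ?\<Omega>)))"
  proof (intro sum_mono)
    fix m S assume m: "m \<in> {2..m0}" and S: "S \<in> \<S> m"
    let ?P = "perfect_matchings (insert [] S)"
    have "[] \<notin> S" using S c by (auto simp: \<S>_def keys_def)
    then have "card (insert [] S) = 2 * m" using S finS[OF S] m by (simp add: \<S>_def)
    then have "card ?P \<le> dfact m" by (intro card_perfect_matchings_le) (auto simp: finS[OF S])
    then have le: "real (card ?P) * real (card ?P) \<le> (real (dfact m))\<^sup>2"
      unfolding power2_eq_square by (intro mult_mono) auto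
    have "0 \<le> (\<Prod>v\<in>S. sel_prob r Q f v) * (((1 / s) ^ (m - 1))\<^sup>2 * B m) * real (card ?\<Omega>)"
      using B0[of m] m p0 by (intro mult_nonneg_nonneg prod_nonneg) auto
    then have "real (card ?P) * real (card ?P) * ((\<Prod>v\<in>S. sel_prob r Q f v) * (((1 / s) ^ (m - 1))\<^sup>2 * B m) * real (card ?\<Omega>))
       \<le> (real (dfact m))\<^sup>2 * ((\<Prod>v\<in>S. sel_prob r Q f v) * (((1 / s) ^ (m - 1))\<^sup>2 * B m) * real (card ?\<Omega>))"
      by (rule mult_right_mono[OF le])
    then show "(\<Sum>M1\<in>?P. \<Sum>M2\<in>?P. (\<Prod>v\<in>S. sel_prob r Q f v) * (((1 / s) ^ (m - 1))\<^sup>2 * B m) * real (card ?\<Omega>))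
      \<le> (\<Prod>v\<in>S. sel_prob r Q f v) * ((real (dfact m))\<^sup>2 * ((1 / s) ^ (m - 1))\<^sup>2 * B m * real (card ?\<Omega>))"
      unfolding sum_constant by (simp only: mult_ac)
  qed
  also have "\<dots> \<le> (\<Sum>m=2..m0. \<mu> ^ (2 * m - 1) / fact (2 * m - 1) *
      ((real (dfact m))\<^sup>2 * ((1 / s) ^ (m - 1))\<^sup>2 * B m * real (card ?\<Omega>)))"
  proof (intro sum_mono)
    fix m assume m: "m \<in> {2..m0}"
    have "(\<Sum>S\<in>\<S> m. \<Prod>v\<in>S. sel_prob r Q f v) \<le> \<mu> ^ (2 * m - 1) / fact (2 * m - 1)"
      unfolding \<S>_def \<mu>_def sel_mu_def by (rule sum_prod_subsets_le) (auto simp: p0)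
    then show "(\<Sum>S\<in>\<S> m. (\<Prod>v\<in>S. sel_prob r Q f v) *
        ((real (dfact m))\<^sup>2 * ((1 / s) ^ (m - 1))\<^sup>2 * B m * real (card ?\<Omega>)))
      \<le> \<mu> ^ (2 * m - 1) / fact (2 * m - 1) * ((real (dfact m))\<^sup>2 * ((1 / s) ^ (m - 1))\<^sup>2 * B m * real (card ?\<Omega>))"
      unfolding sum_distrib_right[symmetric] using B0[of m] m
      by (intro mult_right_mono) (auto intro!: mult_nonneg_nonneg)
  qed
  also have "\<dots> = (\<Sum>m=2..m0. \<mu> ^ (2 * m - 1) / fact (2 * m - 1) * (real (dfact m))\<^sup>2 * ((1 / s) ^ (m - 1))\<^sup>2 * B m)
      * real (card ?\<Omega>)"
    by (simp only: sum_distrib_right mult.assoc)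
  finally have "real (card (?\<Omega> \<inter> ?bad)) / real (card ?\<Omega>) \<le>
      (\<Sum>m=2..m0. \<mu> ^ (2 * m - 1) / fact (2 * m - 1) * (real (dfact m))\<^sup>2 * ((1 / s) ^ (m - 1))\<^sup>2 * B m)"
    using pos\<Omega> by (simp add: pos_divide_le_eq)
  also have "\<dots> = (\<Sum>m=2..<m0. \<mu> ^ (2 * m - 1) / fact (2 * m - 1) * (real (dfact m))\<^sup>2 * ((1 / s) ^ (m - 1))\<^sup>2 * obstruction_bound m)
      * (3 / s) ^ e + \<mu> ^ (2 * m0 - 1) / fact (2 * m0 - 1) * (real (dfact m0))\<^sup>2 * ((1 / s) ^ (m0 - 1))\<^sup>2"
  proof -
    have "{2..m0} = insert m0 {2..<m0}" by (auto simp: m0_def)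
    then show ?thesis by (simp add: B_def sum_distrib_right mult.assoc)
  qed
  also have "\<dots> \<le> 63 * (\<mu> ^ 3 / s\<^sup>2) * (3 / s) ^ e + 1 / 2 powr (2 ^ k / 2)"
  proof (intro add_mono mult_right_mono)
    have "m0 = (m0 - 2) + 2" by (simp add: m0_def)
    then show "(\<Sum>m=2..<m0. \<mu> ^ (2 * m - 1) / fact (2 * m - 1) * (real (dfact m))\<^sup>2 * ((1 / s) ^ (m - 1))\<^sup>2 * obstruction_bound m)
        \<le> 63 * (\<mu> ^ 3 / s\<^sup>2)"
      using sum_weight_le[OF \<mu>0 \<mu>s, of "m0 - 2"] s256 by simp
    show "\<mu> ^ (2 * m0 - 1) / fact (2 * m0 - 1) * (real (dfact m0))\<^sup>2 * ((1 / s) ^ (m0 - 1))\<^sup>2 \<le> 1 / 2 powr (2 ^ k / 2)"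
      using weight_large_le[OF assms(1) \<mu>0 _ m0_def] \<mu>s unfolding s_def by simp
  qed (use s256 in auto)
  \<comment> \<open>\<open>63 / s ^ 2 = 7 * (3 / s) ^ 2\<close> and
    \<open>d + 1 = e + 2\<close>.\<close>
  also have "\<dots> = dependence_prob \<mu> d (2 ^ k)"
    by (simp add: dependence_prob_def d s_def power_divide power2_eq_square)
  finally have "real (card (?\<Omega> \<inter> ?bad)) / real (card ?\<Omega>) \<le> dependence_prob \<mu> d (2 ^ k)" .
  then show ?thesis
    using fin\<Omega> pos\<Omega> by (subst measure_pmf_of_set) (auto simp: \<mu>_def)
qed

end
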